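(* Let $\{u_\eta\}$ and $\{\eta\,\mathrm{grad}\,u_\eta\}$ be two uniformly bounded sequences in $L^2(\Omega)$ and $L^2(\Omega;\mathbb{R}^3)$, respectively. Then there exist a subsequence $\{u_{\eta_k}\}$ and a function $u_0\in L^2(\Omega,\mathcal H_\sharp(\mathrm{grad}_{\mathbf R},Y^m))$ such that, as $\eta_k\to0$, in the sense of weak two-scale convergence for the matrix $\mathbf R$, $$u_{\eta_k}\rightharpoonup u_0(\boldsymbol x,\boldsymbol y)\in L^2(\Omega,L^2_\sharp(Y^m)),\qquad \eta_k\,\mathrm{grad}\,u_{\eta_k}\rightharpoonup\mathrm{grad}_{\mathbf R}\,u_0(\boldsymbol x,\boldsymbol y)\in L^2(\Omega,L^2_\sharp(Y^m;\mathbb{R}^3)).$$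
   Context: $\Omega\subset\mathbb{R}^3$ is a bounded open set with Lipschitz boundary; $\eta>0$ is a parameter tending to $0$. $\mathbf R$ is a real matrix with $m$ rows and $3$ columns, $m>3$, satisfying $\mathbf R^T\boldsymbol k\neq\boldsymbol 0$ for all $\boldsymbol k\in\mathbb{Z}^m\setminus\{\boldsymbol 0\}$. $Y^m=]0,1[^m$; the subscript $\sharp$ denotes $Y^m$-periodicity in $\boldsymbol y$. Weak two-scale convergence for $\mathbf R$: $(u_\eta)\subset L^2(\Omega)$ converges to $u_0\in L^2(\Omega\times Y^m)$ if $\lim_{\eta\to0}\int_\Omega u_\eta(\boldsymbol x)\varphi(\boldsymbol x,\mathbf R\boldsymbol x/\eta)\,d\boldsymbol x=\int\!\!\int_{\Omega\times Y^m}u_0\varphi\,d\boldsymbol x\,d\boldsymbol y$ for every $\varphi\in L^2(\Omega,C_\sharp(Y^m))$ (componentwise for vector fields). $\mathrm{grad}_{\mathbf R}\,u=(\mathbf R^T\nabla_{\boldsymbol y})u$, and $\mathcal H_\sharp(\mathrm{grad}_{\mathbf R},Y^m)=\{u\in L^2_\sharp(Y^m):\mathrm{grad}_{\mathbf R}\,u\in L^2_\sharp(Y^m;\mathbb{R}^3)\}$. *)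

theory Defs
  imports "HOL-Analysis.Analysis"
begin

definition L2 :: "'a measure \<Rightarrow> ('a \<Rightarrow> 'b::real_normed_vector) set" where
  "L2 M = {f. f \<in> borel_measurable M \<and> integrable M (\<lambda>x. (norm (f x))\<^sup>2)}"

definition L2_norm :: "'a measure \<Rightarrow> ('a \<Rightarrow> 'b::real_normed_vector) \<Rightarrow> real" where
  "L2_norm M f = sqrt (LINT x|M. (norm (f x))\<^sup>2)"

text \<open>Near each boundary point the set is, in suitable orthonormal coordinates, the open
  region above the graph of a Lipschitz function: the unit vector \<open>\<nu>\<close> is the vertical axis and
  the graph is taken over the hyperplane orthogonal to \<open>\<nu>\<close>.\<close>

definition lipschitz_boundary :: "'a::euclidean_space set \<Rightarrow> bool" where
  "lipschitz_boundary S \<longleftrightarrow>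
    (\<forall>p\<in>frontier S. \<exists>r>0. \<exists>\<nu> \<gamma> L. norm \<nu> = 1 \<and> L-lipschitz_on {z. z \<bullet> \<nu> = 0} \<gamma> \<and>
      S \<inter> ball p r = {x \<in> ball p r. \<gamma> (x - (x \<bullet> \<nu>) *\<^sub>R \<nu>) < x \<bullet> \<nu>})"

definition grad :: "(real^'n \<Rightarrow> real) \<Rightarrow> real^'n \<Rightarrow> real^'n" where
  "grad \<phi> x = (\<chi> i. frechet_derivative \<phi> (at x) (axis i 1))"

primrec C_k :: "nat \<Rightarrow> (real^'n \<Rightarrow> real) \<Rightarrow> bool" where
  "C_k 0 \<phi> \<longleftrightarrow> continuous_on UNIV \<phi>"
| "C_k (Suc k) \<phi> \<longleftrightarrow> (\<forall>x. \<phi> differentiable (at x)) \<and> (\<forall>i. C_k k (\<lambda>x. grad \<phi> x $ i))"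

definition test_functions :: "(real^'n) set \<Rightarrow> (real^'n \<Rightarrow> real) set" where
  "test_functions S = {\<phi>. (\<forall>k. C_k k \<phi>) \<and>
     compact (closure {x. \<phi> x \<noteq> 0}) \<and> closure {x. \<phi> x \<noteq> 0} \<subseteq> S}"

definition locally_integrable ::
  "'a::euclidean_space set \<Rightarrow> ('a \<Rightarrow> 'b::euclidean_space) \<Rightarrow> bool" where
  "locally_integrable S f \<longleftrightarrow> (\<forall>K. compact K \<and> K \<subseteq> S \<longrightarrow> integrable (lebesgue_on K) f)"

text \<open>Gradients are distributional. They are rendered as relations, since a gradient is
  determined only almost everywhere.\<close>

definition has_weak_grad ::
  "(real^'n) set \<Rightarrow> (real^'n \<Rightarrow> real) \<Rightarrow> (real^'n \<Rightarrow> real^'n) \<Rightarrow> bool" where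
  "has_weak_grad S u g \<longleftrightarrow> locally_integrable S u \<and> locally_integrable S g \<and>
    (\<forall>\<phi>\<in>test_functions S. \<forall>i.
      (LINT x|lebesgue_on S. u x * grad \<phi> x $ i) = - (LINT x|lebesgue_on S. g x $ i * \<phi> x))"

text \<open>The \<open>i\<close>-th component of the distribution \<open>R\<^sup>T \<nabla> u\<close> is the sum of
  \<open>R\<^sub>j\<^sub>i \<partial>\<^sub>j u\<close> over \<open>j\<close>; it acts on \<open>\<phi>\<close> as
  minus the integral of \<open>u\<close> against the \<open>i\<close>-th component of \<open>R\<^sup>T \<nabla> \<phi>\<close>.\<close>

definition has_grad_R ::
  "real^'n^'m \<Rightarrow> (real^'m \<Rightarrow> real) \<Rightarrow> (real^'m \<Rightarrow> real^'n) \<Rightarrow> bool" where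
  "has_grad_R R u g \<longleftrightarrow> locally_integrable UNIV u \<and> locally_integrable UNIV g \<and>
    (\<forall>\<phi>\<in>test_functions UNIV. \<forall>i.
      (LINT y|lebesgue. u y * (transpose R *v grad \<phi> y) $ i) = - (LINT y|lebesgue. g y $ i * \<phi> y))"

definition int_vec :: "int^'m \<Rightarrow> real^'m" where
  "int_vec k = (\<chi> i. of_int (k $ i))"

definition unit_cell :: "(real^'m) set" where
  "unit_cell = {y. \<forall>i. 0 < y $ i \<and> y $ i < 1}"

definition cell_periodic :: "(real^'m \<Rightarrow> 'b) \<Rightarrow> bool" where
  "cell_periodic f \<longleftrightarrow> (\<forall>y k. f (y + int_vec k) = f y)"

text \<open>Continuous periodic functions are bounded, so they live in the type of bounded continuous
  functions, whose norm is the supremum norm. The subspace of periodic functions is separable,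
  so Borel and Bochner measurability agree for functions with values in it.\<close>

definition C_sharp :: "((real^'m) \<Rightarrow>\<^sub>C real) set" where
  "C_sharp = {f. cell_periodic (apply_bcontfun f)}"

definition L2_C_sharp :: "(real^'n) set \<Rightarrow> (real^'n \<Rightarrow> ((real^'m) \<Rightarrow>\<^sub>C real)) set" where
  "L2_C_sharp \<Omega> = {\<phi> \<in> L2 (lebesgue_on \<Omega>). \<forall>x\<in>\<Omega>. \<phi> x \<in> C_sharp}"

definition L2_sharp :: "(real^'m \<Rightarrow> 'b::euclidean_space) set" where
  "L2_sharp = {f \<in> L2 (lebesgue_on unit_cell). cell_periodic f}"

definition H_sharp :: "real^'n^'m \<Rightarrow> (real^'m \<Rightarrow> real) set" where
  "H_sharp R = {u \<in> L2_sharp. \<exists>g\<in>L2_sharp. has_grad_R R u g}"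

text \<open>Functions from \<open>\<Omega>\<close> to a space of square integrable functions of \<open>y\<close> are represented by
  jointly measurable functions of \<open>(x, y)\<close>, through the identification of
  \<open>L\<^sup>2(\<Omega>, L\<^sup>2(Y))\<close> with \<open>L\<^sup>2(\<Omega> \<times> Y)\<close>. In \<open>L2_H_sharp\<close>
  the function \<open>G\<close> makes the graph norm square integrable over \<open>\<Omega>\<close>.\<close>

definition L2_L2_sharp ::
  "(real^'n) set \<Rightarrow> (real^'n \<Rightarrow> real^'m \<Rightarrow> 'b::euclidean_space) set" where
  "L2_L2_sharp \<Omega> = {u. (\<lambda>(x, y). u x y) \<in> L2 (lebesgue_on (\<Omega> \<times> unit_cell)) \<and>
     (AE x in lebesgue_on \<Omega>. u x \<in> L2_sharp)}"

definition L2_H_sharp :: "real^'n^'m \<Rightarrow> (real^'n) set \<Rightarrow> (real^'n \<Rightarrow> real^'m \<Rightarrow> real) set" where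
  "L2_H_sharp R \<Omega> = {u \<in> L2_L2_sharp \<Omega>. \<exists>G\<in>L2_L2_sharp \<Omega>.
     AE x in lebesgue_on \<Omega>. u x \<in> H_sharp R \<and> has_grad_R R (u x) (G x)}"

definition two_scale_converges ::
  "real^'n^'m \<Rightarrow> (real^'n) set \<Rightarrow> (nat \<Rightarrow> real) \<Rightarrow> (nat \<Rightarrow> real^'n \<Rightarrow> real) \<Rightarrow>
   (real^'n \<Rightarrow> real^'m \<Rightarrow> real) \<Rightarrow> bool" where
  "two_scale_converges R \<Omega> \<eta> u u0 \<longleftrightarrow>
    (\<forall>n. u n \<in> L2 (lebesgue_on \<Omega>)) \<and>
    (\<lambda>(x, y). u0 x y) \<in> L2 (lebesgue_on (\<Omega> \<times> unit_cell)) \<and>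
    (\<forall>\<phi>\<in>L2_C_sharp \<Omega>.
      (\<lambda>n. LINT x|lebesgue_on \<Omega>. u n x * apply_bcontfun (\<phi> x) ((1 / \<eta> n) *\<^sub>R (R *v x)))
      \<longlonglongrightarrow> (LINT (x, y)|lebesgue_on (\<Omega> \<times> unit_cell). u0 x y * apply_bcontfun (\<phi> x) y))"

definition two_scale_converges_vec ::
  "real^'n^'m \<Rightarrow> (real^'n) set \<Rightarrow> (nat \<Rightarrow> real) \<Rightarrow> (nat \<Rightarrow> real^'n \<Rightarrow> real^'d) \<Rightarrow>
   (real^'n \<Rightarrow> real^'m \<Rightarrow> real^'d) \<Rightarrow> bool" where
  "two_scale_converges_vec R \<Omega> \<eta> w w0 \<longleftrightarrow>
    (\<forall>i. two_scale_converges R \<Omega> \<eta> (\<lambda>n x. w n x $ i) (\<lambda>x y. w0 x y $ i))"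

end

theory Submission
  imports Defs "HOL-Complex_Analysis.Great_Picard"
begin

text \<open>Let \<open>Y\<close> be the unit cell. A two-scale limit is the representative of a limit functional: along a
subsequence, the integrals of \<open>u\<^sub>\<eta>(x) \<phi>(x, R x/\<eta>)\<close> converge to a number \<open>F(\<phi>)\<close>, and \<open>u\<^sub>0\<close> is the
function on \<open>\<Omega> \<times> Y\<close> that represents \<open>F\<close> in \<open>L\<^sup>2\<close>. Three things make this work.

\<^item> The limit \<open>F(\<phi>)\<close> exists for all \<open>\<phi>\<close> along one subsequence. The space of continuous periodic
functions is separable (\<open>C_sharp_separable\<close>). For each \<open>f\<close> in a countable dense set, the functions
\<open>u\<^sub>\<eta>(x) f(R x/\<eta>)\<close> are bounded in \<open>L\<^sup>2(\<Omega>)\<close>, so a common subsequence of them converges weakly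
(\<open>L2_bounded_weakly_convergent_subsequence\<close>). This settles finite sums of products of an indicator
function in \<open>x\<close> and some \<open>f\<close> in \<open>y\<close>, and these are dense (\<open>L2_approx_simple_tests\<close>).

\<^item> \<open>F\<close> is bounded by the norm of \<open>L\<^sup>2(\<Omega> \<times> Y)\<close>, although the approximants only see \<open>\<phi>\<close> along the
surface \<open>y = R x/\<eta>\<close>. This is the mean value property \<open>oscillating_mean_value\<close>: for \<open>f\<close> continuous
and periodic, \<open>f(R x/\<eta>)\<close> converges weakly to the mean of \<open>f\<close>. Moving \<open>x\<close> by \<open>\<eta> s\<close> moves the phase
\<open>R x/\<eta>\<close> by \<open>R s\<close> and changes an integral over a fixed set of \<open>x\<close> by a vanishing amount. The
condition on \<open>R\<close> and Kronecker's theorem make the vectors \<open>R s\<close> dense modulo the integer lattice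
(\<open>orbit_dense_mod_integers\<close>), so asymptotically the integral does not depend on the initial phase, and
averaging over all phases in \<open>Y\<close> yields the mean of \<open>f\<close>.

\<^item> The limit of the gradients is the gradient of the limit. In the weak formulation take the test
function \<open>\<theta>(x) \<Psi>(R x/\<eta>)\<close>, where \<open>\<Psi>\<close> is the periodization of a test function \<open>\<psi>\<close> on the
space of all \<open>y\<close>. Multiplied by \<open>\<eta>\<close>, its gradient is \<open>\<theta> (R\<^sup>T \<nabla>\<Psi>)(R x/\<eta>)\<close> up to a term of order
\<open>\<eta>\<close>. In the limit the pairing of the two-scale limit of \<open>\<eta> \<nabla>u\<^sub>\<eta>\<close> with \<open>\<theta> \<Psi>\<close> is minus the
pairing of \<open>u\<^sub>0\<close> with \<open>\<theta> R\<^sup>T \<nabla>\<Psi>\<close> (\<open>two_scale_gradient_identity\<close>). Since \<open>\<theta>\<close> is arbitrary, this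
holds in \<open>y\<close> alone for almost every \<open>x\<close>, with an exceptional set that separability makes independent of
\<open>\<Psi>\<close>. Cutting the space of all \<open>y\<close> into cells (\<open>integral_unfold\<close>) turns integrals of a periodic
function against \<open>\<psi>\<close> into cell integrals against \<open>\<Psi>\<close>, which is how the distributional identity of
\<open>has_grad_R\<close> arises.\<close>

section \<open>Square integrable functions and weak compactness\<close>

lemma L2_mult_integrable:
  fixes f g :: "'a \<Rightarrow> real"
  assumes "f \<in> L2 M" "g \<in> L2 M"
  shows "integrable M (\<lambda>x. f x * g x)"
proof (rule Bochner_Integration.integrable_bound[of M "\<lambda>x. (f x)\<^sup>2 + (g x)\<^sup>2"])
  show "integrable M (\<lambda>x. (f x)\<^sup>2 + (g x)\<^sup>2)"
    using assms by (auto simp: L2_def)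
  show "(\<lambda>x. f x * g x) \<in> borel_measurable M"
    using assms by (auto simp: L2_def)
  have "\<bar>a * b\<bar> \<le> a\<^sup>2 + b\<^sup>2" for a b :: real
  proof -
    have "2 * (\<bar>a\<bar> * \<bar>b\<bar>) \<le> a\<^sup>2 + b\<^sup>2"
      using sum_squares_bound[of "\<bar>a\<bar>" "\<bar>b\<bar>"] by simp
    moreover have "0 \<le> \<bar>a\<bar> * \<bar>b\<bar>" by simp
    ultimately show ?thesis unfolding abs_mult by linarith
  qed
  then show "AE x in M. norm (f x * g x) \<le> norm ((f x)\<^sup>2 + (g x)\<^sup>2)"
    by simp
qed

lemma L2_sq_integrable: "f \<in> L2 M \<Longrightarrow> integrable M (\<lambda>x. (f x)\<^sup>2)" for f :: "'a \<Rightarrow> real"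
  by (simp add: L2_def)

lemma L2_measurable: "f \<in> L2 M \<Longrightarrow> f \<in> borel_measurable M"
  by (simp add: L2_def)

lemma L2_lincomb:
  fixes f g :: "'a \<Rightarrow> real"
  assumes "f \<in> L2 M" "g \<in> L2 M"
  shows "(\<lambda>x. a * f x + b * g x) \<in> L2 M"
proof -
  have "(\<lambda>x. (norm (a * f x + b * g x))\<^sup>2)
      = (\<lambda>x. a\<^sup>2 * (f x)\<^sup>2 + (b\<^sup>2 * (g x)\<^sup>2 + (2 * a * b) * (f x * g x)))"
    by (rule ext) (simp add: power2_eq_square algebra_simps)
  moreover have "integrable M (\<lambda>x. a\<^sup>2 * (f x)\<^sup>2 + (b\<^sup>2 * (g x)\<^sup>2 + (2 * a * b) * (f x * g x)))"
    using assms by (intro Bochner_Integration.integrable_add integrable_mult_right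
        L2_sq_integrable L2_mult_integrable)
  ultimately show ?thesis
    using assms by (auto simp: L2_def)
qed

lemma L2_add: "f \<in> L2 M \<Longrightarrow> g \<in> L2 M \<Longrightarrow> (\<lambda>x. f x + g x) \<in> L2 M" for f g :: "'a \<Rightarrow> real"
  using L2_lincomb[of f M g 1 1] by simp

lemma L2_diff: "f \<in> L2 M \<Longrightarrow> g \<in> L2 M \<Longrightarrow> (\<lambda>x. f x - g x) \<in> L2 M" for f g :: "'a \<Rightarrow> real"
  using L2_lincomb[of f M g 1 "-1"] by simp

lemma integral_sq_lincomb:
  fixes f g :: "'a \<Rightarrow> real"
  assumes "f \<in> L2 M" "g \<in> L2 M"
  shows "(LINT x|M. (a * f x + b * g x)\<^sup>2)
    = a\<^sup>2 * (LINT x|M. (f x)\<^sup>2) + b\<^sup>2 * (LINT x|M. (g x)\<^sup>2) + 2 * a * b * (LINT x|M. f x * g x)"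
proof -
  have "(\<lambda>x. (a * f x + b * g x)\<^sup>2)
      = (\<lambda>x. a\<^sup>2 * (f x)\<^sup>2 + b\<^sup>2 * (g x)\<^sup>2 + (2 * a * b) * (f x * g x))"
    by (rule ext) (simp add: power2_eq_square algebra_simps)
  then show ?thesis
    using L2_sq_integrable[OF assms(1)] L2_sq_integrable[OF assms(2)] L2_mult_integrable[OF assms]
    by simp
qed

lemma discriminant_nonpos:
  fixes a b c :: real
  assumes "\<And>t. 0 \<le> a + 2 * t * b + t\<^sup>2 * c" and "0 \<le> c"
  shows "b\<^sup>2 \<le> a * c"
proof (cases "c = 0")
  case True
  have "b = 0"
  proof (rule ccontr)
    assume "b \<noteq> 0"
    have "a + 2 * (- (a + 1) / (2 * b)) * b = -1" using \<open>b \<noteq> 0\<close> by (simp add: field_simps)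
    with assms(1)[of "- (a + 1) / (2 * b)"] True show False by simp
  qed
  then show ?thesis using True by simp
next
  case False
  then have c: "c > 0" using assms(2) by simp
  have "0 \<le> a + 2 * (- b / c) * b + (- b / c)\<^sup>2 * c" by (rule assms(1))
  also have "\<dots> = a - b\<^sup>2 / c" using c by (simp add: power2_eq_square)
  finally show ?thesis using c by (simp add: field_simps)
qed

lemma L2_Cauchy_Schwarz:
  fixes f g :: "'a \<Rightarrow> real"
  assumes "f \<in> L2 M" "g \<in> L2 M"
  shows "(LINT x|M. f x * g x)\<^sup>2 \<le> (LINT x|M. (f x)\<^sup>2) * (LINT x|M. (g x)\<^sup>2)"
proof (rule discriminant_nonpos)
  fix t :: real
  have "0 \<le> (LINT x|M. (1 * f x + t * g x)\<^sup>2)" by simp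
  also have "\<dots> = (LINT x|M. (f x)\<^sup>2) + 2 * t * (LINT x|M. f x * g x) + t\<^sup>2 * (LINT x|M. (g x)\<^sup>2)"
    by (subst integral_sq_lincomb[OF assms]) simp
  finally show "0 \<le> (LINT x|M. (f x)\<^sup>2) + 2 * t * (LINT x|M. f x * g x) + t\<^sup>2 * (LINT x|M. (g x)\<^sup>2)" .
qed simp

lemma L2_Cauchy_Schwarz_abs:
  fixes f g :: "'a \<Rightarrow> real"
  assumes "f \<in> L2 M" "g \<in> L2 M"
  shows "\<bar>LINT x|M. f x * g x\<bar> \<le> sqrt (LINT x|M. (f x)\<^sup>2) * sqrt (LINT x|M. (g x)\<^sup>2)"
  using L2_Cauchy_Schwarz[OF assms] by (metis real_sqrt_abs real_sqrt_le_iff real_sqrt_mult)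

lemma L2_convergence_imp_weak:
  fixes f :: "nat \<Rightarrow> 'a \<Rightarrow> real"
  assumes f: "\<And>n. f n \<in> L2 M" and p: "p \<in> L2 M" and w: "w \<in> L2 M"
    and lim: "(\<lambda>n. LINT x|M. (f n x - p x)\<^sup>2) \<longlonglongrightarrow> 0"
  shows "(\<lambda>n. LINT x|M. f n x * w x) \<longlonglongrightarrow> (LINT x|M. p x * w x)"
proof -
  have "(\<lambda>n. sqrt (LINT x|M. (f n x - p x)\<^sup>2) * sqrt (LINT x|M. (w x)\<^sup>2)) \<longlonglongrightarrow> 0"
    using tendsto_mult_left_zero[OF tendsto_real_sqrt[OF lim, simplified]] by simp
  moreover have "\<bar>(LINT x|M. f n x * w x) - (LINT x|M. p x * w x)\<bar>
      \<le> sqrt (LINT x|M. (f n x - p x)\<^sup>2) * sqrt (LINT x|M. (w x)\<^sup>2)" for n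
  proof -
    have "(LINT x|M. f n x * w x) - (LINT x|M. p x * w x) = (LINT x|M. (f n x - p x) * w x)"
      using L2_mult_integrable[OF f w] L2_mult_integrable[OF p w] by (simp add: left_diff_distrib)
    then show ?thesis using L2_Cauchy_Schwarz_abs[OF L2_diff[OF f p] w] by simp
  qed
  ultimately have "(\<lambda>n. (LINT x|M. f n x * w x) - (LINT x|M. p x * w x)) \<longlonglongrightarrow> 0"
    by - (rule Lim_null_comparison[OF always_eventually], simp_all)
  then show ?thesis by (rule LIM_zero_cancel)
qed

lemma integral_abs_le_L2:
  fixes f :: "'a \<Rightarrow> real"
  assumes "finite_measure M" "f \<in> L2 M"
  shows "integrable M f" "(LINT x|M. \<bar>f x\<bar>) \<le> sqrt (measure M (space M)) * sqrt (LINT x|M. (f x)\<^sup>2)"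
proof -
  interpret finite_measure M by fact
  have one: "(\<lambda>x. 1) \<in> L2 M" by (simp add: L2_def)
  show "integrable M f" using L2_mult_integrable[OF one assms(2)] by simp
  have "(\<lambda>x. \<bar>f x\<bar>) \<in> L2 M" using assms(2) by (auto simp: L2_def)
  from L2_Cauchy_Schwarz_abs[OF one this]
  show "(LINT x|M. \<bar>f x\<bar>) \<le> sqrt (measure M (space M)) * sqrt (LINT x|M. (f x)\<^sup>2)"
    by simp
qed

lemma AE_convergent_of_summable_L1_steps:
  fixes f :: "nat \<Rightarrow> 'a \<Rightarrow> real"
  assumes int: "\<And>k. integrable M (f k)"
    and sm: "summable (\<lambda>k. LINT x|M. \<bar>f (Suc k) x - f k x\<bar>)"
  shows "AE x in M. convergent (\<lambda>k. f k x)"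
proof -
  have [measurable]: "\<And>k. f k \<in> borel_measurable M" using int by auto
  have "(\<integral>\<^sup>+x. (\<Sum>k. ennreal \<bar>f (Suc k) x - f k x\<bar>) \<partial>M)
      = (\<Sum>k. (\<integral>\<^sup>+x. ennreal \<bar>f (Suc k) x - f k x\<bar> \<partial>M))"
    by (intro nn_integral_suminf) measurable
  also have "\<dots> = (\<Sum>k. ennreal (LINT x|M. \<bar>f (Suc k) x - f k x\<bar>))"
    by (intro suminf_cong nn_integral_eq_integral) (use int in auto)
  also have "\<dots> = ennreal (\<Sum>k. (LINT x|M. \<bar>f (Suc k) x - f k x\<bar>))"
    using sm by (intro suminf_ennreal2) auto
  finally have "(\<integral>\<^sup>+x. (\<Sum>k. ennreal \<bar>f (Suc k) x - f k x\<bar>) \<partial>M) \<noteq> \<infinity>" by simp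
  then have "AE x in M. (\<Sum>k. ennreal \<bar>f (Suc k) x - f k x\<bar>) \<noteq> \<infinity>"
    by (intro nn_integral_noteq_infinite) auto
  then show ?thesis
  proof (rule AE_mp, intro AE_I2 impI)
    fix x assume "(\<Sum>k. ennreal \<bar>f (Suc k) x - f k x\<bar>) \<noteq> \<infinity>"
    then have "summable (\<lambda>k. \<bar>f (Suc k) x - f k x\<bar>)"
      by (intro summable_suminf_not_top) auto
    then have "summable (\<lambda>k. f (Suc k) x - f k x)"
      by (rule summable_rabs_cancel)
    then have "convergent (\<lambda>n. \<Sum>k<n. f (Suc k) x - f k x)"
      by (simp add: summable_iff_convergent)
    then have "convergent (\<lambda>n. f n x - f 0 x)"
      using sum_lessThan_telescope[of "\<lambda>k. f k x"] by simp
    then have "convergent (\<lambda>n. (f n x - f 0 x) + f 0 x)"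
      by (intro convergent_add convergent_const)
    then show "convergent (\<lambda>n. f n x)" by simp
  qed
qed

text \<open>A subsequence whose consecutive distances decay geometrically converges almost everywhere, because on
a finite measure space the \<open>L\<^sup>1\<close> norm is controlled by the \<open>L\<^sup>2\<close> norm. Fatou's lemma shows that its
pointwise limit is also the \<open>L\<^sup>2\<close> limit.\<close>

lemma L2_complete:
  fixes f :: "nat \<Rightarrow> 'a \<Rightarrow> real"
  assumes fin: "finite_measure M" and f: "\<And>n. f n \<in> L2 M"
    and cauchy: "\<And>e. e > 0 \<Longrightarrow> \<exists>N. \<forall>m\<ge>N. \<forall>n\<ge>N. (LINT x|M. (f m x - f n x)\<^sup>2) < e"
  obtains p where "p \<in> L2 M" "(\<lambda>n. LINT x|M. (f n x - p x)\<^sup>2) \<longlonglongrightarrow> 0"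
proof -
  interpret finite_measure M by fact
  have fm [measurable]: "\<And>n. f n \<in> borel_measurable M" using f by (simp add: L2_def)
  have "\<forall>k. \<exists>N. \<forall>m\<ge>N. \<forall>n\<ge>N. (LINT x|M. (f m x - f n x)\<^sup>2) < (1/4::real)^k"
    using cauchy by auto
  from choice[OF this] obtain N where N: "\<And>k m n. m \<ge> N k \<Longrightarrow> n \<ge> N k \<Longrightarrow> (LINT x|M. (f m x - f n x)\<^sup>2) < (1/4::real)^k"
    by blast
  \<comment> \<open>indices beyond all thresholds up to \<open>k\<close>, so that consecutive distances are summable\<close>
  define s where "s k = k + (\<Sum>i\<le>k. N i)" for k
  have sN: "s k \<ge> N k" and sS: "s (Suc k) \<ge> N k" and sk: "s k \<ge> k" for k
    using member_le_sum[of k "{..k}" N] by (auto simp: s_def)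
  define d where "d k x = f (s (Suc k)) x - f (s k) x" for k x
  have d: "d k \<in> L2 M" for k unfolding d_def by (intro L2_diff f)
  have "(LINT x|M. \<bar>d k x\<bar>) \<le> sqrt (measure M (space M)) * (1/2)^k" for k
  proof -
    have "sqrt (LINT x|M. (d k x)\<^sup>2) \<le> sqrt ((1/4)^k)"
      using N[OF sS sN, of k] by (simp add: d_def)
    also have "\<dots> = (1/2)^k"
      by (simp add: real_sqrt_power real_sqrt_divide)
    finally have "sqrt (measure M (space M)) * sqrt (LINT x|M. (d k x)\<^sup>2) \<le> sqrt (measure M (space M)) * (1/2)^k"
      by (intro mult_left_mono) auto
    with integral_abs_le_L2(2)[OF fin d, of k] show ?thesis by (rule order_trans)
  qed
  then have "\<And>k. norm (LINT x|M. \<bar>d k x\<bar>) \<le> sqrt (measure M (space M)) * (1/2)^k" by simp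
  then have "summable (\<lambda>k. LINT x|M. \<bar>d k x\<bar>)"
    by (rule summable_comparison_test'[of "\<lambda>k. sqrt (measure M (space M)) * (1/2)^k" 0, rotated])
      (auto intro!: summable_mult summable_geometric)
  then have conv: "AE x in M. convergent (\<lambda>k. f (s k) x)"
    unfolding d_def
    by (intro AE_convergent_of_summable_L1_steps integral_abs_le_L2(1)[OF fin] f)
  define p where "p x = lim (\<lambda>k. f (s k) x)" for x
  have pm [measurable]: "p \<in> borel_measurable M"
    unfolding p_def by (rule borel_measurable_lim_metric) auto
  have bnd: "(\<integral>\<^sup>+x. ennreal ((f n x - p x)\<^sup>2) \<partial>M) \<le> ennreal e"
    if e: "\<And>m. m \<ge> K \<Longrightarrow> (LINT x|M. (f n x - f m x)\<^sup>2) \<le> e" for n e K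
  proof -
    have "(\<integral>\<^sup>+x. ennreal ((f n x - p x)\<^sup>2) \<partial>M)
        = (\<integral>\<^sup>+x. liminf (\<lambda>k. ennreal ((f n x - f (s k) x)\<^sup>2)) \<partial>M)"
    proof (rule nn_integral_cong_AE, rule AE_mp[OF conv], intro AE_I2 impI)
      fix x assume "convergent (\<lambda>k. f (s k) x)"
      then have "(\<lambda>k. f (s k) x) \<longlonglongrightarrow> p x" unfolding p_def by (simp add: convergent_LIMSEQ_iff)
      then have "(\<lambda>k. ennreal ((f n x - f (s k) x)\<^sup>2)) \<longlonglongrightarrow> ennreal ((f n x - p x)\<^sup>2)"
        by (intro tendsto_intros)
      then show "ennreal ((f n x - p x)\<^sup>2) = liminf (\<lambda>k. ennreal ((f n x - f (s k) x)\<^sup>2))"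
        using lim_imp_Liminf[OF sequentially_bot] by metis
    qed
    also have "\<dots> \<le> liminf (\<lambda>k. \<integral>\<^sup>+x. ennreal ((f n x - f (s k) x)\<^sup>2) \<partial>M)"
      by (rule nn_integral_liminf) measurable
    also have "\<dots> = liminf (\<lambda>k. ennreal (LINT x|M. (f n x - f (s k) x)\<^sup>2))"
      by (intro arg_cong[where f=liminf] ext nn_integral_eq_integral L2_sq_integrable L2_diff f) auto
    also have "\<dots> \<le> ennreal e"
    proof -
      have "\<forall>\<^sub>F k in sequentially. ennreal (LINT x|M. (f n x - f (s k) x)\<^sup>2) \<le> ennreal e"
        using eventually_ge_at_top[of K]
        by eventually_elim (intro ennreal_leI e, use sk order_trans in blast)
      then show ?thesis
        by (intro Liminf_le) auto
    qed
    finally show ?thesis .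
  qed
  have fpL2: "(\<lambda>x. f n x - p x) \<in> L2 M" if "n \<ge> N 0" for n
  proof -
    have "(\<integral>\<^sup>+x. ennreal ((f n x - p x)\<^sup>2) \<partial>M) \<le> ennreal 1"
      using N[of 0 n] that by (intro bnd[of "N 0"]) (auto intro: less_imp_le)
    also have "\<dots> < \<infinity>" by simp
    finally show ?thesis
      unfolding L2_def by (auto intro!: integrableI_bounded)
  qed
  have "(\<lambda>x. f (N 0) x - (f (N 0) x - p x)) \<in> L2 M"
    by (intro L2_diff f fpL2) auto
  then have p: "p \<in> L2 M" by simp
  have "(\<lambda>n. LINT x|M. (f n x - p x)\<^sup>2) \<longlonglongrightarrow> 0"
  proof (rule LIMSEQ_I)
    fix e :: real assume "e > 0"
    then obtain K where K: "\<forall>m\<ge>K. \<forall>n\<ge>K. (LINT x|M. (f m x - f n x)\<^sup>2) < e / 2"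
      using cauchy[of "e/2"] by auto
    have "(LINT x|M. (f n x - p x)\<^sup>2) \<le> e / 2" if "n \<ge> K" for n
    proof -
      have "ennreal (LINT x|M. (f n x - p x)\<^sup>2) = (\<integral>\<^sup>+x. ennreal ((f n x - p x)\<^sup>2) \<partial>M)"
        by (intro nn_integral_eq_integral[symmetric] L2_sq_integrable L2_diff f p) auto
      also have "\<dots> \<le> ennreal (e / 2)"
        using K that by (intro bnd[of K]) (auto intro: less_imp_le)
      finally show ?thesis using \<open>e > 0\<close> by simp
    qed
    then show "\<exists>no. \<forall>n\<ge>no. norm ((LINT x|M. (f n x - p x)\<^sup>2) - 0) < e"
      using \<open>e > 0\<close> by (intro exI[of _ K]) (force simp: abs_of_nonneg)
  qed
  with p that show ?thesis by blast
qed

text \<open>The Riesz representation theorem on a subspace. The functional is given by its graph \<open>P\<close>, which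
allows it to be described through objects that determine the functions of the subspace but are not
these functions themselves. The representative minimizes \<open>\<parallel>f\<parallel>\<^sup>2 - 2 r\<close> over the closure of the
subspace: minimizing sequences are Cauchy by the parallelogram law, and the minimum is stationary in
the direction of every \<open>(f, r)\<close>. Applied to the functional \<open>f \<mapsto> \<integral>w f\<close>, the same
lemma yields the orthogonal projection of \<open>w\<close>.\<close>

lemma L2_Riesz_graph:
  fixes P :: "(('a \<Rightarrow> real) \<times> real) set"
  assumes fin: "finite_measure M" and ne: "P \<noteq> {}"
    and L2: "\<And>f r. (f, r) \<in> P \<Longrightarrow> f \<in> L2 M"
    and lin: "\<And>f r g s a b. (f, r) \<in> P \<Longrightarrow> (g, s) \<in> P \<Longrightarrow> (\<lambda>x. a * f x + b * g x, a * r + b * s) \<in> P"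
    and bd: "\<And>f r. (f, r) \<in> P \<Longrightarrow> r\<^sup>2 \<le> C * (LINT x|M. (f x)\<^sup>2)"
  obtains p h where "p \<in> L2 M" "\<And>n. h n \<in> fst ` P" "(\<lambda>n. LINT x|M. (h n x - p x)\<^sup>2) \<longlonglongrightarrow> 0"
    "\<And>f r. (f, r) \<in> P \<Longrightarrow> (LINT x|M. p x * f x) = r"
proof -
  define J where "J = (\<lambda>(f, r). (LINT x|M. (f x)\<^sup>2) - 2 * r :: real)"
  have low: "- max C 0 \<le> J q" if "q \<in> P" for q
  proof -
    obtain f r where q: "q = (f, r)" by (cases q)
    define t where "t = (LINT x|M. (f x)\<^sup>2)"
    have t: "t \<ge> 0" by (simp add: t_def)
    have "r\<^sup>2 \<le> max C 0 * t"
      using bd[of f r] that q t by (auto simp: t_def intro: order_trans[OF _ mult_right_mono])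
    also have "\<dots> \<le> ((max C 0 + t) / 2)\<^sup>2"
      using sum_squares_bound[of "max C 0" t] by (simp add: power2_eq_square field_simps)
    finally have "\<bar>r\<bar> \<le> (max C 0 + t) / 2"
      using t by (metis abs_le_square_iff abs_of_nonneg add_nonneg_nonneg divide_nonneg_nonneg max.cobounded2 zero_le_numeral)
    then show ?thesis unfolding q J_def prod.case t_def[symmetric] using t by auto
  qed
  define m where "m = Inf (J ` P)"
  have bb: "bdd_below (J ` P)" by (rule bdd_belowI2[OF low])
  have mle: "m \<le> J q" if "q \<in> P" for q
    unfolding m_def using that bb by (intro cInf_lower) auto
  have "\<exists>q\<in>P. J q < m + inverse (Suc n)" for n
    using cInf_lessD[of "J ` P" "m + inverse (Suc n)"] ne unfolding m_def by auto
  then obtain q where q: "\<And>n. q n \<in> P" "\<And>n. J (q n) < m + inverse (Suc n)" by metis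
  define h where "h n = fst (q n)" for n
  have qh: "(h n, snd (q n)) \<in> P" for n using q(1) by (simp add: h_def)
  have h: "h n \<in> L2 M" for n using L2[OF qh] .
  have par: "(LINT x|M. (h i x - h j x)\<^sup>2) \<le> 2 * (inverse (Suc i) + inverse (Suc j))" for i j
  proof -
    have mid: "(\<lambda>x. (1/2) * h i x + (1/2) * h j x, (1/2) * snd (q i) + (1/2) * snd (q j)) \<in> P"
      by (rule lin[OF qh qh])
    have e1: "(LINT x|M. (h i x - h j x)\<^sup>2)
        = (LINT x|M. (h i x)\<^sup>2) + (LINT x|M. (h j x)\<^sup>2) - 2 * (LINT x|M. h i x * h j x)"
      using integral_sq_lincomb[OF h[of i] h[of j], of 1 "-1"] by simp
    have e2: "(LINT x|M. ((1/2) * h i x + (1/2) * h j x)\<^sup>2)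
        = (LINT x|M. (h i x)\<^sup>2) / 4 + (LINT x|M. (h j x)\<^sup>2) / 4 + (LINT x|M. h i x * h j x) / 2"
      by (subst integral_sq_lincomb[OF h h]) (simp add: power2_eq_square)
    define z where "z = (\<lambda>x. (1/2) * h i x + (1/2) * h j x, (1/2) * snd (q i) + (1/2) * snd (q j))"
    have Jz: "J z = (LINT x|M. ((1/2) * h i x + (1/2) * h j x)\<^sup>2) - (snd (q i) + snd (q j))"
      by (simp add: J_def z_def)
    have Jq: "J (q k) = (LINT x|M. (h k x)\<^sup>2) - 2 * snd (q k)" for k
      by (simp add: J_def h_def case_prod_beta)
    have "m \<le> J z" using mle[OF mid] by (simp add: z_def)
    then show ?thesis
      using q(2)[of i] q(2)[of j] Jq[of i] Jq[of j] unfolding e1 Jz e2 by argo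
  qed
  obtain p where p: "p \<in> L2 M" and hp: "(\<lambda>n. LINT x|M. (h n x - p x)\<^sup>2) \<longlonglongrightarrow> 0"
  proof (rule L2_complete[of M h, OF fin h])
    fix e :: real assume "e > 0"
    then obtain K where K: "inverse (real (Suc K)) < e / 4"
      using reals_Archimedean[of "e/4"] by auto
    have "(LINT x|M. (h a x - h b x)\<^sup>2) < e" if "a \<ge> K" "b \<ge> K" for a b
    proof -
      have "inverse (real (Suc a)) \<le> inverse (real (Suc K))" "inverse (real (Suc b)) \<le> inverse (real (Suc K))"
        using that by (auto intro!: le_imp_inverse_le)
      then show ?thesis using par[of a b] K by argo
    qed
    then show "\<exists>N. \<forall>m\<ge>N. \<forall>n\<ge>N. (LINT x|M. (h m x - h n x)\<^sup>2) < e"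
      by (intro exI[of _ K]) simp
  qed
  have res: "(LINT x|M. p x * f x) = r" if fr: "(f, r) \<in> P" for f r
  proof -
    have f: "f \<in> L2 M" using L2[OF fr] .
    define b where "b = (LINT x|M. p x * f x) - r"
    have "0 \<le> 0 + 2 * t * b + t\<^sup>2 * (LINT x|M. (f x)\<^sup>2)" for t
    proof -
      have ineq: "m \<le> m + inverse (Suc n) + 2 * t * ((LINT x|M. h n x * f x) - r) + t\<^sup>2 * (LINT x|M. (f x)\<^sup>2)" for n
      proof -
        have "(\<lambda>x. 1 * h n x + t * f x, 1 * snd (q n) + t * r) \<in> P" by (rule lin[OF qh fr])
        from mle[OF this] have "m \<le> J (q n) + 2 * t * ((LINT x|M. h n x * f x) - r) + t\<^sup>2 * (LINT x|M. (f x)\<^sup>2)"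
          unfolding J_def prod.case integral_sq_lincomb[OF h f]
          by (simp add: h_def case_prod_beta right_diff_distrib)
        then show ?thesis using q(2)[of n] by linarith
      qed
      have "(\<lambda>n. m + inverse (Suc n) + 2 * t * ((LINT x|M. h n x * f x) - r) + t\<^sup>2 * (LINT x|M. (f x)\<^sup>2))
          \<longlonglongrightarrow> m + 0 + 2 * t * ((LINT x|M. p x * f x) - r) + t\<^sup>2 * (LINT x|M. (f x)\<^sup>2)"
        by (intro tendsto_intros LIMSEQ_inverse_real_of_nat L2_convergence_imp_weak h p f hp)
      then have "m \<le> m + 0 + 2 * t * ((LINT x|M. p x * f x) - r) + t\<^sup>2 * (LINT x|M. (f x)\<^sup>2)"
        using ineq by (intro LIMSEQ_le_const) auto
      then show ?thesis by (simp add: b_def)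
    qed
    from discriminant_nonpos[OF this] have "b = 0" by simp
    then show ?thesis by (simp add: b_def)
  qed
  have hP: "h n \<in> fst ` P" for n using q(1) by (auto simp: h_def)
  show ?thesis by (rule that[OF p hP hp res])
qed

lemma convergent_subsequence_countable:
  fixes f :: "nat \<Rightarrow> 'a \<Rightarrow> real"
  assumes "countable S" and B: "\<And>n x. x \<in> S \<Longrightarrow> \<bar>f n x\<bar> \<le> B x"
  obtains k where "strict_mono (k :: nat \<Rightarrow> nat)" "\<And>x. x \<in> S \<Longrightarrow> convergent (\<lambda>n. f (k n) x)"
proof -
  have pos: "0 < 1 + \<bar>B x\<bar>" for x by linarith
  have nb: "norm (f n x / (1 + \<bar>B x\<bar>)) \<le> 1" if "x \<in> S" for n x
  proof -
    have "\<bar>f n x\<bar> \<le> 1 + \<bar>B x\<bar>" using B[OF that, of n] by linarith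
    then show ?thesis using pos[of x] by (simp add: abs_div_pos[symmetric])
  qed
  have "\<exists>k. strict_mono (k :: nat \<Rightarrow> nat) \<and> (\<forall>x\<in>S. \<exists>l. (\<lambda>n. f (k n) x / (1 + \<bar>B x\<bar>)) \<longlonglongrightarrow> l)"
    by (rule function_convergent_subsequence[of S "\<lambda>n x. f n x / (1 + \<bar>B x\<bar>)" 1, OF assms(1) nb]; blast)
  then obtain k where k: "strict_mono (k :: nat \<Rightarrow> nat)"
    "\<forall>x\<in>S. \<exists>l. (\<lambda>n. f (k n) x / (1 + \<bar>B x\<bar>)) \<longlonglongrightarrow> l" by blast
  have "convergent (\<lambda>n. f (k n) x)" if "x \<in> S" for x
  proof -
    obtain l where "(\<lambda>n. f (k n) x / (1 + \<bar>B x\<bar>)) \<longlonglongrightarrow> l" using k(2) \<open>x \<in> S\<close> by blast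
    then have "(\<lambda>n. f (k n) x / (1 + \<bar>B x\<bar>) * (1 + \<bar>B x\<bar>)) \<longlonglongrightarrow> l * (1 + \<bar>B x\<bar>)"
      by (rule tendsto_mult_right)
    then show ?thesis using pos[of x] by (simp add: convergent_def) (rule exI)
  qed
  from that[OF k(1) this] show ?thesis .
qed

inductive_set lin_hull :: "('a \<Rightarrow> real) set \<Rightarrow> ('a \<Rightarrow> real) set" for E where
  gen: "f \<in> E \<Longrightarrow> f \<in> lin_hull E"
| lincomb: "f \<in> lin_hull E \<Longrightarrow> g \<in> lin_hull E \<Longrightarrow> (\<lambda>x. a * f x + b * g x) \<in> lin_hull E"

lemma convergent_of_uniform_approx:
  fixes a :: "nat \<Rightarrow> real"
  assumes "\<And>e. e > 0 \<Longrightarrow> \<exists>b. convergent b \<and> (\<forall>n. \<bar>a n - b n\<bar> \<le> e)"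
  shows "convergent a"
proof -
  have "Cauchy a"
  proof (rule CauchyI)
    fix e :: real assume "e > 0"
    then obtain b where b: "convergent b" "\<And>n. \<bar>a n - b n\<bar> \<le> e / 4"
      using assms[of "e/4"] by auto
    then obtain K where K: "\<forall>m\<ge>K. \<forall>n\<ge>K. norm (b m - b n) < e / 4"
      using convergent_Cauchy CauchyD[of b "e/4"] \<open>e > 0\<close> by auto
    have "norm (a m - a n) < e" if "m \<ge> K" "n \<ge> K" for m n
      using K[rule_format, OF that] b(2)[of m] b(2)[of n] \<open>e > 0\<close> unfolding real_norm_def by linarith
    then show "\<exists>K. \<forall>m\<ge>K. \<forall>n\<ge>K. norm (a m - a n) < e" by blast
  qed
  then show ?thesis by (rule Cauchy_convergent)
qed

text \<open>A diagonal argument makes the inner products with every member of the families converge. This gives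
convergence against the linear hull of the families, then against its closure by the uniform bound. An
arbitrary \<open>w\<close> may be replaced by its orthogonal projection to this closure.\<close>

lemma L2_bounded_weakly_convergent_subsequence:
  fixes e :: "'c \<Rightarrow> nat \<Rightarrow> 'a \<Rightarrow> real"
  assumes fin: "finite_measure M" and cnt: "countable I"
    and e: "\<And>c n. c \<in> I \<Longrightarrow> e c n \<in> L2 M" and B: "\<And>c n. c \<in> I \<Longrightarrow> (LINT x|M. (e c n x)\<^sup>2) \<le> B c"
  obtains r where "strict_mono (r :: nat \<Rightarrow> nat)"
    "\<And>c w. c \<in> I \<Longrightarrow> w \<in> L2 M \<Longrightarrow> convergent (\<lambda>n. LINT x|M. e c (r n) x * w x)"
proof -
  define g where "g n = (\<lambda>(c, c', n'). LINT x|M. e c n x * e c' n' x)" for n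
  have bd: "\<bar>g n z\<bar> \<le> (\<lambda>(c, c', n'). sqrt (B c) * sqrt (B c')) z" if z: "z \<in> I \<times> I \<times> UNIV" for n z
  proof -
    obtain c c' n' where zz: "z = (c, c', n')" "c \<in> I" "c' \<in> I" using z by auto
    have "\<bar>LINT x|M. e c n x * e c' n' x\<bar> \<le> sqrt (LINT x|M. (e c n x)\<^sup>2) * sqrt (LINT x|M. (e c' n' x)\<^sup>2)"
      by (intro L2_Cauchy_Schwarz_abs e zz)
    also have "\<dots> \<le> sqrt (B c) * sqrt (B c')"
    proof (rule mult_mono)
      have "0 \<le> (LINT x|M. (e c n x)\<^sup>2)" by simp
      also have "\<dots> \<le> B c" using B[OF zz(2)] .
      finally show "0 \<le> sqrt (B c)" by simp
    qed (use B[OF zz(2)] B[OF zz(3)] in auto)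
    finally show ?thesis by (simp add: zz g_def)
  qed
  have "countable (I \<times> I \<times> (UNIV :: nat set))" using cnt by simp
  from convergent_subsequence_countable[of _ g, OF this bd] obtain r where r: "strict_mono (r :: nat \<Rightarrow> nat)"
    "\<And>z. z \<in> I \<times> I \<times> (UNIV::nat set) \<Longrightarrow> convergent (\<lambda>n. g (r n) z)"
    by blast
  define E where "E = {e c n | c n. c \<in> I}"
  have hull: "f \<in> L2 M" "c \<in> I \<Longrightarrow> convergent (\<lambda>n. LINT x|M. e c (r n) x * f x)"
    if "f \<in> lin_hull E" for f c
    using that
  proof (induction)
    case (gen f)
    { case 1 then show ?case using gen e by (auto simp: E_def) }
    { case 2
      then obtain c' n' where "f = e c' n'" "c' \<in> I" using gen by (auto simp: E_def)
      then show ?case using r(2)[of "(c, c', n')"] 2 by (simp add: g_def) }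
  next
    case (lincomb f g a b)
    { case 1 then show ?case using lincomb by (intro L2_lincomb) }
    { case 2
      have "(LINT x|M. e c (r n) x * (a * f x + b * g x))
          = a * (LINT x|M. e c (r n) x * f x) + b * (LINT x|M. e c (r n) x * g x)" for n
        using L2_mult_integrable[OF e lincomb.IH(1), OF 2] L2_mult_integrable[OF e lincomb.IH(3), OF 2]
        by (simp add: distrib_left mult.left_commute)
      then show ?case using lincomb 2
        by (auto intro!: convergent_add convergent_mult convergent_const) }
  qed
  have "convergent (\<lambda>n. LINT x|M. e c (r n) x * w x)" if c: "c \<in> I" and w: "w \<in> L2 M" for c w
  proof -
    \<comment> \<open>\<open>p\<close> is the orthogonal projection of \<open>w\<close> to the closure of the hull\<close>
    define P where "P = {(f, LINT x|M. w x * f x) | f. f \<in> lin_hull E}"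
    have cE: "e c n \<in> lin_hull E" for n using c by (auto simp: E_def intro: lin_hull.gen)
    obtain p h where p: "p \<in> L2 M" and h: "\<And>n. h n \<in> fst ` P"
      and hp: "(\<lambda>n. LINT x|M. (h n x - p x)\<^sup>2) \<longlonglongrightarrow> 0"
      and pr: "\<And>f r. (f, r) \<in> P \<Longrightarrow> (LINT x|M. p x * f x) = r"
    proof (rule L2_Riesz_graph[of M P "LINT x|M. (w x)\<^sup>2"])
      show "P \<noteq> {}" using cE by (auto simp: P_def)
      show "f \<in> L2 M" if "(f, s) \<in> P" for f s using that hull(1) by (auto simp: P_def)
      show "(\<lambda>x. a * f x + b * g x, a * s + b * t) \<in> P" if "(f, s) \<in> P" "(g, t) \<in> P" for f s g t a b
      proof -
        have fg: "f \<in> lin_hull E" "g \<in> lin_hull E" "s = (LINT x|M. w x * f x)" "t = (LINT x|M. w x * g x)"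
          using that by (auto simp: P_def)
        have "a * s + b * t = (LINT x|M. w x * (a * f x + b * g x))"
          using L2_mult_integrable[OF w hull(1)[OF fg(1)]] L2_mult_integrable[OF w hull(1)[OF fg(2)]]
          by (simp add: fg distrib_left mult.left_commute)
        then show ?thesis using fg by (auto simp: P_def intro: lin_hull.lincomb)
      qed
      show "s\<^sup>2 \<le> (LINT x|M. (w x)\<^sup>2) * (LINT x|M. (f x)\<^sup>2)" if "(f, s) \<in> P" for f s
        using that L2_Cauchy_Schwarz[OF w hull(1)] by (auto simp: P_def)
    qed (use fin in auto)
    have hL: "h n \<in> lin_hull E" for n using h[of n] by (auto simp: P_def)
    have ew: "(LINT x|M. e c (r n) x * w x) = (LINT x|M. e c (r n) x * p x)" for n
      using pr[of "e c (r n)"] cE by (auto simp: P_def mult.commute)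
    show ?thesis unfolding ew
    proof (rule convergent_of_uniform_approx)
      fix \<epsilon> :: real assume "\<epsilon> > 0"
      have "(\<lambda>n. sqrt (B c) * sqrt (LINT x|M. (h n x - p x)\<^sup>2)) \<longlonglongrightarrow> sqrt (B c) * sqrt 0"
        by (intro tendsto_intros hp)
      then have "(\<lambda>n. sqrt (B c) * sqrt (LINT x|M. (h n x - p x)\<^sup>2)) \<longlonglongrightarrow> 0" by simp
      from order_tendstoD(2)[OF this \<open>\<epsilon> > 0\<close>] obtain j where
        j: "sqrt (B c) * sqrt (LINT x|M. (h j x - p x)\<^sup>2) < \<epsilon>"
        by (auto simp: eventually_sequentially)
      have "\<bar>(LINT x|M. e c (r n) x * p x) - (LINT x|M. e c (r n) x * h j x)\<bar> \<le> \<epsilon>" for n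
      proof -
        have hj: "h j \<in> L2 M" using hull(1) hL by blast
        have "(LINT x|M. e c (r n) x * h j x) - (LINT x|M. e c (r n) x * p x)
            = (LINT x|M. e c (r n) x * (h j x - p x))"
          using L2_mult_integrable[OF e[OF c] p] L2_mult_integrable[OF e[OF c] hj] by (simp add: right_diff_distrib)
        then have "\<bar>(LINT x|M. e c (r n) x * p x) - (LINT x|M. e c (r n) x * h j x)\<bar>
            \<le> sqrt (LINT x|M. (e c (r n) x)\<^sup>2) * sqrt (LINT x|M. (h j x - p x)\<^sup>2)"
          using L2_Cauchy_Schwarz_abs[OF e[OF c] L2_diff[OF hj p], of "r n"] by (simp add: abs_minus_commute)
        also have "\<dots> \<le> sqrt (B c) * sqrt (LINT x|M. (h j x - p x)\<^sup>2)"
          using B[OF c] by (intro mult_right_mono) auto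
        finally show ?thesis using j by simp
      qed
      then show "\<exists>b. convergent b \<and> (\<forall>n. \<bar>(LINT x|M. e c (r n) x * p x) - b n\<bar> \<le> \<epsilon>)"
        using hull(2)[OF hL c] by blast
    qed
  qed
  from that[OF r(1) this] show ?thesis .
qed

section \<open>Separability of the continuous periodic functions\<close>

text \<open>One point chosen from each member of countably many covers of vanishing mesh.\<close>

lemma countable_dense_if_small_countable_covers:
  fixes S :: "'a::metric_space set"
  assumes "\<And>e. e > 0 \<Longrightarrow> \<exists>C. countable C \<and> S \<subseteq> \<Union>C \<and> (\<forall>A\<in>C. \<forall>x\<in>A \<inter> S. \<forall>y\<in>A \<inter> S. dist x y < e)"
  obtains D where "countable D" "D \<subseteq> S" "S \<subseteq> closure D"
proof -
  have "\<forall>n. \<exists>C. countable C \<and> S \<subseteq> \<Union>C \<and> (\<forall>A\<in>C. \<forall>x\<in>A \<inter> S. \<forall>y\<in>A \<inter> S. dist x y < inverse (real (Suc n)))"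
    by (rule allI, rule assms) simp
  from choice[OF this] obtain C where C0: "\<forall>n. countable (C n) \<and> S \<subseteq> \<Union>(C n) \<and>
    (\<forall>A\<in>C n. \<forall>x\<in>A \<inter> S. \<forall>y\<in>A \<inter> S. dist x y < inverse (real (Suc n)))" ..
  have C: "countable (C n)" "S \<subseteq> \<Union>(C n)" for n using C0 by simp_all
  have C3: "dist x y < inverse (real (Suc n))" if "A \<in> C n" "x \<in> A \<inter> S" "y \<in> A \<inter> S" for n A x y
    using C0[rule_format, of n] that by blast
  define pick where "pick A = (SOME x. x \<in> A \<inter> S)" for A
  have pick: "pick A \<in> A \<inter> S" if "x \<in> A \<inter> S" for A x
    unfolding pick_def using that by (rule someI)
  define D where "D = (\<Union>n. pick ` {A \<in> C n. A \<inter> S \<noteq> {}})"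
  have "countable D" unfolding D_def using C(1) by (intro countable_UN countable_image) (auto intro: countable_subset)
  moreover have "D \<subseteq> S" using pick by (fastforce simp: D_def)
  moreover have "S \<subseteq> closure D"
  proof
    fix x assume x: "x \<in> S"
    show "x \<in> closure D" unfolding closure_approachable
    proof (intro allI impI)
      fix e :: real assume "e > 0"
      then obtain n where n: "inverse (real (Suc n)) < e" using reals_Archimedean by blast
      obtain A where A: "A \<in> C n" "x \<in> A" using C(2)[of n] x by blast
      have "pick A \<in> D" using A x by (auto simp: D_def)
      moreover have "dist (pick A) x < e"
        using C3[OF A(1) pick[of x A], of x] A x n by auto
      ultimately show "\<exists>y\<in>D. dist y x < e" by blast
    qed
  qed
  ultimately show ?thesis by (rule that)
qed

lemma countable_dense_subset:
  fixes S :: "'a::metric_space set"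
  assumes "countable D" "S \<subseteq> closure D"
  obtains D' where "countable D'" "D' \<subseteq> S" "S \<subseteq> closure D'"
proof (rule countable_dense_if_small_countable_covers[of S])
  fix e :: real assume "e > 0"
  define C where "C = (\<lambda>d. ball d (e/2)) ` D"
  have "countable C" using assms by (simp add: C_def)
  moreover have "S \<subseteq> \<Union>C"
  proof
    fix x assume "x \<in> S"
    then obtain d where "d \<in> D" "dist d x < e/2"
      using assms(2) \<open>e > 0\<close> closure_approachable[of x D] by (meson half_gt_zero subsetD)
    then show "x \<in> \<Union>C" by (auto simp: C_def)
  qed
  moreover have "dist x y < e" if "A \<in> C" "x \<in> A \<inter> S" "y \<in> A \<inter> S" for A x y
    using that by (auto simp: C_def intro: dist_triangle_half_r)
  ultimately show "\<exists>C. countable C \<and> S \<subseteq> \<Union>C \<and> (\<forall>A\<in>C. \<forall>x\<in>A \<inter> S. \<forall>y\<in>A \<inter> S. dist x y < e)" by blast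
qed (rule that)

definition cell_floor :: "real^'m \<Rightarrow> int^'m" where
  "cell_floor y = (\<chi> i. \<lfloor>y $ i\<rfloor>)"

definition cell_frac :: "real^'m \<Rightarrow> real^'m" where
  "cell_frac y = y - int_vec (cell_floor y)"

lemma int_vec_nth [simp]: "int_vec k $ i = of_int (k $ i)"
  by (simp add: int_vec_def)

lemma int_vec_simps: "int_vec 0 = 0" "int_vec (- k) = - int_vec k" "int_vec (k + l) = int_vec k + int_vec l"
  by (simp_all add: vec_eq_iff)

lemma cell_frac_nth: "cell_frac y $ i = frac (y $ i)"
  by (simp add: cell_frac_def cell_floor_def frac_def)

lemma cell_frac_bounds: "0 \<le> cell_frac y $ i" "cell_frac y $ i < 1"
  by (simp_all add: cell_frac_nth frac_lt_1)

lemma cell_frac_in_cbox: "cell_frac y \<in> cbox 0 1"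
  by (simp add: mem_box_cart cell_frac_bounds less_imp_le)

lemma cell_frac_id: "(\<And>i. 0 \<le> y $ i \<and> y $ i < 1) \<Longrightarrow> cell_frac y = y"
  by (simp add: vec_eq_iff cell_frac_nth frac_eq)

lemma cell_frac_periodic: "cell_frac (y + int_vec k) = cell_frac y"
  by (simp add: vec_eq_iff cell_frac_nth)

lemma cell_periodic_cell_frac: "cell_periodic f \<Longrightarrow> f (cell_frac y) = f y"
  unfolding cell_periodic_def cell_frac_def
  by (metis add_uminus_conv_diff int_vec_simps(2))

lemma C_sharp_dist_le_cbox:
  fixes f g :: "(real^'m) \<Rightarrow>\<^sub>C real"
  assumes "f \<in> C_sharp" "g \<in> C_sharp" "\<And>y. y \<in> cbox 0 1 \<Longrightarrow> \<bar>f y - g y\<bar> \<le> e"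
  shows "dist f g \<le> e"
proof (rule dist_bound)
  fix x
  have "f x = f (cell_frac x)" "g x = g (cell_frac x)"
    using assms(1,2) by (simp_all add: C_sharp_def cell_periodic_cell_frac)
  then show "dist (f x) (g x) \<le> e"
    using assms(3)[OF cell_frac_in_cbox] by (simp add: dist_real_def)
qed

lemma C_sharp_uniformly_continuous_cbox:
  fixes f :: "(real^'m) \<Rightarrow>\<^sub>C real"
  assumes "e > 0"
  obtains n :: nat where "\<And>y z. y \<in> cbox a b \<Longrightarrow> z \<in> cbox a b \<Longrightarrow> dist y z < inverse (real (Suc n)) \<Longrightarrow> \<bar>f y - f z\<bar> < e"
proof -
  have "uniformly_continuous_on (cbox a b) f"
    by (intro compact_uniformly_continuous) auto
  then obtain d where d: "d > 0" "\<And>y z. y \<in> cbox a b \<Longrightarrow> z \<in> cbox a b \<Longrightarrow> dist z y < d \<Longrightarrow> dist (f z) (f y) < e"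
    unfolding uniformly_continuous_on_def using assms by blast
  obtain n where "inverse (real (Suc n)) < d" using reals_Archimedean d(1) by blast
  with d(2) show ?thesis by (intro that[of n]) (fastforce simp: dist_real_def)
qed

text \<open>A function is encoded by a mesh size adapted to its modulus of continuity on the closed cell, together
with its rounded values on a finite mesh of that size. There are countably many codes, and two functions
with the same code are uniformly close.\<close>

lemma C_sharp_separable:
  obtains D where "countable D" "D \<subseteq> (C_sharp :: ((real^'m) \<Rightarrow>\<^sub>C real) set)" "C_sharp \<subseteq> closure D"
proof (rule countable_dense_if_small_countable_covers[of "C_sharp :: ((real^'m) \<Rightarrow>\<^sub>C real) set"])
  fix e :: real assume e: "e > 0"
  define \<delta> where "\<delta> = e / 4"
  have \<delta>: "\<delta> > 0" using e by (simp add: \<delta>_def)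
  let ?K = "cbox 0 1 :: (real^'m) set"
  have "\<exists>G. finite G \<and> G \<subseteq> ?K \<and> ?K \<subseteq> (\<Union>g\<in>G. ball g (inverse (real (Suc n))))" for n
  proof -
    have cov: "?K \<subseteq> (\<Union>g\<in>?K. ball g (inverse (real (Suc n))))"
    proof
      fix x assume "x \<in> ?K"
      then show "x \<in> (\<Union>g\<in>?K. ball g (inverse (real (Suc n))))" by (intro UN_I[of x]) auto
    qed
    show ?thesis
      by (rule compactE_image[OF compact_cbox _ cov]) auto
  qed
  then obtain G where G: "\<And>n. finite (G n)" "\<And>n. G n \<subseteq> ?K"
    "\<And>n. ?K \<subseteq> (\<Union>g\<in>G n. ball g (inverse (real (Suc n))))" by metis
  have "\<forall>f::(real^'m) \<Rightarrow>\<^sub>C real. \<exists>n. \<forall>y\<in>?K. \<forall>z\<in>?K. dist y z < inverse (real (Suc n)) \<longrightarrow> \<bar>f y - f z\<bar> < \<delta>"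
    by (meson C_sharp_uniformly_continuous_cbox[OF \<delta>])
  from choice[OF this] obtain N :: "((real^'m) \<Rightarrow>\<^sub>C real) \<Rightarrow> nat" where N0: "\<forall>f::(real^'m) \<Rightarrow>\<^sub>C real. \<forall>y\<in>?K. \<forall>z\<in>?K.
      dist y z < inverse (real (Suc (N f))) \<longrightarrow> \<bar>f y - f z\<bar> < \<delta>" ..
  have N: "\<bar>apply_bcontfun f y - f z\<bar> < \<delta>"
    if "y \<in> ?K" "z \<in> ?K" "dist y z < inverse (real (Suc (N f)))" for f :: "(real^'m) \<Rightarrow>\<^sub>C real" and y z
    using N0 that by simp
  define code where "code f = (N f, restrict (\<lambda>g. \<lfloor>apply_bcontfun f g / \<delta>\<rfloor>) (G (N f)))" for f
  define C where "C = (\<lambda>c. {f. code f = c}) ` range code"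
  have "range code \<subseteq> Sigma UNIV (\<lambda>n. PiE (G n) (\<lambda>_. UNIV))" by (auto simp: code_def)
  moreover have "countable (Sigma (UNIV::nat set) (\<lambda>n. PiE (G n) (\<lambda>_. UNIV :: int set)))"
    by (intro countable_SIGMA countable_PiE) (use G(1) in auto)
  ultimately have "countable (range code)" by (rule countable_subset)
  then have "countable C" by (simp add: C_def)
  moreover have "C_sharp \<subseteq> \<Union>C" by (auto simp: C_def)
  moreover have "dist f h < e" if "A \<in> C" "f \<in> A \<inter> C_sharp" "h \<in> A \<inter> C_sharp" for A f h
  proof -
    have c: "code f = code h" using that by (auto simp: C_def)
    then have NN: "N f = N h" by (simp add: code_def)
    have "dist f h \<le> 3 * \<delta>"
    proof (rule C_sharp_dist_le_cbox)
      fix y :: "real^'m" assume y: "y \<in> ?K"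
      then obtain g where g: "g \<in> G (N f)" "dist g y < inverse (real (Suc (N f)))"
        using G(3)[of "N f"] by (auto simp: subset_eq)
      have gK: "g \<in> ?K" using g(1) G(2) by blast
      have "(snd (code f)) g = (snd (code h)) g" using c by simp
      then have "\<lfloor>f g / \<delta>\<rfloor> = \<lfloor>h g / \<delta>\<rfloor>" using g(1) by (simp add: code_def NN)
      then have "\<bar>f g / \<delta> - h g / \<delta>\<bar> < 1" by linarith
      then have "\<bar>(f g - h g) / \<delta>\<bar> < 1" by (simp add: diff_divide_distrib)
      then have "\<bar>f g - h g\<bar> < \<delta>" using \<delta> by (simp add: abs_div_pos[symmetric])
      moreover have "\<bar>f g - f y\<bar> < \<delta>" using N[OF gK y g(2)] .
      moreover have "\<bar>h g - h y\<bar> < \<delta>" using N[OF gK y, of h] g(2) NN by simp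
      ultimately show "\<bar>f y - h y\<bar> \<le> 3 * \<delta>" by linarith
    qed (use that in auto)
    then show ?thesis using e by (simp add: \<delta>_def)
  qed
  ultimately show "\<exists>C. countable C \<and> C_sharp \<subseteq> \<Union>C \<and>
      (\<forall>A\<in>C. \<forall>x\<in>A \<inter> C_sharp. \<forall>y\<in>A \<inter> C_sharp. dist x (y::(real^'m) \<Rightarrow>\<^sub>C real) < e)" by blast
qed (rule that)

section \<open>Approximation by simple test functions\<close>

text \<open>The Borel sigma algebra of the space of bounded continuous functions does not behave well under pairing,
since the space is not separable. Functions with values in the closure of a countable set
are therefore handled through the index of the first element of the set that is close to the value.\<close>

lemma dense_index_measurable:
  fixes \<phi> :: "'a \<Rightarrow> 'b::metric_space" and d :: "nat \<Rightarrow> 'b"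
  assumes [measurable]: "\<phi> \<in> borel_measurable M"
  shows "(\<lambda>x. LEAST j. dist (\<phi> x) (d j) < \<delta>) \<in> measurable M (count_space UNIV)"
proof (rule measurable_Least)
  fix j
  have "{b. dist b (d j) < \<delta>} \<in> sets borel"
    by (intro borel_open open_Collect_less continuous_intros)
  then have "(\<lambda>b. dist b (d j) < \<delta>) \<in> measurable borel (count_space UNIV)"
    by (simp add: pred_def)
  then show "(\<lambda>x. dist (\<phi> x) (d j) < \<delta>) \<in> measurable M (count_space UNIV)"
    by measurable
qed

lemma dense_index:
  fixes d :: "nat \<Rightarrow> 'b::metric_space"
  assumes "b \<in> closure (range d)" "\<delta> > 0"
  shows "dist b (d (LEAST j. dist b (d j) < \<delta>)) < \<delta>"
proof -
  have "\<exists>j. dist b (d j) < \<delta>"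
    using assms unfolding closure_approachable by (auto simp: dist_commute)
  then show ?thesis by (rule LeastI_ex)
qed

text \<open>Evaluation at a moving point: the function is a pointwise limit of functions that take countably many
values, and for each such value the measurability is that of a single continuous function.\<close>

lemma bcontfun_eval_measurable:
  fixes \<phi> :: "'a \<Rightarrow> ('b::{second_countable_topology, t2_space} \<Rightarrow>\<^sub>C real)"
  assumes \<phi>: "\<phi> \<in> borel_measurable M" and D: "countable D" "\<And>x. x \<in> space M \<Longrightarrow> \<phi> x \<in> closure D"
    and g [measurable]: "g \<in> measurable M borel"
  shows "(\<lambda>x. apply_bcontfun (\<phi> x) (g x)) \<in> borel_measurable M"
proof (cases "D = {}")
  case True
  then have "space M = {}" using D(2) by auto
  then show ?thesis by (auto intro: measurable_empty_iff[THEN iffD2] simp: measurable_def)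
next
  case False
  then obtain d where d: "D = range (d :: nat \<Rightarrow> _)" using D(1) uncountable_def by blast
  define N where "N n x = (LEAST j. dist (\<phi> x) (d j) < inverse (real (Suc n)))" for n x
  have N [measurable]: "N n \<in> measurable M (count_space UNIV)" for n
    unfolding N_def by (rule dense_index_measurable[OF \<phi>])
  show ?thesis
  proof (rule borel_measurable_LIMSEQ_metric)
    show "(\<lambda>x. apply_bcontfun (d (N n x)) (g x)) \<in> borel_measurable M" for n
    proof (rule measurable_compose_countable[OF _ N])
      fix j
      have "apply_bcontfun (d j) \<in> borel_measurable borel"
        by (intro borel_measurable_continuous_onI) simp
      then show "(\<lambda>x. apply_bcontfun (d j) (g x)) \<in> borel_measurable M"
        by (rule measurable_compose[OF g])
    qed
    fix x assume x: "x \<in> space M"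
    have "dist (apply_bcontfun (d (N n x)) (g x)) (apply_bcontfun (\<phi> x) (g x)) \<le> inverse (real (Suc n))" for n
    proof -
      have "dist (\<phi> x) (d (N n x)) < inverse (real (Suc n))"
        unfolding N_def using D(2)[OF x] d by (intro dense_index) auto
      then show ?thesis
        using dist_bounded[of "d (N n x)" "g x" "\<phi> x"] by (simp add: dist_commute)
    qed
    then show "(\<lambda>n. apply_bcontfun (d (N n x)) (g x)) \<longlonglongrightarrow> apply_bcontfun (\<phi> x) (g x)"
      unfolding tendsto_dist_iff[of _ "apply_bcontfun (\<phi> x) (g x)"]
      by (intro tendsto_sandwich[OF _ _ tendsto_const LIMSEQ_inverse_real_of_nat] always_eventually allI) auto
  qed
qed

inductive_set simple_tests :: "'a measure \<Rightarrow> 'b set \<Rightarrow> ('a \<Rightarrow> 'b::real_normed_vector) set" for M D where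
  base: "A \<in> sets M \<Longrightarrow> d \<in> D \<Longrightarrow> (\<lambda>x. (c * indicator A x) *\<^sub>R d) \<in> simple_tests M D"
| add: "s \<in> simple_tests M D \<Longrightarrow> t \<in> simple_tests M D \<Longrightarrow> (\<lambda>x. s x + t x) \<in> simple_tests M D"

lemma simple_tests_scale:
  "s \<in> simple_tests M D \<Longrightarrow> (\<lambda>x. a *\<^sub>R s x) \<in> simple_tests M D"
proof (induction rule: simple_tests.induct)
  case (base A d c)
  then have "(\<lambda>x. ((a * c) * indicator A x) *\<^sub>R d) \<in> simple_tests M D" by (rule simple_tests.base)
  then show ?case by (simp add: mult.assoc)
next
  case (add s t)
  then show ?case by (simp add: scaleR_add_right simple_tests.add)
qed

text \<open>Stated as a difference from a Borel function, since in a space without a countable base measurability is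
not preserved by general sums.\<close>

lemma simple_tests_diff_measurable:
  assumes "s \<in> simple_tests M D" "\<phi> \<in> borel_measurable M"
  shows "(\<lambda>x. \<phi> x - s x) \<in> borel_measurable M"
  using assms
proof (induction arbitrary: \<phi>)
  case (base A d c)
  have "(\<lambda>b. b - c *\<^sub>R d) \<in> borel_measurable borel"
    by (intro borel_measurable_continuous_onI continuous_intros)
  from measurable_compose[OF base.prems this]
  have "(\<lambda>x. if x \<in> A then \<phi> x - c *\<^sub>R d else \<phi> x) \<in> borel_measurable M"
    using base by (intro measurable_If_set) auto
  moreover have "(\<lambda>x. if x \<in> A then \<phi> x - c *\<^sub>R d else \<phi> x) = (\<lambda>x. \<phi> x - (c * indicator A x) *\<^sub>R d)"
    by (auto simp: indicator_def)
  ultimately show ?case by simp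
next
  case (add s t)
  have "(\<lambda>x. (\<phi> x - s x) - t x) \<in> borel_measurable M" by (intro add.IH add.prems)
  then show ?case by (simp add: diff_diff_add)
qed

lemma simple_tests_measurable:
  assumes "s \<in> simple_tests M D" shows "s \<in> borel_measurable M"
proof -
  have "(\<lambda>x. 0 - (-1) *\<^sub>R s x) \<in> borel_measurable M"
    by (intro simple_tests_diff_measurable[OF simple_tests_scale[OF assms]]) simp
  then show ?thesis by simp
qed

lemma simple_tests_bounded:
  assumes "s \<in> simple_tests M D"
  obtains B where "\<And>x. norm (s x) \<le> B"
proof -
  have "\<exists>B. \<forall>x. norm (s x) \<le> B" using assms
  proof induction
    case (base A d c)
    then show ?case by (intro exI[of _ "\<bar>c\<bar> * norm d"]) (auto simp: indicator_def)
  next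
    case (add s t)
    then obtain B C where "\<And>x. norm (s x) \<le> B" "\<And>x. norm (t x) \<le> C" by blast
    then show ?case by (intro exI[of _ "B + C"]) (meson add_mono norm_triangle_le)
  qed
  then show ?thesis using that by blast
qed

lemma simple_tests_sum:
  fixes K :: nat
  assumes "\<And>j. A j \<in> sets M" "\<And>j. d j \<in> D"
  shows "(\<lambda>x. \<Sum>j<K. indicator (A j) x *\<^sub>R d j) \<in> simple_tests M D"
proof (induction K)
  case 0
  have "(\<lambda>x. (0 * indicator {} x) *\<^sub>R d 0) \<in> simple_tests M D" by (intro simple_tests.base assms) auto
  then show ?case by simp
next
  case (Suc K)
  have "(\<lambda>x. (1 * indicator (A K) x) *\<^sub>R d K) \<in> simple_tests M D" by (intro simple_tests.base assms)
  from simple_tests.add[OF Suc this] show ?case by simp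
qed

text \<open>Replace \<open>\<phi> x\<close> by the first element of the dense sequence at distance less than \<open>\<delta>\<close>, and by \<open>0\<close>
where the index of this element is large. The first change costs little because the measure is finite,
the second one by dominated convergence.\<close>

lemma L2_approx_simple_tests:
  fixes \<phi> :: "'a \<Rightarrow> 'b::real_normed_vector"
  assumes fin: "finite_measure M" and \<phi>: "\<phi> \<in> L2 M"
    and D: "countable D" "D \<noteq> {}" "\<And>x. x \<in> space M \<Longrightarrow> \<phi> x \<in> closure D" and e: "e > 0"
  obtains s where "s \<in> simple_tests M D" "(\<lambda>x. \<phi> x - s x) \<in> L2 M" "(LINT x|M. (norm (\<phi> x - s x))\<^sup>2) < e"
proof -
  interpret finite_measure M by fact
  have [measurable]: "\<phi> \<in> borel_measurable M" using \<phi> by (simp add: L2_def)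
  have int\<phi>: "integrable M (\<lambda>x. (norm (\<phi> x))\<^sup>2)" using \<phi> by (simp add: L2_def)
  obtain d where d: "D = range (d :: nat \<Rightarrow> _)" using D(1,2) uncountable_def by blast
  define \<mu> where "\<mu> = measure M (space M)"
  have \<mu>: "\<mu> \<ge> 0" by (simp add: \<mu>_def)
  \<comment> \<open>\<open>\<delta>\<^sup>2\<close> times the total mass is at most \<open>e / 2\<close>; the summand \<open>1\<close> avoids division by zero\<close>
  define \<delta> where "\<delta> = sqrt (e / (2 * (\<mu> + 1)))"
  have \<delta>: "\<delta> > 0" using e \<mu> by (simp add: \<delta>_def)
  have "\<delta>\<^sup>2 * \<mu> = (e / 2) * (\<mu> / (\<mu> + 1))" using e \<mu> by (simp add: \<delta>_def)
  also have "\<dots> \<le> (e / 2) * 1" using e \<mu> by (intro mult_left_mono) auto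
  finally have \<delta>2: "\<delta>\<^sup>2 * \<mu> \<le> e / 2" by simp
  define N where "N x = (LEAST j. dist (\<phi> x) (d j) < \<delta>)" for x
  have N [measurable]: "N \<in> measurable M (count_space UNIV)"
    unfolding N_def by (rule dense_index_measurable) measurable
  define A where "A j = {x \<in> space M. N x = j}" for j
  have A [measurable]: "A j \<in> sets M" for j unfolding A_def by measurable
  define s where "s K x = (\<Sum>j<K. indicator (A j) x *\<^sub>R d j)" for K :: nat and x
  have s: "s K \<in> simple_tests M D" for K
    unfolding s_def using A d by (intro simple_tests_sum) auto
  have sx: "s K x = (if N x < K then d (N x) else 0)" if "x \<in> space M" for K x
  proof -
    have "s K x = (\<Sum>j<K. if j = N x then d j else 0)"
      unfolding s_def using that by (intro sum.cong) (auto simp: A_def)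
    then show ?thesis by simp
  qed
  have near: "norm (\<phi> x - d (N x)) < \<delta>" if "x \<in> space M" for x
    using dense_index[of "\<phi> x" d \<delta>] D(3)[OF that] d \<delta> by (simp add: N_def dist_norm)
  define T where "T K x = (if N x < K then 0 else (norm (\<phi> x))\<^sup>2)" for K x
  have Tm [measurable]: "T K \<in> borel_measurable M" for K
    unfolding T_def by (intro measurable_If borel_measurable_power borel_measurable_norm) measurable
  have Tint: "integrable M (T K)" for K
    by (rule Bochner_Integration.integrable_bound[OF int\<phi>]) (auto simp: T_def)
  have bound: "(norm (\<phi> x - s K x))\<^sup>2 \<le> \<delta>\<^sup>2 + T K x" if "x \<in> space M" for x K
  proof (cases "N x < K")
    case True
    then show ?thesis using near[OF that] sx[OF that, of K] \<delta>
      by (simp add: T_def power_mono less_imp_le)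
  next
    case False
    then show ?thesis using sx[OF that, of K] by (simp add: T_def)
  qed
  have "(\<lambda>K. LINT x|M. T K x) \<longlonglongrightarrow> (LINT x|M. 0)"
  proof (rule integral_dominated_convergence[OF _ _ int\<phi>])
    show "AE x in M. (\<lambda>K. T K x) \<longlonglongrightarrow> 0"
    proof (rule AE_I2)
      fix x
      have "\<forall>\<^sub>F K in sequentially. T K x = 0"
        using eventually_gt_at_top[of "N x"] by eventually_elim (simp add: T_def)
      then show "(\<lambda>K. T K x) \<longlonglongrightarrow> 0" by (rule tendsto_eventually)
    qed
    show "AE x in M. norm (T K x) \<le> (norm (\<phi> x))\<^sup>2" for K by (rule AE_I2) (simp add: T_def)
  qed auto
  then have "\<forall>\<^sub>F K in sequentially. (LINT x|M. T K x) < e / 2"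
    using e by (intro order_tendstoD(2)) auto
  then obtain K where K: "(LINT x|M. T K x) < e / 2" by (auto simp: eventually_sequentially)
  have m: "(\<lambda>x. \<phi> x - s K x) \<in> borel_measurable M"
    by (intro simple_tests_diff_measurable[OF s]) measurable
  have "(\<lambda>b::'b. (norm b)\<^sup>2) \<in> borel_measurable borel"
    by (intro borel_measurable_continuous_onI continuous_intros)
  from measurable_compose[OF m this] have mn: "(\<lambda>x. (norm (\<phi> x - s K x))\<^sup>2) \<in> borel_measurable M" .
  have i: "integrable M (\<lambda>x. \<delta>\<^sup>2 + T K x)" using Tint by simp
  have int: "integrable M (\<lambda>x. (norm (\<phi> x - s K x))\<^sup>2)"
  proof (rule Bochner_Integration.integrable_bound[OF i mn], rule AE_I2)
    fix x assume "x \<in> space M"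
    from bound[OF this, of K] show "norm ((norm (\<phi> x - s K x))\<^sup>2) \<le> norm (\<delta>\<^sup>2 + T K x)" by simp
  qed
  have "(LINT x|M. (norm (\<phi> x - s K x))\<^sup>2) \<le> (LINT x|M. \<delta>\<^sup>2 + T K x)"
    by (rule integral_mono[OF int i bound])
  also have "\<dots> = \<delta>\<^sup>2 * \<mu> + (LINT x|M. T K x)"
    using Tint by (simp add: \<mu>_def)
  also have "\<dots> < e" using \<delta>2 K by simp
  finally show ?thesis using int m by (intro that[OF s[of K]]) (simp_all add: L2_def)
qed

section \<open>Translations and dense orbits on the torus\<close>

lemma lborel_translate:
  fixes f :: "'a::euclidean_space \<Rightarrow> 'b::{banach, second_countable_topology}"
  assumes [measurable]: "f \<in> borel_measurable borel"
  shows "(LINT x|lborel. f (x + h)) = (LINT x|lborel. f x)"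
    and "integrable lborel (\<lambda>x. f (x + h)) \<longleftrightarrow> integrable lborel f"
proof -
  have "(LINT x|lborel. f x) = (LINT x|distr lborel borel ((+) h). f x)"
    by (simp add: lborel_distr_plus)
  also have "\<dots> = (LINT x|lborel. f (h + x))" by (subst integral_distr) auto
  finally show "(LINT x|lborel. f (x + h)) = (LINT x|lborel. f x)" by (simp add: add.commute)
  have "integrable lborel f \<longleftrightarrow> integrable (distr lborel borel ((+) h)) f"
    by (simp add: lborel_distr_plus)
  also have "\<dots> \<longleftrightarrow> integrable lborel (\<lambda>x. f (h + x))" by (subst integrable_distr_eq) auto
  finally show "integrable lborel (\<lambda>x. f (x + h)) \<longleftrightarrow> integrable lborel f" by (simp add: add.commute)
qed

lemma bounded_borel_inner_outer:
  fixes A :: "'a::euclidean_space set"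
  assumes A: "A \<in> sets borel" "bounded A" and e: "(e::real) > 0"
  obtains S T where "compact S" "S \<subseteq> A" "open T" "A \<subseteq> T"
    "integrable lborel (indicator (T - S) :: 'a \<Rightarrow> real)" "(LINT x|lborel. indicator (T - S) x :: real) < e"
proof -
  have AL: "A \<in> sets lebesgue" using A by (simp add: sets_completionI_sets)
  obtain T where T: "open T" "A \<subseteq> T" "T - A \<in> lmeasurable" "emeasure lebesgue (T - A) < ennreal (e/2)"
    using sets_lebesgue_outer_open[OF AL, of "e/2"] e by auto
  obtain S where S: "closed S" "S \<subseteq> A" "A - S \<in> lmeasurable" "emeasure lebesgue (A - S) < ennreal (e/2)"
    using sets_lebesgue_inner_closed[OF AL, of "e/2"] e by auto
  have comp: "compact S" using S A(2) by (meson bounded_subset compact_eq_bounded_closed)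
  have b: "T - S \<in> sets borel" using T S by auto
  have eq: "T - S = (T - A) \<union> (A - S)" using T S by auto
  have "emeasure lborel (T - S) = emeasure lebesgue (T - S)" using b by simp
  also have "\<dots> \<le> emeasure lebesgue (T - A) + emeasure lebesgue (A - S)"
    unfolding eq using T S by (intro emeasure_subadditive) auto
  also have "\<dots> < ennreal (e/2) + ennreal (e/2)" using T(4) S(4) by (rule add_strict_mono)
  also have "\<dots> = ennreal e" using e by (simp flip: ennreal_plus)
  finally have lt: "emeasure lborel (T - S) < ennreal e" .
  then have fin: "emeasure lborel (T - S) < \<infinity>" by (rule less_trans) simp
  have "integrable lborel (indicator (T - S) :: 'a \<Rightarrow> real)"
    using b fin by (intro integrable_real_indicator) auto
  moreover have "(LINT x|lborel. indicator (T - S) x :: real) < e"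
  proof -
    have "ennreal (measure lborel (T - S)) < ennreal e"
      using lt fin by (simp add: emeasure_eq_ennreal_measure)
    then show ?thesis using b by (simp add: ennreal_less_iff)
  qed
  ultimately show ?thesis using that comp S(2) T(1,2) by blast
qed

text \<open>Squeeze \<open>A\<close> between a compact set and an open set with difference of small measure. A small
translation does not move the compact set out of the open one.\<close>

lemma indicator_translation_continuous:
  fixes A :: "'a::euclidean_space set" and h :: "nat \<Rightarrow> 'a"
  assumes A: "A \<in> sets borel" "bounded A" and h: "h \<longlonglongrightarrow> 0"
  shows "(\<lambda>n. LINT x|lborel. \<bar>indicator A (x + h n) - indicator A x :: real\<bar>) \<longlonglongrightarrow> 0"
proof (rule LIMSEQ_I)
  fix e :: real assume e: "e > 0"
  obtain S T where ST: "compact S" "S \<subseteq> A" "open T" "A \<subseteq> T"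
    and i: "integrable lborel (indicator (T - S) :: 'a \<Rightarrow> real)"
    and lt: "(LINT x|lborel. indicator (T - S) x) < e / 4"
    using bounded_borel_inner_outer[OF A, of "e/4"] e by auto
  have Sb [measurable]: "S \<in> sets borel" and Tb [measurable]: "T \<in> sets borel" and [measurable]: "A \<in> sets borel"
    using ST A by (auto simp: borel_compact)
  obtain d where d: "d > 0" "(\<Union>x\<in>S. ball x d) \<subseteq> T"
    using compact_subset_open_imp_ball_epsilon_subset[OF ST(1,3)] ST(2,4) by auto
  have iS: "integrable lborel (indicator S :: 'a \<Rightarrow> real)"
    using ST(1) by (intro integrable_real_indicator) (auto simp: compact_imp_bounded emeasure_bounded_finite[simplified])
  have "\<exists>N. \<forall>n\<ge>N. norm (h n) < d" using LIMSEQ_D[OF h d(1)] by simp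
  then obtain N where N: "\<And>n. n \<ge> N \<Longrightarrow> norm (h n) < d" by blast
  have main: "(LINT x|lborel. \<bar>indicator A (x + h n) - indicator A x :: real\<bar>) < e" if n: "n \<ge> N" for n
  proof -
    \<comment> \<open>the last bracket has integral \<open>0\<close>; where a point of \<open>T - S\<close> moves into \<open>S\<close>, the factor \<open>3\<close> outweighs its value \<open>-1\<close>\<close>
    let ?g = "\<lambda>x. indicator (T - S) (x + h n) + 3 * indicator (T - S) x + (indicator S x - indicator S (x + h n)) :: real"
    have pt: "\<bar>indicator A (x + h n) - indicator A x :: real\<bar> \<le> ?g x" for x
    proof -
      have "x \<in> T" if "x + h n \<in> S"
      proof -
        have "x \<in> ball (x + h n) d" using N[OF n] by (simp add: dist_norm)
        then show ?thesis using d(2) that by blast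
      qed
      then show ?thesis using ST(2,4) by (auto simp: indicator_def)
    qed
    have it: "integrable lborel (\<lambda>x. indicator (T - S) (x + h n) :: real)" "integrable lborel (\<lambda>x. indicator S (x + h n) :: real)"
      using i iS by (subst lborel_translate(2); simp)+
    have "(LINT x|lborel. \<bar>indicator A (x + h n) - indicator A x :: real\<bar>) \<le> (LINT x|lborel. ?g x)"
    proof (rule integral_mono)
      show ig: "integrable lborel ?g" using it i iS by simp
      show "integrable lborel (\<lambda>x. \<bar>indicator A (x + h n) - indicator A x :: real\<bar>)"
      proof (rule Bochner_Integration.integrable_bound[OF ig])
        show "(\<lambda>x. \<bar>indicator A (x + h n) - indicator A x :: real\<bar>) \<in> borel_measurable lborel" by measurable
        show "AE x in lborel. norm \<bar>indicator A (x + h n) - indicator A x :: real\<bar> \<le> norm (?g x)"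
        proof (rule AE_I2)
          fix x show "norm \<bar>indicator A (x + h n) - indicator A x :: real\<bar> \<le> norm (?g x)"
            using pt[of x] by simp
        qed
      qed
    qed (rule pt)
    also have "\<dots> = 4 * (LINT x|lborel. indicator (T - S) x)"
    proof -
      have t1: "(LINT x|lborel. indicator (T - S) (x + h n) :: real) = (LINT x|lborel. indicator (T - S) x)"
        by (rule lborel_translate(1)) measurable
      have t2: "(LINT x|lborel. indicator S (x + h n) :: real) = (LINT x|lborel. indicator S x)"
        by (rule lborel_translate(1)) measurable
      have "(LINT x|lborel. ?g x) = (LINT x|lborel. indicator (T - S) (x + h n)) + 3 * (LINT x|lborel. indicator (T - S) x)
          + ((LINT x|lborel. indicator S x) - (LINT x|lborel. indicator S (x + h n)))"
        using it i iS by (simp only: Bochner_Integration.integral_add Bochner_Integration.integral_diff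
            integral_mult_right_zero integrable_mult_right Bochner_Integration.integrable_add Bochner_Integration.integrable_diff)
      then show ?thesis unfolding t1 t2 by simp
    qed
    also have "\<dots> < e" using lt by simp
    finally show ?thesis .
  qed
  have "norm ((LINT x|lborel. \<bar>indicator A (x + h n) - indicator A x :: real\<bar>) - 0) < e" if "n \<ge> N" for n
    using main[OF that] by (simp add: abs_of_nonneg)
  then show "\<exists>no. \<forall>n\<ge>no. norm ((LINT x|lborel. \<bar>indicator A (x + h n) - indicator A x :: real\<bar>) - 0) < e" by blast
qed

text \<open>For each integer vector \<open>k \<noteq> 0\<close> the unwanted \<open>v\<close> form a hyperplane, because \<open>R\<^sup>T k \<noteq> 0\<close>.
Countably many hyperplanes do not cover the space.\<close>

lemma irrational_direction:
  fixes R :: "real^'n^'m"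
  assumes irr: "\<And>k :: int^'m. k \<noteq> 0 \<Longrightarrow> transpose R *v int_vec k \<noteq> 0"
  obtains v where "\<And>k :: int^'m. k \<noteq> 0 \<Longrightarrow> int_vec k \<bullet> (R *v v) \<noteq> 0"
proof -
  let ?H = "\<lambda>k :: int^'m. {v. (transpose R *v int_vec k) \<bullet> v = 0}"
  have "negligible (\<Union>k\<in>{k. k \<noteq> 0}. ?H k)"
  proof (rule negligible_countable_Union)
    show "countable (?H ` {k. k \<noteq> 0})" by (intro countable_image countableI_type)
    fix X assume "X \<in> ?H ` {k. k \<noteq> 0}"
    then obtain k where "k \<noteq> 0" "X = ?H k" by blast
    then show "negligible X" using irr[of k] negligible_hyperplane by blast
  qed
  then have "(\<Union>k\<in>{k. k \<noteq> 0}. ?H k) \<noteq> UNIV" using non_negligible_UNIV by metis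
  then obtain v where v: "v \<notin> (\<Union>k\<in>{k. k \<noteq> 0}. ?H k)" by blast
  have "int_vec k \<bullet> (R *v v) \<noteq> 0" if "k \<noteq> 0" for k :: "int^'m"
    using v that by (auto simp: dot_lmul_matrix)
  then show ?thesis by (rule that)
qed

lemma inner_real_vec: "x \<bullet> y = (\<Sum>i\<in>UNIV. x $ i * y $ i)" for x y :: "real^'m"
  by (simp add: inner_vec_def)

text \<open>Along a direction \<open>v\<close> as in the previous lemma, the coordinates of \<open>R v\<close> are linearly independent
over the integers, and Kronecker's theorem applies to the line spanned by \<open>R v\<close>.\<close>

lemma orbit_dense_mod_integers:
  fixes R :: "real^'n^'m" and t :: "real^'m"
  assumes irr: "\<And>k :: int^'m. k \<noteq> 0 \<Longrightarrow> transpose R *v int_vec k \<noteq> 0" and "\<delta> > 0"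
  obtains s k where "dist t (R *v s + int_vec k) < \<delta>"
proof -
  obtain v where v: "\<And>k :: int^'m. k \<noteq> 0 \<Longrightarrow> int_vec k \<bullet> (R *v v) \<noteq> 0"
    using irrational_direction[OF irr] by blast
  define \<theta> where "\<theta> i = (R *v v) $ i" for i
  have v0: "k = 0" if "(\<Sum>i\<in>UNIV. of_int (k $ i) * \<theta> i) = 0" for k :: "int^'m"
    using v[of k] that by (auto simp: inner_real_vec \<theta>_def)
  have inj: "inj \<theta>"
  proof (rule injI, rule ccontr)
    fix i j assume ij: "\<theta> i = \<theta> j" "i \<noteq> j"
    \<comment> \<open>a coincidence would be an integer relation with coefficients \<open>1\<close> and \<open>-1\<close>\<close>
    define k :: "int^'m" where "k = (\<chi> l. (if l = i then 1 else 0) - (if l = j then 1 else 0))"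
    have "(\<Sum>l\<in>UNIV. of_int (k $ l) * \<theta> l) = (\<Sum>l\<in>UNIV. (if l = i then \<theta> l else 0) - (if l = j then \<theta> l else 0))"
      by (intro sum.cong) (auto simp: k_def)
    also have "\<dots> = 0" using ij by (simp add: sum_subtractf)
    finally have "k = 0" by (rule v0)
    then have "k $ i = 0" by simp
    then show False using ij by (simp add: k_def)
  qed
  obtain e where e: "bij_betw e {0..<CARD('m)} (UNIV :: 'm set)"
    using ex_bij_betw_nat_finite[OF finite_class.finite_UNIV] by blast
  have einj: "inj_on e {..<CARD('m)}" and eimg: "e ` {..<CARD('m)} = UNIV"
    using e by (auto simp: bij_betw_def atLeast0LessThan)
  interpret Modules.module "(\<lambda>r. (*) (real_of_int r))"
    by (simp add: Modules.module.intro distrib_left mult.commute)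
  have ind: "independent ((\<theta> \<circ> e) ` {..<CARD('m)})"
    unfolding independent_explicit_module
  proof (intro allI impI)
    fix T u w assume T: "finite T" "T \<subseteq> (\<theta> \<circ> e) ` {..<CARD('m)}" and s: "(\<Sum>v\<in>T. real_of_int (u v) * v) = 0" and w: "w \<in> T"
    define k :: "int^'m" where "k = (\<chi> i. if \<theta> i \<in> T then u (\<theta> i) else 0)"
    have Tr: "T \<subseteq> range \<theta>" using T(2) by auto
    have "(\<Sum>i\<in>UNIV. of_int (k $ i) * \<theta> i) = (\<Sum>i\<in>\<theta> -` T. of_int (u (\<theta> i)) * \<theta> i)"
      by (rule sum.mono_neutral_cong_right) (auto simp: k_def)
    also have "\<dots> = (\<Sum>v\<in>\<theta> ` (\<theta> -` T). of_int (u v) * v)"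
      by (subst sum.reindex) (use inj in \<open>auto intro: inj_on_subset\<close>)
    also have "\<theta> ` (\<theta> -` T) = T" using Tr by auto
    finally have "k = 0" using s v0 by simp
    obtain i where i: "w = \<theta> i" using Tr w by auto
    have "k $ i = 0" using \<open>k = 0\<close> by simp
    then show "u w = 0" using i w by (simp add: k_def)
  qed
  have inj2: "inj_on (\<theta> \<circ> e) {..<CARD('m)}"
    using einj inj by (intro comp_inj_on) (auto intro: inj_on_subset)
  define \<epsilon> where "\<epsilon> = \<delta> / (2 * real CARD('m))"
  have \<epsilon>: "\<epsilon> > 0" using \<open>\<delta> > 0\<close> by (simp add: \<epsilon>_def)
  obtain \<tau> h where th: "\<And>i. i < CARD('m) \<Longrightarrow> \<bar>\<tau> * (\<theta> \<circ> e) i - of_int (h i) - t $ e i\<bar> < \<epsilon>"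
    using Kronecker_thm_1[OF ind inj2 \<epsilon>, of "\<lambda>i. t $ e i"] by blast
  define e' where "e' = inv_into {..<CARD('m)} e"
  have e': "e' i < CARD('m)" "e (e' i) = i" for i
    using eimg inv_into_into[of i e "{..<CARD('m)}"] f_inv_into_f[of i e "{..<CARD('m)}"] by (auto simp: e'_def)
  define k :: "int^'m" where "k = (\<chi> i. - h (e' i))"
  let ?z = "t - (R *v (\<tau> *\<^sub>R v) + int_vec k)"
  have "\<bar>?z $ i\<bar> < \<epsilon>" for i
  proof -
    have "?z $ i = - (\<tau> * (\<theta> \<circ> e) (e' i) - of_int (h (e' i)) - t $ e (e' i))"
      by (simp add: k_def e' \<theta>_def matrix_vector_mult_scaleR)
    then show ?thesis using th[OF e'(1)[of i]] by (simp only: abs_minus_cancel)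
  qed
  then have "norm ?z \<le> (\<Sum>i\<in>(UNIV::'m set). \<epsilon>)"
    by (intro order_trans[OF norm_le_l1_cart] sum_mono) (auto intro: less_imp_le)
  also have "\<dots> < \<delta>" using \<open>\<delta> > 0\<close> by (simp add: \<epsilon>_def)
  finally show ?thesis by (intro that[of "\<tau> *\<^sub>R v" k]) (simp add: dist_norm)
qed

section \<open>Integration of periodic functions\<close>

abbreviation cell_measure :: "(real^'m) measure" where
  "cell_measure \<equiv> restrict_space lborel unit_cell"

lemma unit_cell_box: "unit_cell = box 0 (1 :: real^'m)"
  by (auto simp: unit_cell_def mem_box_cart)

lemma unit_cell_borel [measurable]: "unit_cell \<in> sets borel" by (simp add: unit_cell_box)

lemma space_cell_measure [simp]: "space cell_measure = unit_cell"
  by (simp add: space_restrict_space)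

lemma emeasure_unit_cell: "emeasure lborel (unit_cell :: (real^'m) set) = 1"
proof -
  have "emeasure lborel (unit_cell :: (real^'m) set) = (\<Prod>b\<in>Basis. (1 - 0 :: real^'m) \<bullet> b)"
    unfolding unit_cell_box by (rule emeasure_lborel_box) (auto simp: Basis_vec_def inner_axis)
  also have "(\<Prod>b\<in>Basis. (1 - 0 :: real^'m) \<bullet> b) = 1"
    by (intro prod.neutral) (auto simp: Basis_vec_def inner_axis)
  finally show ?thesis by simp
qed

lemma cell_measure_total [simp]: "measure cell_measure (unit_cell :: (real^'m) set) = 1"
  by (simp add: measure_def emeasure_restrict_space emeasure_unit_cell)

lemma finite_cell_measure: "finite_measure (cell_measure :: (real^'m) measure)"
  by (rule finite_measureI) (simp add: emeasure_restrict_space emeasure_unit_cell)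

lemma cell_integral_eq: "(LINT y|cell_measure. f y) = (LINT y|lborel. indicator unit_cell y * f y)" for f :: "real^'m \<Rightarrow> real"
  by (subst integral_restrict_space) auto

lemma cell_integrable_iff: "integrable cell_measure f \<longleftrightarrow> integrable lborel (\<lambda>y. indicator unit_cell y * f y)" for f :: "real^'m \<Rightarrow> real"
  by (subst integrable_restrict_space) auto

lemma borel_cell: "f \<in> borel_measurable borel \<Longrightarrow> f \<in> borel_measurable cell_measure"
  by (rule measurable_restrict_space1) simp

lemma cell_integrable_bounded:
  fixes f :: "real^'m \<Rightarrow> real"
  assumes "f \<in> borel_measurable borel" "\<And>y. \<bar>f y\<bar> \<le> B"
  shows "integrable cell_measure f"
proof (rule finite_measure.integrable_const_bound[OF finite_cell_measure])
  show "AE y in cell_measure. norm (f y) \<le> B" by (rule AE_I2) (simp add: assms(2))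
  show "f \<in> borel_measurable cell_measure" by (rule borel_cell[OF assms(1)])
qed

lemma finite_int_vecs:
  assumes "bounded (int_vec ` K :: (real^'m) set)" shows "finite (K :: (int^'m) set)"
proof -
  obtain B where B: "\<And>k. k \<in> K \<Longrightarrow> norm (int_vec k :: real^'m) \<le> B"
    using assms by (auto simp: bounded_iff)
  have "vec_nth ` K \<subseteq> PiE UNIV (\<lambda>_. {-\<lceil>B\<rceil>..\<lceil>B\<rceil>})"
  proof (clarsimp simp: PiE_iff)
    fix k i assume "k \<in> K"
    have "\<bar>of_int (k $ i) :: real\<bar> \<le> B"
      using B[OF \<open>k \<in> K\<close>] component_le_norm_cart[of "int_vec k :: real^'m" i] by simp
    then show "- \<lceil>B\<rceil> \<le> k $ i \<and> k $ i \<le> \<lceil>B\<rceil>" by linarith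
  qed
  then have "finite (vec_nth ` K)" by (rule finite_subset) (auto intro!: finite_PiE)
  then show ?thesis by (rule finite_imageD) (auto simp: inj_on_def vec_eq_iff)
qed

text \<open>Away from this null set, each point lies in exactly one integer translate of the open unit cell.\<close>

lemma AE_no_integer_coordinate: "AE y in lborel. \<forall>i. (y :: real^'m) $ i \<notin> \<int>"
proof -
  have "AE y in lborel. (y :: real^'m) $ i \<noteq> of_int c" for i c
  proof -
    have "negligible {y :: real^'m. axis i 1 \<bullet> y = of_int c}"
      by (rule negligible_hyperplane) (simp add: axis_eq_0_iff)
    moreover have "{y :: real^'m. axis i 1 \<bullet> y = of_int c} = {y. y $ i = of_int c}"
      by (simp add: inner_axis')
    ultimately have "{y :: real^'m. y $ i = of_int c} \<in> null_sets lebesgue"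
      by (simp add: negligible_iff_null_sets)
    moreover have "{y :: real^'m. y $ i = of_int c} \<in> sets borel"
      by measurable
    ultimately have "{y :: real^'m. y $ i = of_int c} \<in> null_sets lborel"
      by (auto simp: null_sets_def)
    then show ?thesis by (rule AE_I'[where N="{y. y $ i = of_int c}"]) auto
  qed
  then have "AE y in lborel. \<forall>i c. (y :: real^'m) $ i \<noteq> of_int c"
    by (simp add: AE_all_countable)
  then show ?thesis by eventually_elim (auto elim!: Ints_cases)
qed

lemma unit_cell_shift_iff:
  assumes "\<forall>i. (y :: real^'m) $ i \<notin> \<int>"
  shows "y - int_vec k \<in> unit_cell \<longleftrightarrow> k = cell_floor y"
proof -
  have "y $ i - of_int (k $ i) > 0 \<and> y $ i - of_int (k $ i) < 1 \<longleftrightarrow> k $ i = \<lfloor>y $ i\<rfloor>" for i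
  proof -
    have "y $ i \<noteq> of_int (k $ i)" using assms by (metis Ints_of_int)
    then show ?thesis by linarith
  qed
  then show ?thesis by (simp add: unit_cell_def vec_eq_iff cell_floor_def)
qed

text \<open>Cut the space into integer translates of the cell and move all pieces back to the cell. The finite set
\<open>K\<close> contains the shifts of the cell that meet the support of \<open>f\<close>.\<close>

lemma integral_unfold:
  fixes u f :: "real^'m \<Rightarrow> real"
  assumes per: "cell_periodic u" and [measurable]: "u \<in> borel_measurable borel" "f \<in> borel_measurable borel"
    and iu: "integrable cell_measure u" and fB: "\<And>y. \<bar>f y\<bar> \<le> B"
    and K: "finite K" "\<And>y k. y \<in> unit_cell \<Longrightarrow> f (y + int_vec k) \<noteq> 0 \<Longrightarrow> k \<in> K"
  shows "integrable lborel (\<lambda>y. u y * f y)"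
    and "(LINT y|lborel. u y * f y) = (LINT y|cell_measure. u y * (\<Sum>k\<in>K. f (y + int_vec k)))"
proof -
  define g where "g k z = indicator unit_cell z * (u z * f (z + int_vec k))" for k z
  have gm [measurable]: "g k \<in> borel_measurable borel" for k unfolding g_def by measurable
  have iuf: "integrable cell_measure (\<lambda>z. u z * f (z + int_vec k))" for k
  proof (rule Bochner_Integration.integrable_bound[of _ "\<lambda>z. u z * B"])
    show "integrable cell_measure (\<lambda>z. u z * B)" using iu by simp
    show "(\<lambda>z. u z * f (z + int_vec k)) \<in> borel_measurable cell_measure" by (intro borel_cell) measurable
    have "norm (u z * f (z + int_vec k)) \<le> norm (u z * B)" for z
      using fB[of "z + int_vec k"] by (auto simp: abs_mult intro!: mult_left_mono)
    then show "AE z in cell_measure. norm (u z * f (z + int_vec k)) \<le> norm (u z * B)" by simp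
  qed
  have gi: "integrable lborel (g k)" for k
    unfolding g_def by (rule cell_integrable_iff[THEN iffD1, OF iuf])
  have gs: "integrable lborel (\<lambda>y. g k (y - int_vec k))" "(LINT y|lborel. g k (y - int_vec k)) = (LINT y|lborel. g k y)" for k
    using gi lborel_translate[of "g k" "- int_vec k"] by simp_all
  have ae: "AE y in lborel. u y * f y = (\<Sum>k\<in>K. g k (y - int_vec k))"
    using AE_no_integer_coordinate
  proof eventually_elim
    fix y :: "real^'m" assume y: "\<forall>i. y $ i \<notin> \<int>"
    have up: "u (y - int_vec k) = u y" for k
      using per unfolding cell_periodic_def by (metis diff_add_cancel)
    have "(\<Sum>k\<in>K. g k (y - int_vec k)) = (\<Sum>k\<in>K. if k = cell_floor y then u y * f y else 0)"
      by (intro sum.cong refl) (simp add: g_def up unit_cell_shift_iff[OF y] indicator_def)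
    also have "\<dots> = (if cell_floor y \<in> K then u y * f y else 0)" using K(1) by simp
    also have "\<dots> = u y * f y"
    proof (cases "f y = 0")
      case False
      then have "cell_floor y \<in> K"
        using K(2)[of "y - int_vec (cell_floor y)" "cell_floor y"] unit_cell_shift_iff[OF y] by simp
      then show ?thesis by simp
    qed simp
    finally show "u y * f y = (\<Sum>k\<in>K. g k (y - int_vec k))" ..
  qed
  have si: "integrable lborel (\<lambda>y. \<Sum>k\<in>K. g k (y - int_vec k))" by (intro Bochner_Integration.integrable_sum gs)
  show "integrable lborel (\<lambda>y. u y * f y)"
    by (rule integrable_cong_AE_imp[OF si _ ae[THEN AE_symmetric]]) measurable
  have "(LINT y|lborel. u y * f y) = (LINT y|lborel. (\<Sum>k\<in>K. g k (y - int_vec k)))"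
    by (rule integral_cong_AE[OF _ _ ae]) measurable
  also have "\<dots> = (\<Sum>k\<in>K. (LINT y|lborel. g k y))"
    by (subst Bochner_Integration.integral_sum) (auto simp: gs)
  also have "\<dots> = (\<Sum>k\<in>K. (LINT y|cell_measure. u y * f (y + int_vec k)))"
    by (simp add: cell_integral_eq g_def)
  also have "\<dots> = (LINT y|cell_measure. (\<Sum>k\<in>K. u y * f (y + int_vec k)))"
    by (rule Bochner_Integration.integral_sum[symmetric]) (rule iuf)
  finally show "(LINT y|lborel. u y * f y) = (LINT y|cell_measure. u y * (\<Sum>k\<in>K. f (y + int_vec k)))"
    by (simp add: sum_distrib_left)
qed

lemma bounded_unit_cell: "bounded (unit_cell :: (real^'m) set)"
  by (simp add: unit_cell_box)

lemma finite_overlapping_shifts: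
  assumes "bounded (S :: (real^'m) set)" "bounded T"
  shows "finite {k. \<exists>y\<in>T. y + int_vec k \<in> S}"
proof (rule finite_int_vecs)
  have "int_vec ` {k. \<exists>y\<in>T. y + int_vec k \<in> S} \<subseteq> (\<lambda>(x, y). x - y) ` (S \<times> T)"
  proof clarify
    fix k y assume "y \<in> T" "y + int_vec k \<in> S"
    then show "int_vec k \<in> (\<lambda>(x, y). x - y) ` (S \<times> T)"
      by (intro image_eqI[of _ _ "(y + int_vec k, y)"]) auto
  qed
  moreover have "bounded ((\<lambda>(x, y). x - y) ` (S \<times> T))"
    using bounded_minus_comp[of fst "S \<times> T" snd] assms
    by (simp add: case_prod_beta' bounded_fst bounded_snd image_image fst_image_times snd_image_times)
  ultimately show "bounded (int_vec ` {k. \<exists>y\<in>T. y + int_vec k \<in> S})" by (rule bounded_subset[rotated])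
qed

lemma C_sharp_borel [measurable]: "apply_bcontfun f \<in> borel_measurable borel" for f :: "(real^'m) \<Rightarrow>\<^sub>C real"
  by (intro borel_measurable_continuous_onI) simp

lemma C_sharp_periodicD: "f \<in> C_sharp \<Longrightarrow> cell_periodic (apply_bcontfun f)"
  by (simp add: C_sharp_def)

lemma bcont_abs_le: "\<bar>apply_bcontfun f y\<bar> \<le> norm f" for f :: "'a::topological_space \<Rightarrow>\<^sub>C real"
  using norm_bounded[of f y] by simp

text \<open>Unfolding with the indicator function of a translated cell, whose integer translates also add up to
\<open>1\<close> almost everywhere.\<close>

lemma cell_integral_shift:
  fixes f :: "(real^'m) \<Rightarrow>\<^sub>C real"
  assumes f: "f \<in> C_sharp"
  shows "(LINT t|cell_measure. f (z + t)) = (LINT t|cell_measure. f t)"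
proof -
  define \<chi>' :: "real^'m \<Rightarrow> real" where "\<chi>' y = indicator unit_cell (y - z)" for y
  have [measurable]: "\<chi>' \<in> borel_measurable borel" unfolding \<chi>'_def by measurable
  define K where "K = {k. \<exists>y\<in>unit_cell. y + int_vec k \<in> (+) z ` unit_cell}"
  have K: "finite K" unfolding K_def
    by (intro finite_overlapping_shifts bounded_translation bounded_unit_cell)
  have KK: "k \<in> K" if "y \<in> unit_cell" "\<chi>' (y + int_vec k) \<noteq> 0" for y k
  proof -
    have "y + int_vec k - z \<in> unit_cell" using that(2) by (auto simp: \<chi>'_def indicator_def split: if_splits)
    then have "y + int_vec k \<in> (+) z ` unit_cell" by (intro image_eqI[of _ _ "y + int_vec k - z"]) auto
    then show ?thesis using that(1) by (auto simp: K_def)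
  qed
  have fi: "integrable cell_measure f"
    by (rule cell_integrable_bounded[of _ "norm f"]) (auto simp: bcont_abs_le)
  have "(LINT t|cell_measure. f (z + t)) = (LINT t|lborel. (\<lambda>y. f y * \<chi>' y) (t + z))"
    by (simp add: cell_integral_eq \<chi>'_def algebra_simps)
  also have "\<dots> = (LINT y|lborel. f y * \<chi>' y)"
    by (rule lborel_translate(1)) measurable
  also have "\<dots> = (LINT y|cell_measure. f y * (\<Sum>k\<in>K. \<chi>' (y + int_vec k)))"
    by (rule integral_unfold(2)[OF C_sharp_periodicD[OF f] _ _ fi, of _ 1])
      (auto simp: K KK, auto simp: \<chi>'_def indicator_def)
  also have "\<dots> = (LINT y|cell_measure. f y)"
  proof (rule integral_cong_AE)
    show "(\<lambda>y. f y * (\<Sum>k\<in>K. \<chi>' (y + int_vec k))) \<in> borel_measurable cell_measure"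
      by (rule borel_cell) measurable
    show "apply_bcontfun f \<in> borel_measurable cell_measure" by (rule borel_cell) measurable
    have "AE y in lborel. \<forall>i. (y - z) $ i \<notin> \<int>"
    proof -
      have "AE y in distr lborel borel ((+) (- z)). \<forall>i. y $ i \<notin> \<int>"
        unfolding lborel_distr_plus by (rule AE_no_integer_coordinate)
      then have "AE y in lborel. \<forall>i. (- z + y) $ i \<notin> \<int>" by (rule AE_distrD[rotated]) measurable
      then show ?thesis by (simp add: algebra_simps)
    qed
    then have "AE y in lborel. y \<in> unit_cell \<longrightarrow> f y * (\<Sum>k\<in>K. \<chi>' (y + int_vec k)) = f y"
    proof eventually_elim
      fix y assume y: "\<forall>i. (y - z) $ i \<notin> \<int>"
      show "y \<in> unit_cell \<longrightarrow> f y * (\<Sum>k\<in>K. \<chi>' (y + int_vec k)) = f y"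
      proof
        assume yc: "y \<in> unit_cell"
        let ?k = "- cell_floor (y - z)"
        have chi: "\<chi>' (y + int_vec k) = (if k = ?k then 1 else 0)" for k
          using unit_cell_shift_iff[OF y, of "- k"]
          by (auto simp: \<chi>'_def indicator_def int_vec_simps algebra_simps minus_equation_iff[of k])
        have "?k \<in> K" by (rule KK[OF yc]) (simp add: chi)
        then show "f y * (\<Sum>k\<in>K. \<chi>' (y + int_vec k)) = f y" using K by (simp add: chi)
      qed
    qed
    then show "AE y in cell_measure. f y * (\<Sum>k\<in>K. \<chi>' (y + int_vec k)) = f y"
      by (subst AE_restrict_space_iff) auto
  qed
  finally show ?thesis .
qed

lemma C_sharp_modulus:
  fixes f :: "(real^'m) \<Rightarrow>\<^sub>C real"
  assumes f: "f \<in> C_sharp" and "e > 0"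
  obtains \<delta> where "\<delta> > 0" "\<And>y z. dist y z < \<delta> \<Longrightarrow> \<bar>f y - f z\<bar> < e"
proof -
  obtain n where n: "\<And>y z. y \<in> cbox (-1) 2 \<Longrightarrow> z \<in> cbox (-1) 2 \<Longrightarrow> dist y z < inverse (real (Suc n)) \<Longrightarrow> \<bar>f y - f z\<bar> < e"
    using C_sharp_uniformly_continuous_cbox[OF \<open>e > 0\<close>] by blast
  have "\<bar>f y - f z\<bar> < e" if d: "dist y z < inverse (real (Suc n))" for y z
  proof -
    let ?k = "- cell_floor y"
    have yk: "y + int_vec ?k = cell_frac y" by (simp add: cell_frac_def int_vec_simps)
    have "inverse (real (Suc n)) \<le> 1" by (simp add: field_simps)
    then have d1: "dist y z < 1" using d by linarith
    have 1: "y + int_vec ?k \<in> cbox (-1) 2"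
    proof (clarsimp simp: yk mem_box_cart)
      fix i show "- 1 \<le> cell_frac y $ i \<and> cell_frac y $ i \<le> 2"
        using cell_frac_bounds[of y i] by linarith
    qed
    have "z + int_vec ?k \<in> cbox (-1) 2"
    proof -
      have "- 1 \<le> (z + int_vec ?k) $ i \<and> (z + int_vec ?k) $ i \<le> 2" for i
      proof -
        have "\<bar>(y - z) $ i\<bar> < 1"
          using component_le_norm_cart[of "y - z" i] d1 by (simp add: dist_norm)
        moreover have "0 \<le> y $ i + int_vec ?k $ i" "y $ i + int_vec ?k $ i < 1"
          using cell_frac_bounds[of y i] unfolding yk[symmetric] by simp_all
        ultimately show ?thesis by auto
      qed
      then show ?thesis unfolding mem_box_cart by simp
    qed
    from n[OF 1 this] d have "\<bar>f (y + int_vec ?k) - f (z + int_vec ?k)\<bar> < e" by (simp add: dist_norm)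
    then show ?thesis using C_sharp_periodicD[OF f] by (simp only: cell_periodic_def)
  qed
  then show ?thesis by (intro that[of "inverse (real (Suc n))"]) auto
qed

section \<open>Mean values of oscillating functions\<close>

text \<open>Let \<open>a n t\<close> be the integral over \<open>A\<close> with the phase advanced by \<open>t\<close>. The difference
\<open>a n (R s) - a n 0\<close> is controlled by the translation of \<open>A\<close> by \<open>\<eta> n *\<^sub>R s\<close>, so it vanishes in the
limit. By density and uniform continuity \<open>a n t - a n 0\<close> tends to \<open>0\<close> for every \<open>t\<close>. Averaging over
\<open>t\<close> in the cell replaces \<open>a n t\<close> by its mean, which Fubini's theorem evaluates for each \<open>n\<close>.\<close>

lemma oscillating_mean_value:
  fixes R :: "real^'n^'m" and f :: "(real^'m) \<Rightarrow>\<^sub>C real"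
  assumes irr: "\<And>k :: int^'m. k \<noteq> 0 \<Longrightarrow> transpose R *v int_vec k \<noteq> 0"
    and f: "f \<in> C_sharp" and A: "A \<in> sets borel" "bounded A"
    and \<eta>: "\<And>n. \<eta> n > 0" "\<eta> \<longlonglongrightarrow> 0"
  shows "(\<lambda>n. LINT x|lborel. indicator A x * f ((1 / \<eta> n) *\<^sub>R (R *v x)))
    \<longlonglongrightarrow> measure lborel A * (LINT y|cell_measure. f y)"
proof -
  have [measurable]: "A \<in> sets borel" by fact
  have Rm [measurable]: "(\<lambda>x. R *v x) \<in> borel_measurable borel"
    by (intro borel_measurable_continuous_onI linear_continuous_on matrix_vector_mul_bounded_linear)
  define a where "a n t = (LINT x|lborel. indicator A x * f ((1 / \<eta> n) *\<^sub>R (R *v x) + t))" for n t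
  have emA: "emeasure lborel A < \<infinity>" using A(2) by (rule emeasure_bounded_finite)
  have iA: "integrable lborel (indicator A :: _ \<Rightarrow> real)"
    using A(1) emA by (intro integrable_real_indicator) auto
  have ib: "integrable lborel (\<lambda>x. indicator A (x + h) * g x)"
    if [measurable]: "g \<in> borel_measurable borel" and gB: "\<And>x. \<bar>g x\<bar> \<le> norm f" for g h
  proof (rule Bochner_Integration.integrable_bound[of _ "\<lambda>x. indicator A (x + h) * norm f"])
    show "integrable lborel (\<lambda>x. indicator A (x + h) * norm f)"
      using lborel_translate(2)[of "indicator A :: _ \<Rightarrow> real" h] iA by simp
    show "AE x in lborel. norm (indicator A (x + h) * g x) \<le> norm (indicator A (x + h) * norm f)"
      by (rule AE_I2) (simp add: abs_mult gB mult_left_mono)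
  qed measurable
  have fm [measurable]: "(\<lambda>x. f ((1 / \<eta> n) *\<^sub>R (R *v x) + t)) \<in> borel_measurable borel" for n t
    by measurable
  have ia: "integrable lborel (\<lambda>x. indicator A x * f ((1 / \<eta> n) *\<^sub>R (R *v x) + t))" for n t
    using ib[OF fm bcont_abs_le, of 0] by simp
  have orbit: "(\<lambda>n. a n (R *v s) - a n 0) \<longlonglongrightarrow> 0" for s
  proof -
    have "(\<lambda>n. - (\<eta> n *\<^sub>R s)) \<longlonglongrightarrow> - (0 *\<^sub>R s)" by (intro tendsto_intros \<eta>)
    then have "(\<lambda>n. - (\<eta> n *\<^sub>R s)) \<longlonglongrightarrow> 0" by simp
    note tr = indicator_translation_continuous[OF A this]
    have "(\<lambda>n. (LINT x|lborel. \<bar>indicator A (x + - (\<eta> n *\<^sub>R s)) - indicator A x\<bar>) * norm f) \<longlonglongrightarrow> 0 * norm f"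
      by (intro tendsto_mult tr tendsto_const)
    moreover have "\<bar>a n (R *v s) - a n 0\<bar>
        \<le> (LINT x|lborel. \<bar>indicator A (x + - (\<eta> n *\<^sub>R s)) - indicator A x\<bar>) * norm f" for n
    proof -
      define h where "h = - (\<eta> n *\<^sub>R s)"
      define g where "g x = f ((1 / \<eta> n) *\<^sub>R (R *v x))" for x
      have gm [measurable]: "g \<in> borel_measurable borel" unfolding g_def by measurable
      have gB: "\<bar>g x\<bar> \<le> norm f" for x unfolding g_def by (rule bcont_abs_le)
      have e1: "a n (R *v s) = (LINT x|lborel. indicator A (x + h) * g x)"
      proof -
        have "(1 / \<eta> n) *\<^sub>R (R *v (x - h)) = (1 / \<eta> n) *\<^sub>R (R *v x) + R *v s" for x
          using \<eta>(1)[of n] by (simp add: h_def matrix_vector_right_distrib matrix_vector_mult_scaleR scaleR_add_right)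
        then have "a n (R *v s) = (LINT x|lborel. (\<lambda>x. indicator A (x + h) * g x) (x + - h))"
          unfolding a_def g_def by simp
        also have "\<dots> = (LINT x|lborel. indicator A (x + h) * g x)"
          by (rule lborel_translate(1)) measurable
        finally show ?thesis .
      qed
      have e2: "a n 0 = (LINT x|lborel. indicator A x * g x)" by (simp add: a_def g_def)
      have i1: "integrable lborel (\<lambda>x. indicator A (x + h) * g x)" by (rule ib[OF gm gB])
      have i2: "integrable lborel (\<lambda>x. indicator A x * g x)" using ib[OF gm gB, of 0] by simp
      have ih: "integrable lborel (\<lambda>x. indicator A (x + h) :: real)"
        using lborel_translate(2)[of "indicator A :: _ \<Rightarrow> real" h] iA by simp
      have "a n (R *v s) - a n 0 = (LINT x|lborel. (indicator A (x + h) - indicator A x) * g x)"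
        unfolding e1 e2 using i1 i2 by (simp add: left_diff_distrib)
      also have "\<bar>\<dots>\<bar> \<le> (LINT x|lborel. \<bar>(indicator A (x + h) - indicator A x) * g x\<bar>)"
        by (rule integral_abs_bound)
      also have "\<dots> \<le> (LINT x|lborel. \<bar>indicator A (x + h) - indicator A x\<bar> * norm f)"
      proof (rule integral_mono)
        show "integrable lborel (\<lambda>x. \<bar>(indicator A (x + h) - indicator A x) * g x\<bar>)"
          using i1 i2 by (simp add: left_diff_distrib)
        show "integrable lborel (\<lambda>x. \<bar>indicator A (x + h) - indicator A x\<bar> * norm f)"
          using ih iA by simp
        show "\<bar>(indicator A (x + h) - indicator A x) * g x\<bar> \<le> \<bar>indicator A (x + h) - indicator A x\<bar> * norm f" for x
          by (simp add: abs_mult gB mult_left_mono)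
      qed
      finally show ?thesis by (simp add: h_def)
    qed
    ultimately show ?thesis
      by - (rule Lim_null_comparison[OF always_eventually], simp_all)
  qed
  have aper: "a n (t + int_vec k) = a n t" for n t k
  proof -
    have "f (z + (t + int_vec k)) = f (z + t)" for z
      using C_sharp_periodicD[OF f] unfolding cell_periodic_def by (metis add.assoc)
    then show ?thesis unfolding a_def by simp
  qed
  have all: "(\<lambda>n. a n t - a n 0) \<longlonglongrightarrow> 0" for t
  proof (rule LIMSEQ_I)
    fix e :: real assume e: "e > 0"
    define \<mu> where "\<mu> = measure lborel A"
    have \<mu>: "\<mu> \<ge> 0" by (simp add: \<mu>_def)
    define e' where "e' = e / (2 * (\<mu> + 1))"
    have e': "e' > 0" "\<mu> * e' \<le> e / 2"
      using e \<mu> by (auto simp: e'_def field_simps)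
    obtain \<delta> where \<delta>: "\<delta> > 0" "\<And>y z. dist y z < \<delta> \<Longrightarrow> \<bar>f y - f z\<bar> < e'"
      using C_sharp_modulus[OF f e'(1)] by blast
    obtain s k where sk: "dist t (R *v s + int_vec k) < \<delta>"
      using orbit_dense_mod_integers[OF irr \<delta>(1)] by blast
    have close: "\<bar>a n t - a n (R *v s)\<bar> \<le> e / 2" for n
    proof -
      let ?F = "\<lambda>t x. f ((1 / \<eta> n) *\<^sub>R (R *v x) + t)"
      have "a n t - a n (R *v s) = a n t - a n (R *v s + int_vec k)" by (simp add: aper)
      also have "\<dots> = (LINT x|lborel. indicator A x * (?F t x - ?F (R *v s + int_vec k) x))"
        unfolding a_def using ia by (simp add: right_diff_distrib)
      also have "\<bar>\<dots>\<bar> \<le> (LINT x|lborel. \<bar>indicator A x * (?F t x - ?F (R *v s + int_vec k) x)\<bar>)"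
        by (rule integral_abs_bound)
      also have "\<dots> \<le> (LINT x|lborel. indicator A x * e')"
      proof (rule integral_mono)
        show "integrable lborel (\<lambda>x. \<bar>indicator A x * (?F t x - ?F (R *v s + int_vec k) x)\<bar>)"
          using ia by (simp add: right_diff_distrib)
        show "integrable lborel (\<lambda>x. indicator A x * e')" using iA by simp
        fix x
        have "dist ((1 / \<eta> n) *\<^sub>R (R *v x) + t) ((1 / \<eta> n) *\<^sub>R (R *v x) + (R *v s + int_vec k)) < \<delta>"
          using sk by simp
        from \<delta>(2)[OF this] show "\<bar>indicator A x * (?F t x - ?F (R *v s + int_vec k) x)\<bar> \<le> indicator A x * e'"
          by (simp add: abs_mult indicator_def)
      qed
      also have "\<dots> = \<mu> * e'" by (simp add: \<mu>_def)
      finally show ?thesis using e'(2) by simp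
    qed
    obtain N where N: "\<And>n. n \<ge> N \<Longrightarrow> \<bar>a n (R *v s) - a n 0\<bar> < e / 2"
      using LIMSEQ_D[OF orbit[of s], of "e/2"] e by auto
    have "norm (a n t - a n 0 - 0) < e" if "n \<ge> N" for n
      using N[OF that] close[of n] unfolding real_norm_def by linarith
    then show "\<exists>no. \<forall>n\<ge>no. norm (a n t - a n 0 - 0) < e" by blast
  qed
  let ?N = "restrict_space lborel A"
  have finN: "finite_measure ?N"
    by (rule finite_measureI) (use emA in \<open>simp add: emeasure_restrict_space space_restrict_space\<close>)
  interpret N: finite_measure ?N by (rule finN)
  interpret Y: finite_measure "cell_measure :: (real^'m) measure" by (rule finite_cell_measure)
  interpret pair_sigma_finite ?N "cell_measure :: (real^'m) measure" ..
  have aN: "a n t = (LINT x|?N. f ((1 / \<eta> n) *\<^sub>R (R *v x) + t))" for n t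
    unfolding a_def by (subst integral_restrict_space) auto
  have NB: "(\<lambda>x. x) \<in> measurable ?N borel" "(\<lambda>x. x) \<in> measurable cell_measure borel"
    by (auto intro!: measurable_restrict_space1)
  have pm: "(\<lambda>(x, t). f ((1 / \<eta> n) *\<^sub>R (R *v x) + t)) \<in> borel_measurable (?N \<Otimes>\<^sub>M cell_measure)" for n
  proof -
    have [measurable]: "fst \<in> measurable (?N \<Otimes>\<^sub>M cell_measure) borel" "snd \<in> measurable (?N \<Otimes>\<^sub>M cell_measure) borel"
      by (rule measurable_compose[OF measurable_fst NB(1)], rule measurable_compose[OF measurable_snd NB(2)])
    show ?thesis unfolding case_prod_beta by measurable
  qed
  have pint: "integrable (?N \<Otimes>\<^sub>M cell_measure) (\<lambda>(x, t). f ((1 / \<eta> n) *\<^sub>R (R *v x) + t))" for n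
  proof (rule finite_measure.integrable_const_bound[OF finite_measure_pair_measure[OF finite_cell_measure finN] _ pm])
    show "AE p in ?N \<Otimes>\<^sub>M cell_measure. norm (case p of (x, t) \<Rightarrow> f ((1 / \<eta> n) *\<^sub>R (R *v x) + t)) \<le> norm f"
      by (rule AE_I2) (simp add: case_prod_beta bcont_abs_le)
  qed
  have ai: "integrable cell_measure (a n)" for n
    using integrable_snd[OF pint] unfolding aN .
  have avg: "(LINT t|cell_measure. a n t) = measure lborel A * (LINT y|cell_measure. f y)" for n
  proof -
    have "(LINT t|cell_measure. a n t) = (LINT x|?N. (LINT t|cell_measure. f ((1 / \<eta> n) *\<^sub>R (R *v x) + t)))"
      unfolding aN by (rule Fubini_integral[OF pint])
    also have "\<dots> = measure ?N (space ?N) * (LINT y|cell_measure. f y)"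
      by (simp add: cell_integral_shift[OF f])
    also have "measure ?N (space ?N) = measure lborel A"
      by (simp add: measure_restrict_space space_restrict_space)
    finally show ?thesis .
  qed
  have aB: "\<bar>a n t\<bar> \<le> norm f * measure lborel A" for n t
  proof -
    have "\<bar>a n t\<bar> \<le> (LINT x|lborel. \<bar>indicator A x * f ((1 / \<eta> n) *\<^sub>R (R *v x) + t)\<bar>)"
      unfolding a_def by (rule integral_abs_bound)
    also have "\<dots> \<le> (LINT x|lborel. indicator A x * norm f)"
    proof (rule integral_mono)
      show "integrable lborel (\<lambda>x. \<bar>indicator A x * f ((1 / \<eta> n) *\<^sub>R (R *v x) + t)\<bar>)"
        using ia by (rule integrable_abs)
    qed (use iA in \<open>auto simp: abs_mult intro!: mult_left_mono bcont_abs_le\<close>)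
    finally show ?thesis by (simp add: mult.commute)
  qed
  have "(\<lambda>n. LINT t|cell_measure. (a n t - a n 0)) \<longlonglongrightarrow> (LINT t|(cell_measure :: (real^'m) measure). 0)"
  proof (rule integral_dominated_convergence[where w="\<lambda>_. 2 * (norm f * measure lborel A)"])
    show "(\<lambda>t. a n t - a n 0) \<in> borel_measurable cell_measure" for n using ai by auto
    show "AE t in cell_measure. norm (a n t - a n 0) \<le> 2 * (norm f * measure lborel A)" for n
    proof (rule AE_I2)
      fix t show "norm (a n t - a n 0) \<le> 2 * (norm f * measure lborel A)"
        using aB[of n t] aB[of n 0] unfolding real_norm_def by linarith
    qed
  qed (use all in auto)
  then have "(\<lambda>n. measure lborel A * (LINT y|cell_measure. f y) - a n 0) \<longlonglongrightarrow> 0"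
    using ai by (simp add: avg)
  then have "(\<lambda>n. measure lborel A * (LINT y|cell_measure. f y)
      - (measure lborel A * (LINT y|cell_measure. f y) - a n 0)) \<longlonglongrightarrow> measure lborel A * (LINT y|cell_measure. f y) - 0"
    by (intro tendsto_diff tendsto_const)
  then show ?thesis by (simp add: a_def)
qed

section \<open>The two-scale measure\<close>

text \<open>Only the first factor is completed: this is the form in which Lebesgue measurable functions of \<open>x\<close> meet
Borel functions of \<open>y\<close>.\<close>

lemma lebesgue_times_borel:
  fixes A :: "'a::euclidean_space set" and B :: "'b::euclidean_space set"
  assumes A: "A \<in> sets lebesgue" and B: "B \<in> sets borel"
  shows "A \<times> B \<in> sets lebesgue" "emeasure lebesgue (A \<times> B) = emeasure lebesgue A * emeasure lborel B"
proof -
  obtain S N N' where SN: "A = S \<union> N" "N \<subseteq> N'" "N' \<in> null_sets lborel" "S \<in> sets lborel"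
    using A by (rule sets_completionE)
  have "N' \<times> UNIV \<in> null_sets (lborel \<Otimes>\<^sub>M (lborel :: 'b measure))"
    using SN(3) by (intro lborel.times_in_null_sets1) auto
  then have "N' \<times> UNIV \<in> null_sets (lborel :: ('a \<times> 'b) measure)" by (simp add: lborel_prod)
  then have nl: "N' \<times> (UNIV :: 'b set) \<in> null_sets lebesgue" by (rule null_sets_completionI)
  have nB: "N \<times> B \<in> null_sets lebesgue" using SN(2) by (intro null_sets_completion_subset[OF _ nl]) auto
  have nN: "N \<in> null_sets lebesgue" by (rule null_sets_completion_subset[OF SN(2) null_sets_completionI[OF SN(3)]])
  have SB: "S \<times> B \<in> sets (lborel :: ('a \<times> 'b) measure)"
    using pair_measureI[of S lborel B lborel] SN(4) B unfolding lborel_prod by simp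
  have eq: "A \<times> B = (S \<times> B) \<union> (N \<times> B)" using SN(1) by auto
  show "A \<times> B \<in> sets lebesgue" unfolding eq using SB nB by (intro sets.Un) auto
  have "emeasure lebesgue (A \<times> B) = emeasure lebesgue (S \<times> B)"
    unfolding eq by (rule emeasure_Un_null_set[OF _ nB]) (use SB in auto)
  also have "\<dots> = emeasure (lborel \<Otimes>\<^sub>M lborel) (S \<times> B)" using SB by (simp add: lborel_prod)
  also have "\<dots> = emeasure lborel S * emeasure lborel B"
    using SN(4) B by (intro lborel.emeasure_pair_measure_Times) auto
  also have "emeasure lborel S = emeasure lebesgue A"
    unfolding SN(1) using SN(4) nN by (subst emeasure_Un_null_set) auto
  finally show "emeasure lebesgue (A \<times> B) = emeasure lebesgue A * emeasure lborel B" .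
qed

text \<open>The slow variable carries the Lebesgue sigma algebra, for which the given functions are measurable, the
fast variable the Borel sigma algebra. Sections in \<open>y\<close> are thus Borel functions, and they remain
measurable when they are extended periodically.\<close>

abbreviation two_scale_measure :: "(real^'n) set \<Rightarrow> ((real^'n) \<times> (real^'m)) measure" where
  "two_scale_measure \<Omega> \<equiv> lebesgue_on \<Omega> \<Otimes>\<^sub>M cell_measure"

lemma finite_lebesgue_on:
  fixes \<Omega> :: "'a::euclidean_space set"
  assumes "open \<Omega>" "bounded \<Omega>" shows "finite_measure (lebesgue_on \<Omega>)"
  using assms by (intro finite_measure_lebesgue_on bounded_set_imp_lmeasurable) auto

text \<open>Lebesgue measure on \<open>\<Omega> \<times> Y\<close> is an extension of the product measure, since both agree on rectangles.\<close>

lemma two_scale_measure_eq_distr: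
  fixes \<Omega> :: "(real^'n) set"
  assumes \<Omega>: "open \<Omega>" "bounded \<Omega>"
  shows "(\<lambda>p. p) \<in> measurable (lebesgue_on (\<Omega> \<times> unit_cell)) (two_scale_measure \<Omega> :: ((real^'n) \<times> (real^'m)) measure)"
    and "distr (lebesgue_on (\<Omega> \<times> unit_cell)) (two_scale_measure \<Omega>) (\<lambda>p. p) = (two_scale_measure \<Omega> :: ((real^'n) \<times> (real^'m)) measure)"
proof -
  let ?L = "lebesgue_on (\<Omega> \<times> unit_cell) :: ((real^'n) \<times> (real^'m)) measure"
  let ?P = "two_scale_measure \<Omega> :: ((real^'n) \<times> (real^'m)) measure"
  have \<Omega>L: "\<Omega> \<in> sets lebesgue" using \<Omega>(1) by (simp add: borel_open sets_completionI_sets)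
  have O: "\<Omega> \<times> unit_cell \<in> sets (lebesgue :: ((real^'n) \<times> (real^'m)) measure)"
    by (rule lebesgue_times_borel(1)[OF \<Omega>L unit_cell_borel])
  have O1: "\<Omega> \<inter> space lebesgue \<in> sets lebesgue" and O2: "unit_cell \<inter> space lborel \<in> sets lborel"
    and O3: "\<Omega> \<times> unit_cell \<inter> space lebesgue \<in> sets (lebesgue :: ((real^'n) \<times> (real^'m)) measure)"
    using \<Omega>L O by auto
  have rect: "A \<times> B \<in> sets ?L" "emeasure ?L (A \<times> B) = emeasure (lebesgue_on \<Omega>) A * emeasure (cell_measure :: (real^'m) measure) B"
    if "A \<in> sets (lebesgue_on \<Omega>)" "B \<in> sets (cell_measure :: (real^'m) measure)" for A B
  proof -
    have A: "A \<in> sets lebesgue" "A \<subseteq> \<Omega>" using that(1) O1 by (auto simp: sets_restrict_space_iff)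
    have B: "B \<in> sets borel" "B \<subseteq> unit_cell" using that(2) O2 by (auto simp: sets_restrict_space_iff)
    have AB: "A \<times> B \<subseteq> \<Omega> \<times> unit_cell" using A B by auto
    show "A \<times> B \<in> sets ?L"
      using lebesgue_times_borel(1)[OF A(1) B(1)] AB O3 by (simp add: sets_restrict_space_iff)
    have "emeasure ?L (A \<times> B) = emeasure lebesgue (A \<times> B)"
      using emeasure_restrict_space[OF O3 AB] .
    also have "\<dots> = emeasure lebesgue A * emeasure lborel B" by (rule lebesgue_times_borel(2)[OF A(1) B(1)])
    also have "emeasure lebesgue A = emeasure (lebesgue_on \<Omega>) A"
      using emeasure_restrict_space[OF O1 A(2)] by simp
    also have "emeasure lborel B = emeasure (cell_measure :: (real^'m) measure) B"
      using emeasure_restrict_space[OF O2 B(2)] by simp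
    finally show "emeasure ?L (A \<times> B) = emeasure (lebesgue_on \<Omega>) A * emeasure (cell_measure :: (real^'m) measure) B" .
  qed
  show m: "(\<lambda>p. p) \<in> measurable ?L ?P"
  proof (rule measurable_pair_measureI)
    show "(\<lambda>p. p) \<in> space ?L \<rightarrow> space (lebesgue_on \<Omega>) \<times> space cell_measure" by auto
    fix A B assume "A \<in> sets (lebesgue_on \<Omega>)" "B \<in> sets (cell_measure :: (real^'m) measure)"
    note r = rect(1)[OF this]
    have "(\<lambda>p. p) -` (A \<times> B) \<inter> space ?L = A \<times> B" using sets.sets_into_space[OF r] by auto
    then show "(\<lambda>p. p) -` (A \<times> B) \<inter> space ?L \<in> sets ?L" using r by simp
  qed
  have "?P = distr ?L ?P (\<lambda>p. p)"
  proof (rule pair_measure_eqI)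
    show "sigma_finite_measure (lebesgue_on \<Omega>)"
      using finite_lebesgue_on[OF \<Omega>] by (rule finite_measure.axioms)
    show "sigma_finite_measure (cell_measure :: (real^'m) measure)"
      using finite_cell_measure by (rule finite_measure.axioms)
    fix A B assume AB: "A \<in> sets (lebesgue_on \<Omega>)" "B \<in> sets (cell_measure :: (real^'m) measure)"
    have "emeasure (distr ?L ?P (\<lambda>p. p)) (A \<times> B) = emeasure ?L ((\<lambda>p. p) -` (A \<times> B) \<inter> space ?L)"
      by (rule emeasure_distr[OF m pair_measureI[OF AB]])
    also have "(\<lambda>p. p) -` (A \<times> B) \<inter> space ?L = A \<times> B"
      using sets.sets_into_space[OF rect(1)[OF AB]] by auto
    finally show "emeasure (lebesgue_on \<Omega>) A * emeasure cell_measure B = emeasure (distr ?L ?P (\<lambda>p. p)) (A \<times> B)"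
      using rect(2)[OF AB] by simp
  qed simp
  then show "distr ?L ?P (\<lambda>p. p) = ?P" ..
qed

lemma two_scale_measure_lebesgue:
  fixes \<Omega> :: "(real^'n) set" and f :: "(real^'n) \<times> (real^'m) \<Rightarrow> 'b::{banach, second_countable_topology}"
  assumes \<Omega>: "open \<Omega>" "bounded \<Omega>" and f: "f \<in> borel_measurable (two_scale_measure \<Omega>)"
  shows "f \<in> borel_measurable (lebesgue_on (\<Omega> \<times> unit_cell))"
    and "integrable (lebesgue_on (\<Omega> \<times> unit_cell)) f \<longleftrightarrow> integrable (two_scale_measure \<Omega>) f"
    and "(LINT p|lebesgue_on (\<Omega> \<times> unit_cell). f p) = (LINT p|two_scale_measure \<Omega>. f p)"
  using measurable_compose[OF two_scale_measure_eq_distr(1)[OF \<Omega>] f]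
    integrable_distr_eq[OF two_scale_measure_eq_distr(1)[OF \<Omega>] f]
    integral_distr[OF two_scale_measure_eq_distr(1)[OF \<Omega>] f]
  unfolding two_scale_measure_eq_distr(2)[OF \<Omega>] by auto

lemma C_sharp_add: "f \<in> C_sharp \<Longrightarrow> g \<in> C_sharp \<Longrightarrow> f + g \<in> C_sharp"
  by (simp add: C_sharp_def cell_periodic_def plus_bcontfun.rep_eq)

lemma C_sharp_scaleR: "f \<in> C_sharp \<Longrightarrow> c *\<^sub>R f \<in> C_sharp"
  by (simp add: C_sharp_def cell_periodic_def scaleR_bcontfun.rep_eq)

lemma C_sharp_0: "0 \<in> C_sharp"
  by (simp add: C_sharp_def cell_periodic_def zero_bcontfun.rep_eq)

lemma apply_bcontfun_scaleR: "apply_bcontfun (c *\<^sub>R f) y = c * apply_bcontfun f y"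
  for f :: "'a::topological_space \<Rightarrow>\<^sub>C real"
  by (simp add: scaleR_bcontfun.rep_eq)

lemma apply_bcontfun_add: "apply_bcontfun (f + g) y = apply_bcontfun f y + apply_bcontfun g y"
  for f g :: "'a::topological_space \<Rightarrow>\<^sub>C real"
  by (simp add: plus_bcontfun.rep_eq)

lemma apply_bcontfun_diff: "apply_bcontfun (f - g) y = apply_bcontfun f y - apply_bcontfun g y"
  for f g :: "'a::topological_space \<Rightarrow>\<^sub>C real"
  by (simp add: minus_bcontfun.rep_eq)

lemma C_sharp_mult:
  fixes f g :: "(real^'m) \<Rightarrow>\<^sub>C real"
  assumes "f \<in> C_sharp" "g \<in> C_sharp"
  obtains h :: "(real^'m) \<Rightarrow>\<^sub>C real" where "h \<in> C_sharp" "\<And>y. h y = f y * g y"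
proof -
  have "(\<lambda>y. f y * g y) \<in> bcontfun"
  proof (rule bcontfun_normI)
    show "continuous_on UNIV (\<lambda>y. f y * g y)" by (intro continuous_intros) auto
    show "norm (f y * g y) \<le> norm f * norm g" for y
      by (simp add: abs_mult) (intro mult_mono bcont_abs_le, auto)
  qed
  then have "apply_bcontfun (Bcontfun (\<lambda>y. f y * g y)) = (\<lambda>y. f y * g y)" by (rule Bcontfun_inverse)
  moreover from this have "Bcontfun (\<lambda>y. f y * g y) \<in> C_sharp"
    using assms by (simp add: C_sharp_def cell_periodic_def)
  ultimately show ?thesis by (intro that[of "Bcontfun (\<lambda>y. f y * g y)"]) simp_all
qed

lemma C_sharp_eval_measurable:
  fixes \<phi> :: "'a \<Rightarrow> ((real^'m) \<Rightarrow>\<^sub>C real)"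
  assumes "\<phi> \<in> borel_measurable M" "\<And>x. x \<in> space M \<Longrightarrow> \<phi> x \<in> C_sharp" "g \<in> measurable M borel"
  shows "(\<lambda>x. apply_bcontfun (\<phi> x) (g x)) \<in> borel_measurable M"
proof -
  obtain D where D: "countable D" "C_sharp \<subseteq> closure (D :: ((real^'m) \<Rightarrow>\<^sub>C real) set)"
    by (rule C_sharp_separable)
  have "\<phi> x \<in> closure D" if "x \<in> space M" for x
    using assms(2)[OF that] D(2) by (rule set_mp[rotated])
  from bcontfun_eval_measurable[OF assms(1) D(1) this assms(3)] show ?thesis .
qed

lemma C_sharp_eval_L2:
  fixes \<phi> :: "'a \<Rightarrow> ((real^'m) \<Rightarrow>\<^sub>C real)"
  assumes \<phi>: "\<phi> \<in> L2 M" "\<And>x. x \<in> space M \<Longrightarrow> \<phi> x \<in> C_sharp" and g: "g \<in> measurable M borel"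
  shows "(\<lambda>x. apply_bcontfun (\<phi> x) (g x)) \<in> L2 M"
    "(LINT x|M. (apply_bcontfun (\<phi> x) (g x))\<^sup>2) \<le> (LINT x|M. (norm (\<phi> x))\<^sup>2)"
proof -
  have m: "(\<lambda>x. apply_bcontfun (\<phi> x) (g x)) \<in> borel_measurable M"
    using C_sharp_eval_measurable[OF _ \<phi>(2) g] \<phi>(1) by (simp add: L2_def)
  have i: "integrable M (\<lambda>x. (norm (\<phi> x))\<^sup>2)" using \<phi>(1) by (simp add: L2_def)
  have b: "(apply_bcontfun (\<phi> x) (g x))\<^sup>2 \<le> (norm (\<phi> x))\<^sup>2" for x
    by (rule power2_le_iff_abs_le[THEN iffD2]) (simp_all add: bcont_abs_le)
  have i': "integrable M (\<lambda>x. (apply_bcontfun (\<phi> x) (g x))\<^sup>2)"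
    by (rule Bochner_Integration.integrable_bound[OF i]) (use m b in auto)
  show "(\<lambda>x. apply_bcontfun (\<phi> x) (g x)) \<in> L2 M" using m i' by (simp add: L2_def)
  show "(LINT x|M. (apply_bcontfun (\<phi> x) (g x))\<^sup>2) \<le> (LINT x|M. (norm (\<phi> x))\<^sup>2)"
    by (rule integral_mono[OF i' i b])
qed

lemma two_scale_lift_L2:
  fixes \<phi> :: "real^'n \<Rightarrow> ((real^'m) \<Rightarrow>\<^sub>C real)"
  assumes \<Omega>: "open \<Omega>" "bounded \<Omega>" and \<phi>: "\<phi> \<in> L2 (lebesgue_on \<Omega>)" "\<And>x. x \<in> \<Omega> \<Longrightarrow> \<phi> x \<in> C_sharp"
  shows "(\<lambda>p. apply_bcontfun (\<phi> (fst p)) (snd p)) \<in> L2 (two_scale_measure \<Omega>)"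
    "(LINT p|two_scale_measure \<Omega>. (apply_bcontfun (\<phi> (fst p)) (snd p))\<^sup>2) \<le> (LINT x|lebesgue_on \<Omega>. (norm (\<phi> x))\<^sup>2)"
proof -
  interpret O: finite_measure "lebesgue_on \<Omega>" by (rule finite_lebesgue_on[OF \<Omega>])
  interpret Y: finite_measure "cell_measure :: (real^'m) measure" by (rule finite_cell_measure)
  interpret pair_sigma_finite "lebesgue_on \<Omega>" "cell_measure :: (real^'m) measure" ..
  let ?M = "two_scale_measure \<Omega> :: ((real^'n) \<times> (real^'m)) measure"
  have sn: "snd \<in> measurable ?M borel"
    by (rule measurable_compose[OF measurable_snd]) (auto intro!: measurable_restrict_space1)
  have i: "integrable (lebesgue_on \<Omega>) (\<lambda>x. (norm (\<phi> x))\<^sup>2)" using \<phi>(1) by (simp add: L2_def)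
  have ip: "integrable ?M (\<lambda>(x, y). (norm (\<phi> x))\<^sup>2)"
  proof (rule Fubini_integrable)
    show "(\<lambda>(x, y). (norm (\<phi> x))\<^sup>2) \<in> borel_measurable ?M"
      using measurable_compose[OF measurable_fst borel_measurable_integrable[OF i]] by (simp add: case_prod_beta')
  qed (use i in \<open>simp_all\<close>)
  have m: "(\<lambda>p. \<phi> (fst p)) \<in> borel_measurable ?M"
    using \<phi>(1) by (intro measurable_compose[OF measurable_fst]) (simp add: L2_def)
  have L: "(\<lambda>p. \<phi> (fst p)) \<in> L2 ?M" using m ip by (simp add: L2_def case_prod_beta')
  have C: "\<And>p. p \<in> space ?M \<Longrightarrow> \<phi> (fst p) \<in> C_sharp" using \<phi>(2) by (auto simp: space_pair_measure)
  show "(\<lambda>p. apply_bcontfun (\<phi> (fst p)) (snd p)) \<in> L2 ?M" by (rule C_sharp_eval_L2(1)[OF L C sn])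
  have "(LINT p|?M. (apply_bcontfun (\<phi> (fst p)) (snd p))\<^sup>2) \<le> (LINT p|?M. (norm (\<phi> (fst p)))\<^sup>2)"
    by (rule C_sharp_eval_L2(2)[OF L C sn])
  also have "\<dots> = (LINT x|lebesgue_on \<Omega>. (norm (\<phi> x))\<^sup>2)"
    using integral_fst'[OF ip] by (simp add: case_prod_beta')
  finally show "(LINT p|?M. (apply_bcontfun (\<phi> (fst p)) (snd p))\<^sup>2) \<le> (LINT x|lebesgue_on \<Omega>. (norm (\<phi> x))\<^sup>2)" .
qed

lemma simple_tests_C_sharp:
  assumes "s \<in> simple_tests M D" "D \<subseteq> C_sharp" shows "s x \<in> C_sharp"
  using assms(1) by induction (use assms(2) in \<open>auto intro: C_sharp_add C_sharp_scaleR\<close>)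

lemma simple_tests_L2:
  assumes "finite_measure M" "s \<in> simple_tests M D" shows "s \<in> L2 M"
proof -
  obtain B where B: "\<And>x. norm (s x) \<le> B" using simple_tests_bounded[OF assms(2)] by blast
  have sm: "s \<in> borel_measurable M" by (rule simple_tests_measurable[OF assms(2)])
  have "(\<lambda>b::'b. (norm b)\<^sup>2) \<in> borel_measurable borel"
    by (intro borel_measurable_continuous_onI continuous_intros)
  from measurable_compose[OF sm this] have "(\<lambda>x. (norm (s x))\<^sup>2) \<in> borel_measurable M" .
  then have "integrable M (\<lambda>x. (norm (s x))\<^sup>2)"
    by (intro finite_measure.integrable_const_bound[OF assms(1), of _ "B\<^sup>2"]) (auto simp: B power_mono)
  then show ?thesis using sm by (simp add: L2_def)
qed

abbreviation phase :: "real^'n^'m \<Rightarrow> real \<Rightarrow> real^'n \<Rightarrow> real^'m" where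
  "phase R \<epsilon> x \<equiv> (1 / \<epsilon>) *\<^sub>R (R *v x)"

lemma phase_measurable: "(\<lambda>x. phase R \<epsilon> x) \<in> measurable (lebesgue_on \<Omega>) borel"
proof -
  have "(\<lambda>x. phase R \<epsilon> x) \<in> borel_measurable borel"
    by (intro borel_measurable_continuous_onI linear_continuous_on
        bounded_linear_compose[OF bounded_linear_scaleR_right] matrix_vector_mul_bounded_linear)
  then show ?thesis by (intro measurable_restrict_space1 measurable_completion) simp
qed

section \<open>Two-scale compactness\<close>

lemma oscillating_mean_value_lebesgue:
  fixes R :: "real^'n^'m" and f :: "(real^'m) \<Rightarrow>\<^sub>C real"
  assumes irr: "\<And>k :: int^'m. k \<noteq> 0 \<Longrightarrow> transpose R *v int_vec k \<noteq> 0"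
    and f: "f \<in> C_sharp" and \<Omega>: "open \<Omega>" "bounded \<Omega>" and A: "A \<in> sets (lebesgue_on \<Omega>)"
    and \<eta>: "\<And>n. \<eta> n > 0" "\<eta> \<longlonglongrightarrow> 0"
  shows "(\<lambda>n. LINT x|lebesgue_on \<Omega>. indicator A x * f (phase R (\<eta> n) x))
    \<longlonglongrightarrow> measure (lebesgue_on \<Omega>) A * (LINT y|cell_measure. f y)"
proof -
  have \<Omega>L: "\<Omega> \<inter> space lebesgue \<in> sets lebesgue" using \<Omega>(1) by (simp add: borel_open sets_completionI_sets)
  have AL: "A \<in> sets lebesgue" "A \<subseteq> \<Omega>" using A \<Omega>L by (auto simp: sets_restrict_space_iff)
  obtain S N N' where SN: "A = S \<union> N" "N \<subseteq> N'" "N' \<in> null_sets lborel" "S \<in> sets lborel"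
    using AL(1) by (rule sets_completionE)
  have N: "N \<in> null_sets lebesgue" by (rule null_sets_completion_subset[OF SN(2) null_sets_completionI[OF SN(3)]])
  have S: "S \<in> sets borel" "bounded S" using SN AL(2) \<Omega>(2) by (auto intro: bounded_subset)
  have Rm [measurable]: "(\<lambda>x. phase R (\<eta> n) x) \<in> borel_measurable borel" for n
    by (intro borel_measurable_continuous_onI linear_continuous_on
        bounded_linear_compose[OF bounded_linear_scaleR_right] matrix_vector_mul_bounded_linear)
  have [measurable]: "S \<in> sets borel" by (rule S)
  have eq: "(LINT x|lebesgue_on \<Omega>. indicator A x * f (phase R (\<eta> n) x)) = (LINT x|lborel. indicator S x * f (phase R (\<eta> n) x))" for n
  proof -
    have gm: "(\<lambda>x. indicator S x * f (phase R (\<eta> n) x)) \<in> borel_measurable lborel" by measurable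
    have fl: "(\<lambda>x. f (phase R (\<eta> n) x)) \<in> borel_measurable lebesgue"
      by (rule measurable_completion) measurable
    have "(LINT x|lebesgue_on \<Omega>. indicator A x * f (phase R (\<eta> n) x))
        = (LINT x|lebesgue. indicator \<Omega> x *\<^sub>R (indicator A x * f (phase R (\<eta> n) x)))"
      by (rule integral_restrict_space[OF \<Omega>L])
    also have "\<dots> = (LINT x|lebesgue. indicator A x * f (phase R (\<eta> n) x))"
      using AL(2) by (intro Bochner_Integration.integral_cong) (auto simp: indicator_def)
    also have "\<dots> = (LINT x|lebesgue. indicator S x * f (phase R (\<eta> n) x))"
    proof (rule integral_cong_AE)
      show "(\<lambda>x. indicator A x * f (phase R (\<eta> n) x)) \<in> borel_measurable lebesgue"
        using AL(1) fl by (intro borel_measurable_times borel_measurable_indicator)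
      show "(\<lambda>x. indicator S x * f (phase R (\<eta> n) x)) \<in> borel_measurable lebesgue"
        using gm by (rule measurable_completion)
      show "AE x in lebesgue. indicator A x * f (phase R (\<eta> n) x) = indicator S x * f (phase R (\<eta> n) x)"
        by (rule AE_I'[OF N]) (auto simp: SN(1) indicator_def)
    qed
    also have "\<dots> = (LINT x|lborel. indicator S x * f (phase R (\<eta> n) x))"
      by (rule integral_completion[OF gm])
    finally show ?thesis .
  qed
  have "measure (lebesgue_on \<Omega>) A = measure lebesgue A"
    using measure_restrict_space[OF \<Omega>L AL(2)] .
  also have "\<dots> = measure lborel S"
    unfolding measure_def SN(1) using SN(4) N by (subst emeasure_Un_null_set) auto
  finally show ?thesis
    unfolding eq using oscillating_mean_value[OF irr f S \<eta>] by simp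
qed

text \<open>The product of two simple tests is a finite sum of terms to which the mean value property applies.\<close>

lemma two_scale_simple_mean:
  fixes R :: "real^'n^'m"
  assumes irr: "\<And>k :: int^'m. k \<noteq> 0 \<Longrightarrow> transpose R *v int_vec k \<noteq> 0"
    and \<Omega>: "open \<Omega>" "bounded \<Omega>" and D: "D \<subseteq> C_sharp"
    and \<eta>: "\<And>n. \<eta> n > 0" "\<eta> \<longlonglongrightarrow> 0"
    and s: "s \<in> simple_tests (lebesgue_on \<Omega>) D" and t: "t \<in> simple_tests (lebesgue_on \<Omega>) D"
  shows "(\<lambda>n. LINT x|lebesgue_on \<Omega>. s x (phase R (\<eta> n) x) * t x (phase R (\<eta> n) x))
    \<longlonglongrightarrow> (LINT p|two_scale_measure \<Omega>. s (fst p) (snd p) * t (fst p) (snd p))"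
proof -
  interpret O: finite_measure "lebesgue_on \<Omega>" by (rule finite_lebesgue_on[OF \<Omega>])
  interpret Y: finite_measure "cell_measure :: (real^'m) measure" by (rule finite_cell_measure)
  interpret pair_sigma_finite "lebesgue_on \<Omega>" "cell_measure :: (real^'m) measure" ..
  let ?I = "\<lambda>n s t. LINT x|lebesgue_on \<Omega>. apply_bcontfun (s x) (phase R (\<eta> n) x) * apply_bcontfun (t x) (phase R (\<eta> n) x)"
  let ?J = "\<lambda>s t. LINT p|two_scale_measure \<Omega>. apply_bcontfun (s (fst p)) (snd p) * apply_bcontfun (t (fst p)) (snd p)"
  let ?S = "simple_tests (lebesgue_on \<Omega>) D"
  have CS: "s x \<in> C_sharp" if "s \<in> ?S" for s x by (rule simple_tests_C_sharp[OF that D])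
  have SL: "s \<in> L2 (lebesgue_on \<Omega>)" if "s \<in> ?S" for s by (rule simple_tests_L2[OF O.finite_measure_axioms that])
  have l1: "(\<lambda>x. apply_bcontfun (s x) (phase R (\<eta> n) x)) \<in> L2 (lebesgue_on \<Omega>)" if "s \<in> ?S" for s n
    by (rule C_sharp_eval_L2(1)[OF SL[OF that] CS[OF that] phase_measurable])
  have l2: "(\<lambda>p. apply_bcontfun (s (fst p)) (snd p)) \<in> L2 (two_scale_measure \<Omega>)" if "s \<in> ?S" for s
    by (rule two_scale_lift_L2(1)[OF \<Omega> SL[OF that] CS[OF that]])
  have addI: "?I n (\<lambda>x. s x + s' x) t = ?I n s t + ?I n s' t" if "s \<in> ?S" "s' \<in> ?S" "t \<in> ?S" for n s s' t
    unfolding apply_bcontfun_add distrib_right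
    by (intro Bochner_Integration.integral_add L2_mult_integrable l1 that)
  have addJ: "?J (\<lambda>x. s x + s' x) t = ?J s t + ?J s' t" if "s \<in> ?S" "s' \<in> ?S" "t \<in> ?S" for s s' t
    unfolding apply_bcontfun_add distrib_right
    by (intro Bochner_Integration.integral_add L2_mult_integrable l2 that)
  have adds: "(\<lambda>n. ?I n (\<lambda>x. s x + s' x) t) \<longlonglongrightarrow> ?J (\<lambda>x. s x + s' x) t"
    if "s \<in> ?S" "s' \<in> ?S" "t \<in> ?S" "(\<lambda>n. ?I n s t) \<longlonglongrightarrow> ?J s t" "(\<lambda>n. ?I n s' t) \<longlonglongrightarrow> ?J s' t" for s s' t
    unfolding addI[OF that(1-3)] addJ[OF that(1-3)] by (rule tendsto_add[OF that(4,5)])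
  have bases: "(\<lambda>n. ?I n (\<lambda>x. (c * indicator A x) *\<^sub>R f) (\<lambda>x. (c' * indicator A' x) *\<^sub>R f'))
      \<longlonglongrightarrow> ?J (\<lambda>x. (c * indicator A x) *\<^sub>R f) (\<lambda>x. (c' * indicator A' x) *\<^sub>R f')"
    if A: "A \<in> sets (lebesgue_on \<Omega>)" "A' \<in> sets (lebesgue_on \<Omega>)" and f: "f \<in> D" "f' \<in> D" for A A' c c' f f'
  proof -
    obtain h :: "(real^'m) \<Rightarrow>\<^sub>C real" where h: "h \<in> C_sharp" "\<And>y. h y = f y * f' y"
      using C_sharp_mult[of f f'] f D by blast
    have AA: "A \<inter> A' \<in> sets (lebesgue_on \<Omega>)" using A by auto
    have e1: "?I n (\<lambda>x. (c * indicator A x) *\<^sub>R f) (\<lambda>x. (c' * indicator A' x) *\<^sub>R f')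
        = (c * c') * (LINT x|lebesgue_on \<Omega>. indicator (A \<inter> A') x * h (phase R (\<eta> n) x))" for n
      unfolding integral_mult_right_zero[symmetric]
      by (intro Bochner_Integration.integral_cong) (auto simp: apply_bcontfun_scaleR h(2) indicator_def)
    have hi: "integrable cell_measure h"
      by (rule cell_integrable_bounded[of _ "norm h"]) (auto simp: bcont_abs_le)
    have Ai: "integrable (lebesgue_on \<Omega>) (indicator (A \<inter> A') :: _ \<Rightarrow> real)"
      using AA by (intro integrable_real_indicator) (simp_all add: O.emeasure_finite less_top[symmetric])
    have e2: "?J (\<lambda>x. (c * indicator A x) *\<^sub>R f) (\<lambda>x. (c' * indicator A' x) *\<^sub>R f')
        = (c * c') * (LINT p|two_scale_measure \<Omega>. indicator (A \<inter> A') (fst p) * h (snd p))"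
      unfolding integral_mult_right_zero[symmetric]
      by (intro Bochner_Integration.integral_cong) (auto simp: apply_bcontfun_scaleR h(2) indicator_def)
    have ip: "integrable (two_scale_measure \<Omega>) (\<lambda>(x, y). indicator (A \<inter> A') x * h y)"
    proof (rule Fubini_integrable)
      show "(\<lambda>(x, y). indicator (A \<inter> A') x * h y) \<in> borel_measurable (two_scale_measure \<Omega>)"
        unfolding case_prod_beta'
        by (intro borel_measurable_times measurable_compose[OF measurable_fst borel_measurable_integrable[OF Ai]]
            measurable_compose[OF measurable_snd borel_measurable_integrable[OF hi]])
      show "integrable (lebesgue_on \<Omega>) (\<lambda>x. LINT y|cell_measure. norm (case (x, y) of (x, y) \<Rightarrow> indicator (A \<inter> A') x * h y))"
        using Ai by (simp add: abs_mult)
      show "AE x in lebesgue_on \<Omega>. integrable cell_measure (\<lambda>y. case (x, y) of (x, y) \<Rightarrow> indicator (A \<inter> A') x * h y)"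
        using hi by simp
    qed
    have "(LINT p|two_scale_measure \<Omega>. indicator (A \<inter> A') (fst p) * h (snd p))
        = measure (lebesgue_on \<Omega>) (A \<inter> A') * (LINT y|cell_measure. h y)"
    proof -
      have "A \<inter> A' \<inter> \<Omega> = A \<inter> A'" using sets.sets_into_space[OF AA] by auto
      then show ?thesis using integral_fst'[OF ip] by (simp add: case_prod_beta')
    qed
    then show ?thesis unfolding e1 e2
      using oscillating_mean_value_lebesgue[OF irr h(1) \<Omega> AA \<eta>]
      by (intro tendsto_mult tendsto_const) simp
  qed
  have half: "(\<lambda>n. ?I n (\<lambda>x. (c * indicator A x) *\<^sub>R f) t) \<longlonglongrightarrow> ?J (\<lambda>x. (c * indicator A x) *\<^sub>R f) t"
    if A: "A \<in> sets (lebesgue_on \<Omega>)" and f: "f \<in> D" and t: "t \<in> ?S" for A c f t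
    using t
  proof induction
    case (base A' f' c')
    show ?case by (rule bases[OF A base(1) f base(2)])
  next
    case (add t t')
    have b: "(\<lambda>x. (c * indicator A x) *\<^sub>R f) \<in> ?S" by (rule simple_tests.base[OF A f])
    show ?case
      using adds[OF add.hyps(1,2) b] add.IH by (simp add: mult.commute)
  qed
  show ?thesis using s
  proof induction
    case (base A f c)
    show ?case by (rule half[OF base t])
  next
    case (add s s')
    show ?case by (rule adds[OF add.hyps(1,2) t add.IH])
  qed
qed

lemma L2_bounded_multiplier:
  fixes f g :: "'a \<Rightarrow> real"
  assumes f: "f \<in> L2 M" and g: "g \<in> borel_measurable M" "\<And>x. \<bar>g x\<bar> \<le> B"
  shows "(\<lambda>x. f x * g x) \<in> L2 M" "(LINT x|M. (f x * g x)\<^sup>2) \<le> B\<^sup>2 * (LINT x|M. (f x)\<^sup>2)"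
proof -
  have [measurable]: "f \<in> borel_measurable M" "g \<in> borel_measurable M" using f g by (auto simp: L2_def)
  have b: "(f x * g x)\<^sup>2 \<le> B\<^sup>2 * (f x)\<^sup>2" for x
  proof -
    have "(g x)\<^sup>2 \<le> B\<^sup>2" by (rule power2_le_iff_abs_le[THEN iffD2, OF _ g(2)]) (use g(2)[of x] in linarith)
    then show ?thesis using mult_right_mono[of "(g x)\<^sup>2" "B\<^sup>2" "(f x)\<^sup>2"]
      by (simp add: power_mult_distrib mult.commute[of "(f x)\<^sup>2"])
  qed
  have i: "integrable M (\<lambda>x. B\<^sup>2 * (f x)\<^sup>2)" using L2_sq_integrable[OF f] by simp
  have i': "integrable M (\<lambda>x. (f x * g x)\<^sup>2)"
    by (rule Bochner_Integration.integrable_bound[OF i]) (use b in auto)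
  show "(\<lambda>x. f x * g x) \<in> L2 M" using i' by (simp add: L2_def)
  have "(LINT x|M. (f x * g x)\<^sup>2) \<le> (LINT x|M. B\<^sup>2 * (f x)\<^sup>2)" by (rule integral_mono[OF i' i b])
  then show "(LINT x|M. (f x * g x)\<^sup>2) \<le> B\<^sup>2 * (LINT x|M. (f x)\<^sup>2)" by simp
qed

lemma tendsto_of_uniform_approx:
  fixes a :: "nat \<Rightarrow> real"
  assumes "\<And>e. e > 0 \<Longrightarrow> \<exists>b l'. b \<longlonglongrightarrow> l' \<and> (\<forall>n. \<bar>a n - b n\<bar> \<le> e) \<and> \<bar>l - l'\<bar> \<le> e"
  shows "a \<longlonglongrightarrow> l"
proof (rule LIMSEQ_I)
  fix e :: real assume e: "e > 0"
  obtain b l' where b: "b \<longlonglongrightarrow> l'" and ab: "\<And>n. \<bar>a n - b n\<bar> \<le> e / 4" and l: "\<bar>l - l'\<bar> \<le> e / 4"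
    using assms[of "e/4"] e by auto
  obtain N where N: "\<And>n. n \<ge> N \<Longrightarrow> \<bar>b n - l'\<bar> < e / 4"
    using LIMSEQ_D[OF b, of "e/4"] e by auto
  have "norm (a n - l) < e" if "n \<ge> N" for n
    using N[OF that] ab[of n] l unfolding real_norm_def by linarith
  then show "\<exists>no. \<forall>n\<ge>no. norm (a n - l) < e" by blast
qed

text \<open>A countable family of sequences is treated at once, so that functions and rescaled gradients share the
subsequence. The functional defined by the limits on simple tests has the bound
\<open>\<bar>F(s)\<bar>\<^sup>2 \<le> B \<integral>\<integral>s\<^sup>2\<close>: the Cauchy-Schwarz inequality holds before the limit, and the mean value
property identifies the limit of the squared norms of \<open>s(x, R x/\<eta>)\<close>. Its Riesz representative is the
two-scale limit. Both sides of the claim are continuous in the norm of \<open>L\<^sup>2(\<Omega>, C_sharp)\<close>, in which the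
simple tests are dense.\<close>

lemma two_scale_compactness:
  fixes R :: "real^'n^'m" and v :: "'c::countable \<Rightarrow> nat \<Rightarrow> real^'n \<Rightarrow> real"
  assumes irr: "\<And>k :: int^'m. k \<noteq> 0 \<Longrightarrow> transpose R *v int_vec k \<noteq> 0"
    and \<Omega>: "open \<Omega>" "bounded \<Omega>"
    and \<eta>: "\<And>n. \<eta> n > 0" "\<eta> \<longlonglongrightarrow> 0"
    and v: "\<And>c n. v c n \<in> L2 (lebesgue_on \<Omega>)" and B: "\<And>c n. (LINT x|lebesgue_on \<Omega>. (v c n x)\<^sup>2) \<le> B c"
  obtains r :: "nat \<Rightarrow> nat" and w :: "'c \<Rightarrow> (real^'n) \<times> (real^'m) \<Rightarrow> real" where
    "strict_mono r" "\<And>c. w c \<in> L2 (two_scale_measure \<Omega>)"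
    "\<And>c \<phi>. \<phi> \<in> L2_C_sharp \<Omega> \<Longrightarrow>
      (\<lambda>n. LINT x|lebesgue_on \<Omega>. v c (r n) x * apply_bcontfun (\<phi> x) (phase R (\<eta> (r n)) x))
      \<longlonglongrightarrow> (LINT p|two_scale_measure \<Omega>. w c p * apply_bcontfun (\<phi> (fst p)) (snd p))"
proof -
  have finO: "finite_measure (lebesgue_on \<Omega>)" by (rule finite_lebesgue_on[OF \<Omega>])
  have finP: "finite_measure (two_scale_measure \<Omega> :: ((real^'n) \<times> (real^'m)) measure)"
    by (rule finite_measure_pair_measure[OF finite_cell_measure finO])
  obtain D where D: "countable D" "D \<subseteq> C_sharp" "C_sharp \<subseteq> closure (D :: ((real^'m) \<Rightarrow>\<^sub>C real) set)"
    by (rule C_sharp_separable)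
  have Dne: "D \<noteq> {}" using D(3) C_sharp_0 by auto
  let ?S = "simple_tests (lebesgue_on \<Omega>) D"
  have CS: "s x \<in> C_sharp" if "s \<in> ?S" for s x by (rule simple_tests_C_sharp[OF that D(2)])
  have SL: "s \<in> L2 (lebesgue_on \<Omega>)" if "s \<in> ?S" for s by (rule simple_tests_L2[OF finO that])
  have l1: "(\<lambda>x. apply_bcontfun (s x) (phase R (\<eta> n) x)) \<in> L2 (lebesgue_on \<Omega>)" if "s \<in> ?S" for s n
    by (rule C_sharp_eval_L2(1)[OF SL[OF that] CS[OF that] phase_measurable])
  have l2: "(\<lambda>p. apply_bcontfun (s (fst p)) (snd p)) \<in> L2 (two_scale_measure \<Omega>)" if "s \<in> ?S" for s
    by (rule two_scale_lift_L2(1)[OF \<Omega> SL[OF that] CS[OF that]])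
  define e where "e = (\<lambda>(c, f) n x. v c n x * apply_bcontfun f (phase R (\<eta> n) x))"
  have fm: "(\<lambda>x. apply_bcontfun f (phase R (\<eta> n) x)) \<in> borel_measurable (lebesgue_on \<Omega>)" for f :: "(real^'m) \<Rightarrow>\<^sub>C real" and n
    by (rule measurable_compose[OF phase_measurable C_sharp_borel])
  have eL: "e z n \<in> L2 (lebesgue_on \<Omega>)" for z n
    unfolding e_def case_prod_beta by (rule L2_bounded_multiplier(1)[OF v fm bcont_abs_le])
  have eB: "(LINT x|lebesgue_on \<Omega>. (e z n x)\<^sup>2) \<le> (norm (snd z))\<^sup>2 * B (fst z)" for z n
    unfolding e_def case_prod_beta
    by (rule order_trans[OF L2_bounded_multiplier(2)[OF v fm bcont_abs_le]]) (intro mult_left_mono B, simp)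
  have cD: "countable ((UNIV :: 'c set) \<times> D)" using D(1) by simp
  obtain r where r: "strict_mono (r :: nat \<Rightarrow> nat)"
    and rc: "\<And>z g. z \<in> UNIV \<times> D \<Longrightarrow> g \<in> L2 (lebesgue_on \<Omega>) \<Longrightarrow> convergent (\<lambda>n. LINT x|lebesgue_on \<Omega>. e z (r n) x * g x)"
    by (rule L2_bounded_weakly_convergent_subsequence[of "lebesgue_on \<Omega>" "UNIV \<times> D" e
          "\<lambda>z. (norm (snd z))\<^sup>2 * B (fst z)", OF finO cD eL eB])
      (erule that, simp)
  let ?I = "\<lambda>c n s. LINT x|lebesgue_on \<Omega>. v c (r n) x * apply_bcontfun (s x) (phase R (\<eta> (r n)) x)"
  have \<eta>r: "\<And>n. \<eta> (r n) > 0" "(\<lambda>n. \<eta> (r n)) \<longlonglongrightarrow> 0"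
    using \<eta> LIMSEQ_subseq_LIMSEQ[OF \<eta>(2) r] by (auto simp: o_def)
  have Iadd: "?I c n (\<lambda>x. a *\<^sub>R s x + b *\<^sub>R t x) = a * ?I c n s + b * ?I c n t" if "s \<in> ?S" "t \<in> ?S" for c n s t a b
  proof -
    have "?I c n (\<lambda>x. a *\<^sub>R s x + b *\<^sub>R t x) = (LINT x|lebesgue_on \<Omega>.
        a * (v c (r n) x * apply_bcontfun (s x) (phase R (\<eta> (r n)) x))
        + b * (v c (r n) x * apply_bcontfun (t x) (phase R (\<eta> (r n)) x)))"
      by (intro Bochner_Integration.integral_cong) (auto simp: apply_bcontfun_add apply_bcontfun_scaleR algebra_simps)
    also have "\<dots> = a * ?I c n s + b * ?I c n t"
      using L2_mult_integrable[OF v l1[OF that(1)]] L2_mult_integrable[OF v l1[OF that(2)]] by simp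
    finally show ?thesis .
  qed
  have conv: "convergent (\<lambda>n. ?I c n s)" if "s \<in> ?S" for c s
    using that
  proof induction
    case (base A f k)
    have "(\<lambda>x. k * indicator A x) \<in> L2 (lebesgue_on \<Omega>)"
    proof -
      have "(\<lambda>x. (k * indicator A x) *\<^sub>R (1::real)) \<in> L2 (lebesgue_on \<Omega>)"
        by (rule simple_tests_L2[OF finO simple_tests.base[OF base(1), of 1 UNIV]]) simp
      then show ?thesis by simp
    qed
    from rc[of "(c, f)", OF _ this] base(2)
    have "convergent (\<lambda>n. LINT x|lebesgue_on \<Omega>. e (c, f) (r n) x * (k * indicator A x))" by simp
    then show ?case by (simp add: e_def apply_bcontfun_scaleR mult.assoc mult.left_commute mult.commute)
  next
    case (add s t)
    have "?I c n (\<lambda>x. s x + t x) = ?I c n s + ?I c n t" for n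
      using Iadd[OF add.hyps(1,2), of c n 1 1] by simp
    then show ?case using add.IH by (simp add: convergent_add)
  qed
  define \<Lambda> where "\<Lambda> c s = lim (\<lambda>n. ?I c n s)" for c s
  have \<Lambda>: "(\<lambda>n. ?I c n s) \<longlonglongrightarrow> \<Lambda> c s" if "s \<in> ?S" for c s
    unfolding \<Lambda>_def using conv[OF that] by (simp add: convergent_LIMSEQ_iff)
  have "\<exists>w. w \<in> L2 (two_scale_measure \<Omega>) \<and>
      (\<forall>s\<in>?S. (LINT p|two_scale_measure \<Omega>. w p * apply_bcontfun (s (fst p)) (snd p)) = \<Lambda> c s)" for c
  proof -
    define P where "P = (\<lambda>s. (\<lambda>p. apply_bcontfun (s (fst p)) (snd p), \<Lambda> c s)) ` ?S"
    obtain p h where p: "p \<in> L2 (two_scale_measure \<Omega>)"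
      and pr: "\<And>f r. (f, r) \<in> P \<Longrightarrow> (LINT x|two_scale_measure \<Omega>. p x * f x) = r"
    proof (rule L2_Riesz_graph[of "two_scale_measure \<Omega>" P "B c"])
      show "finite_measure (two_scale_measure \<Omega> :: ((real^'n) \<times> (real^'m)) measure)" by (rule finP)
      obtain f where "f \<in> D" using Dne by blast
      then have "(\<lambda>x. (0 * indicator {} x) *\<^sub>R f) \<in> ?S" by (intro simple_tests.base) auto
      then show "P \<noteq> {}" unfolding P_def by blast
      show "f \<in> L2 (two_scale_measure \<Omega>)" if "(f, y) \<in> P" for f y
        using that l2 by (auto simp: P_def)
      show "(\<lambda>x. a * f x + b * g x, a * y + b * z) \<in> P" if fg: "(f, y) \<in> P" "(g, z) \<in> P" for f y g z a b
      proof -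
        obtain s t where st: "s \<in> ?S" "t \<in> ?S" and f: "f = (\<lambda>p. apply_bcontfun (s (fst p)) (snd p))" "y = \<Lambda> c s"
          and g: "g = (\<lambda>p. apply_bcontfun (t (fst p)) (snd p))" "z = \<Lambda> c t"
          using fg by (auto simp: P_def)
        have S: "(\<lambda>x. a *\<^sub>R s x + b *\<^sub>R t x) \<in> ?S"
          by (intro simple_tests.add simple_tests_scale st)
        have "(\<lambda>n. a * ?I c n s + b * ?I c n t) \<longlonglongrightarrow> a * \<Lambda> c s + b * \<Lambda> c t"
          by (intro tendsto_intros \<Lambda> st)
        then have "\<Lambda> c (\<lambda>x. a *\<^sub>R s x + b *\<^sub>R t x) = a * \<Lambda> c s + b * \<Lambda> c t"
          using \<Lambda>[OF S, of c] unfolding Iadd[OF st] by (rule LIMSEQ_unique[rotated])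
        then show ?thesis unfolding P_def f g
          by (intro image_eqI[OF _ S]) (simp add: apply_bcontfun_add apply_bcontfun_scaleR)
      qed
      show "y\<^sup>2 \<le> B c * (LINT x|two_scale_measure \<Omega>. (f x)\<^sup>2)" if fy: "(f, y) \<in> P" for f y
      proof -
        obtain s where s: "s \<in> ?S" and f: "f = (\<lambda>p. apply_bcontfun (s (fst p)) (snd p))" "y = \<Lambda> c s"
          using fy by (auto simp: P_def)
        have lim: "(\<lambda>n. B c * (LINT x|lebesgue_on \<Omega>. (apply_bcontfun (s x) (phase R (\<eta> (r n)) x))\<^sup>2))
            \<longlonglongrightarrow> B c * (LINT x|two_scale_measure \<Omega>. (f x)\<^sup>2)"
          using two_scale_simple_mean[OF irr \<Omega> D(2) \<eta>r s s] unfolding f power2_eq_square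
          by (intro tendsto_mult tendsto_const)
        have "(?I c n s)\<^sup>2 \<le> B c * (LINT x|lebesgue_on \<Omega>. (apply_bcontfun (s x) (phase R (\<eta> (r n)) x))\<^sup>2)" for n
          by (rule order_trans[OF L2_Cauchy_Schwarz[OF v l1[OF s]]]) (intro mult_right_mono B, simp)
        then show ?thesis unfolding f(2)
          by (intro LIMSEQ_le[OF tendsto_power[OF \<Lambda>[OF s]] lim]) auto
      qed
    qed (rule that)
    have "(LINT q|two_scale_measure \<Omega>. p q * apply_bcontfun (s (fst q)) (snd q)) = \<Lambda> c s" if "s \<in> ?S" for s
      by (rule pr) (use that in \<open>auto simp: P_def\<close>)
    with p show ?thesis by blast
  qed
  then have "\<forall>c. \<exists>w. w \<in> L2 (two_scale_measure \<Omega>) \<and>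
      (\<forall>s\<in>?S. (LINT p|two_scale_measure \<Omega>. w p * apply_bcontfun (s (fst p)) (snd p)) = \<Lambda> c s)" ..
  from choice[OF this] obtain w where w0: "\<forall>c. w c \<in> L2 (two_scale_measure \<Omega>) \<and>
      (\<forall>s\<in>?S. (LINT p|two_scale_measure \<Omega>. w c p * apply_bcontfun (s (fst p)) (snd p)) = \<Lambda> c s)" ..
  have w: "w c \<in> L2 (two_scale_measure \<Omega>)" for c using w0 by simp
  have ws: "(LINT p|two_scale_measure \<Omega>. w c p * apply_bcontfun (s (fst p)) (snd p)) = \<Lambda> c s" if "s \<in> ?S" for c s
    using w0 that by simp
  let ?J = "\<lambda>c \<phi>. LINT p|two_scale_measure \<Omega>. w c p * apply_bcontfun (\<phi> (fst p)) (snd p)"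
  have main: "(\<lambda>n. ?I c n \<phi>) \<longlonglongrightarrow> ?J c \<phi>" if \<phi>: "\<phi> \<in> L2_C_sharp \<Omega>" for c \<phi>
  proof (rule tendsto_of_uniform_approx)
    fix \<epsilon> :: real assume \<epsilon>: "\<epsilon> > 0"
    have \<phi>L: "\<phi> \<in> L2 (lebesgue_on \<Omega>)" and \<phi>C: "\<And>x. x \<in> \<Omega> \<Longrightarrow> \<phi> x \<in> C_sharp"
      using \<phi> by (auto simp: L2_C_sharp_def)
    define K where "K = sqrt (B c) + sqrt (LINT p|two_scale_measure \<Omega>. (w c p)\<^sup>2)"
    have B0: "B c \<ge> 0" using order_trans[OF _ B[of c 0]] by simp
    have K0: "K \<ge> 0" using B0 by (simp add: K_def)
    \<comment> \<open>the squared distance to a simple test for which both error terms are at most \<open>\<epsilon>\<close>\<close>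
    define d where "d = (\<epsilon> / (K + 1))\<^sup>2"
    have d: "d > 0" using \<epsilon> K0 by (simp add: d_def)
    have sd: "sqrt d = \<epsilon> / (K + 1)" using \<epsilon> K0 by (simp add: d_def)
    have Kd: "k * sqrt d \<le> \<epsilon>" if "0 \<le> k" "k \<le> K" for k
    proof -
      have "k * \<epsilon> \<le> \<epsilon> * (K + 1)" using \<epsilon> that by (simp add: mult.commute[of k] mult_left_mono)
      then show ?thesis using K0 by (simp add: sd field_simps)
    qed
    have cl: "\<And>x. x \<in> space (lebesgue_on \<Omega>) \<Longrightarrow> \<phi> x \<in> closure D" using \<phi>C D(3) by auto
    obtain s where s: "s \<in> ?S" and ds: "(\<lambda>x. \<phi> x - s x) \<in> L2 (lebesgue_on \<Omega>)"
      and dd: "(LINT x|lebesgue_on \<Omega>. (norm (\<phi> x - s x))\<^sup>2) < d"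
      by (rule L2_approx_simple_tests[OF finO \<phi>L D(1) Dne cl d])
    have dC: "\<phi> x - s x \<in> C_sharp" if "x \<in> \<Omega>" for x
      using C_sharp_add[OF \<phi>C[OF that] C_sharp_scaleR[OF CS[OF s], of "-1" x]] by simp
    have dC': "\<And>x. x \<in> space (lebesgue_on \<Omega>) \<Longrightarrow> \<phi> x - s x \<in> C_sharp" using dC by simp
    have \<phi>C': "\<And>x. x \<in> space (lebesgue_on \<Omega>) \<Longrightarrow> \<phi> x \<in> C_sharp" using \<phi>C by simp
    note \<phi>1 = C_sharp_eval_L2(1)[OF \<phi>L \<phi>C' phase_measurable]
    note \<phi>2 = two_scale_lift_L2(1)[OF \<Omega> \<phi>L \<phi>C]
    have "\<bar>?I c n \<phi> - ?I c n s\<bar> \<le> \<epsilon>" for n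
    proof -
      have "?I c n \<phi> - ?I c n s = (LINT x|lebesgue_on \<Omega>. v c (r n) x * apply_bcontfun (\<phi> x - s x) (phase R (\<eta> (r n)) x))"
        unfolding apply_bcontfun_diff right_diff_distrib
        by (rule Bochner_Integration.integral_diff[symmetric]; intro L2_mult_integrable v \<phi>1 l1 s)
      also have "\<bar>\<dots>\<bar> \<le> sqrt (LINT x|lebesgue_on \<Omega>. (v c (r n) x)\<^sup>2)
          * sqrt (LINT x|lebesgue_on \<Omega>. (apply_bcontfun (\<phi> x - s x) (phase R (\<eta> (r n)) x))\<^sup>2)"
        by (rule L2_Cauchy_Schwarz_abs[OF v C_sharp_eval_L2(1)[OF ds dC' phase_measurable]])
      also have "\<dots> \<le> sqrt (B c) * sqrt d"
        using B0 B[of c "r n"] dd C_sharp_eval_L2(2)[OF ds dC' phase_measurable, of "\<eta> (r n)" R]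
        by (intro mult_mono) auto
      also have "\<dots> \<le> \<epsilon>" by (rule Kd) (simp_all add: K_def B0)
      finally show ?thesis .
    qed
    moreover have "\<bar>?J c \<phi> - ?J c s\<bar> \<le> \<epsilon>"
    proof -
      have "?J c \<phi> - ?J c s = (LINT p|two_scale_measure \<Omega>. w c p * apply_bcontfun (\<phi> (fst p) - s (fst p)) (snd p))"
        unfolding apply_bcontfun_diff right_diff_distrib
        by (rule Bochner_Integration.integral_diff[symmetric]; intro L2_mult_integrable w \<phi>2 l2 s)
      also have "\<bar>\<dots>\<bar> \<le> sqrt (LINT p|two_scale_measure \<Omega>. (w c p)\<^sup>2)
          * sqrt (LINT p|two_scale_measure \<Omega>. (apply_bcontfun (\<phi> (fst p) - s (fst p)) (snd p))\<^sup>2)"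
        by (rule L2_Cauchy_Schwarz_abs[OF w two_scale_lift_L2(1)[OF \<Omega> ds dC]])
      also have "\<dots> \<le> sqrt (LINT p|two_scale_measure \<Omega>. (w c p)\<^sup>2) * sqrt d"
        using dd two_scale_lift_L2(2)[OF \<Omega> ds dC] by (intro mult_left_mono) auto
      also have "\<dots> \<le> \<epsilon>" by (rule Kd) (simp_all add: K_def B0)
      finally show ?thesis .
    qed
    moreover have "(\<lambda>n. ?I c n s) \<longlonglongrightarrow> ?J c s" using \<Lambda>[OF s] by (simp add: ws[OF s])
    ultimately show "\<exists>b l'. b \<longlonglongrightarrow> l' \<and> (\<forall>n. \<bar>?I c n \<phi> - b n\<bar> \<le> \<epsilon>) \<and> \<bar>?J c \<phi> - l'\<bar> \<le> \<epsilon>"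
      by (intro exI[of _ "\<lambda>n. ?I c n s"] exI[of _ "?J c s"]) simp
  qed
  show ?thesis by (rule that[OF r w main])
qed

section \<open>Smooth functions\<close>

lemma grad_eqI:
  assumes "(f has_derivative f') (at x)" shows "grad f x $ i = f' (axis i 1)"
  unfolding grad_def using frechet_derivative_at[OF assms] by simp

lemma C_k_const: "C_k k (\<lambda>x :: real^'n. c)"
proof (induction k arbitrary: c)
  case (Suc k)
  have "grad (\<lambda>x :: real^'n. c) x $ i = 0" for x i
    using grad_eqI[OF has_derivative_const[of c "at x"]] by simp
  with Suc show ?case by simp
qed simp

lemma C_k_Suc_imp: "C_k (Suc k) f \<Longrightarrow> C_k k f" for f :: "real^'n \<Rightarrow> real"
proof (induction k arbitrary: f)
  case 0
  then have "f differentiable (at x)" for x by simp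
  then show ?case by (simp add: continuous_on_eq_continuous_within differentiable_imp_continuous_within)
next
  case (Suc k)
  then show ?case by (metis C_k.simps(2))
qed

lemma C_k_add:
  fixes f g :: "real^'n \<Rightarrow> real"
  assumes "C_k k f" "C_k k g" shows "C_k k (\<lambda>x. f x + g x)"
  using assms
proof (induction k arbitrary: f g)
  case 0 then show ?case by (simp add: continuous_on_add)
next
  case (Suc k)
  have d: "(f has_derivative frechet_derivative f (at x)) (at x)" "(g has_derivative frechet_derivative g (at x)) (at x)" for x
    using Suc.prems by (simp_all add: frechet_derivative_works)
  have "grad (\<lambda>x. f x + g x) x $ i = grad f x $ i + grad g x $ i" for x i
    using grad_eqI[OF has_derivative_add[OF d(1)[of x] d(2)[of x]]] grad_eqI[OF d(1)[of x]] grad_eqI[OF d(2)[of x]] by simp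
  moreover have "(\<lambda>x. f x + g x) differentiable (at x)" for x
    using Suc.prems by (intro differentiable_add) auto
  ultimately show ?case using Suc by simp
qed

lemma grad_mult:
  fixes f g :: "real^'n \<Rightarrow> real"
  assumes "f differentiable (at x)" "g differentiable (at x)"
  shows "grad (\<lambda>x. f x * g x) x $ i = f x * grad g x $ i + grad f x $ i * g x"
proof -
  have d: "(f has_derivative frechet_derivative f (at x)) (at x)" "(g has_derivative frechet_derivative g (at x)) (at x)"
    using assms by (simp_all add: frechet_derivative_works)
  show ?thesis
    using grad_eqI[OF has_derivative_mult[OF d]] grad_eqI[OF d(1)] grad_eqI[OF d(2)] by simp
qed

lemma C_k_mult:
  fixes f g :: "real^'n \<Rightarrow> real"
  assumes "C_k k f" "C_k k g" shows "C_k k (\<lambda>x. f x * g x)"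
  using assms
proof (induction k arbitrary: f g)
  case 0 then show ?case by (simp add: continuous_on_mult)
next
  case (Suc k)
  have d: "f differentiable (at x)" "g differentiable (at x)" for x using Suc.prems by auto
  have m: "C_k k f" "C_k k g" using Suc.prems C_k_Suc_imp by blast+
  have "C_k k (\<lambda>x. f x * grad g x $ i + grad f x $ i * g x)" for i
    using Suc.prems m by (intro C_k_add Suc.IH) auto
  moreover have "(\<lambda>x. f x * g x) differentiable (at x)" for x
    using d by (intro differentiable_mult)
  ultimately show ?case by (simp add: grad_mult[OF d])
qed

lemma C_k_sum:
  fixes f :: "'i \<Rightarrow> real^'n \<Rightarrow> real"
  assumes "\<And>i. i \<in> I \<Longrightarrow> C_k k (f i)" shows "C_k k (\<lambda>x. \<Sum>i\<in>I. f i x)"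
  using assms by (induction I rule: infinite_finite_induct) (auto intro: C_k_const C_k_add)

lemma C_k_prod:
  fixes f :: "'i \<Rightarrow> real^'n \<Rightarrow> real"
  assumes "\<And>i. i \<in> I \<Longrightarrow> C_k k (f i)" shows "C_k k (\<lambda>x. \<Prod>i\<in>I. f i x)"
  using assms by (induction I rule: infinite_finite_induct) (auto intro: C_k_const C_k_mult)

lemma transpose_mult_nth: "(transpose R *v w) $ i = (\<Sum>j\<in>UNIV. R $ j $ i * w $ j)"
  by (simp only: matrix_vector_mult_def transpose_def vec_lambda_beta)

lemma grad_compose_affine:
  fixes f :: "real^'m \<Rightarrow> real" and R :: "real^'n^'m"
  assumes "f differentiable (at (c *\<^sub>R (R *v x) + b))"
  shows "(\<lambda>x. f (c *\<^sub>R (R *v x) + b)) differentiable (at x)"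
    and "grad (\<lambda>x. f (c *\<^sub>R (R *v x) + b)) x $ i = c * (transpose R *v grad f (c *\<^sub>R (R *v x) + b)) $ i"
proof -
  let ?f' = "frechet_derivative f (at (c *\<^sub>R (R *v x) + b))"
  have d: "(f has_derivative ?f') (at (c *\<^sub>R (R *v x) + b))"
    using assms by (simp add: frechet_derivative_works)
  have "((\<lambda>x. c *\<^sub>R (R *v x) + b) has_derivative (\<lambda>h. c *\<^sub>R (R *v h))) (at x)"
    by (auto intro!: derivative_eq_intros bounded_linear_imp_has_derivative matrix_vector_mul_bounded_linear)
  from has_derivative_compose[OF this d]
  have D: "((\<lambda>x. f (c *\<^sub>R (R *v x) + b)) has_derivative (\<lambda>h. ?f' (c *\<^sub>R (R *v h)))) (at x)" .
  then show "(\<lambda>x. f (c *\<^sub>R (R *v x) + b)) differentiable (at x)" by (rule differentiableI)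
  interpret linear ?f' using d by (rule has_derivative_linear)
  have "R *v axis i 1 = (\<Sum>j\<in>UNIV. R $ j $ i *\<^sub>R axis j 1)"
    unfolding matrix_vector_mult_basis
    by (simp add: vec_eq_iff column_def axis_def if_distrib cong: if_cong)
  then have "?f' (c *\<^sub>R (R *v axis i 1)) = c * (\<Sum>j\<in>UNIV. R $ j $ i * ?f' (axis j 1))"
    by (simp add: scale sum)
  also have "\<dots> = c * (transpose R *v grad f (c *\<^sub>R (R *v x) + b)) $ i"
    unfolding transpose_mult_nth grad_eqI[OF d] ..
  finally show "grad (\<lambda>x. f (c *\<^sub>R (R *v x) + b)) x $ i = c * (transpose R *v grad f (c *\<^sub>R (R *v x) + b)) $ i"
    using grad_eqI[OF D] by simp
qed

lemma C_k_compose_affine: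
  fixes f :: "real^'m \<Rightarrow> real" and R :: "real^'n^'m"
  assumes "C_k k f" shows "C_k k (\<lambda>x. f (c *\<^sub>R (R *v x) + b))"
  using assms
proof (induction k arbitrary: f)
  case 0
  have "continuous_on UNIV (\<lambda>x. c *\<^sub>R (R *v x) + b)"
    by (intro continuous_intros linear_continuous_on matrix_vector_mul_bounded_linear)
  with 0 show ?case by (auto intro: continuous_on_compose2)
next
  case (Suc k)
  have d: "f differentiable (at y)" for y using Suc.prems by simp
  have "C_k k (\<lambda>x. c * (\<Sum>j\<in>UNIV. R $ j $ i * grad f (c *\<^sub>R (R *v x) + b) $ j))" for i
    using Suc.prems by (intro C_k_mult C_k_const C_k_sum Suc.IH) auto
  moreover have "grad (\<lambda>x. f (c *\<^sub>R (R *v x) + b)) x $ i = c * (\<Sum>j\<in>UNIV. R $ j $ i * grad f (c *\<^sub>R (R *v x) + b) $ j)" for x i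
    unfolding grad_compose_affine(2)[OF d] transpose_mult_nth ..
  ultimately show ?case by (auto intro!: grad_compose_affine(1) d)
qed

text \<open>For \<open>j = 0\<close> this is the classical smooth function that vanishes for \<open>t \<le> 0\<close>. The factor \<open>t\<^sup>-\<^sup>j\<close>
makes the family closed under differentiation up to linear combinations.\<close>

definition flat_exp :: "nat \<Rightarrow> real \<Rightarrow> real" where
  "flat_exp j t = (if t \<le> 0 then 0 else (1 / t) ^ j * exp (- (1 / t)))"

lemma flat_exp_tendsto_0: "(flat_exp j \<longlongrightarrow> 0) (at_right 0)"
proof -
  have "((\<lambda>t. inverse t ^ j / exp (inverse t)) \<longlongrightarrow> (0::real)) (at_right 0)"
    by (rule filterlim_compose[OF tendsto_power_div_exp_0 filterlim_inverse_at_top_right])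
  moreover have "\<forall>\<^sub>F t in at_right 0. inverse t ^ j / exp (inverse t) = flat_exp j t"
    by (rule eventually_at_rightI[of 0 1]) (auto simp: flat_exp_def exp_minus inverse_eq_divide)
  ultimately show ?thesis by (rule Lim_transform_eventually)
qed

lemma flat_exp_has_derivative:
  "(flat_exp j has_real_derivative (flat_exp (j + 2) t - real j * flat_exp (j + 1) t)) (at t)"
proof (cases t "0 :: real" rule: linorder_cases)
  case less
  have "((\<lambda>_. 0) has_real_derivative 0) (at t)" by simp
  then have "(flat_exp j has_real_derivative 0) (at t)"
    by (rule has_field_derivative_transform_within_open[of _ _ _ "{..<0}"]) (use less in \<open>auto simp: flat_exp_def\<close>)
  then show ?thesis using less by (simp add: flat_exp_def)
next
  case greater
  have D1: "((\<lambda>t. 1 / t) has_real_derivative - ((1 / t)\<^sup>2)) (at t)"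
    using greater by (auto intro!: derivative_eq_intros simp: power2_eq_square field_simps)
  have e: "real j * (- ((1 / t)\<^sup>2) * (1 / t) ^ (j - Suc 0)) = - (real j * (1 / t) ^ (j + 1))"
    by (cases j) (simp_all add: power2_eq_square)
  have "((\<lambda>t. (1 / t) ^ j * exp (- (1 / t))) has_real_derivative
      ((1 / t) ^ (j + 2) * exp (- (1 / t)) - real j * ((1 / t) ^ (j + 1) * exp (- (1 / t))))) (at t)"
    by (rule DERIV_cong[OF DERIV_mult[OF DERIV_power[OF D1] DERIV_fun_exp[OF DERIV_minus[OF D1]]]])
      (unfold e, simp add: power_add power2_eq_square algebra_simps)
  then have "(flat_exp j has_real_derivative
      ((1 / t) ^ (j + 2) * exp (- (1 / t)) - real j * ((1 / t) ^ (j + 1) * exp (- (1 / t))))) (at t)"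
    by (rule has_field_derivative_transform_within_open[of _ _ _ "{0<..}"]) (use greater in \<open>auto simp: flat_exp_def\<close>)
  then show ?thesis using greater by (simp add: flat_exp_def)
next
  case equal
  have "(flat_exp j has_real_derivative 0) (at 0)"
    unfolding has_field_derivative_iff
  proof (rule filterlim_split_at)
    have "\<forall>\<^sub>F t in at_left 0. 0 = (flat_exp j t - flat_exp j 0) / (t - 0)"
      by (rule eventually_at_leftI[of "-1" 0]) (auto simp: flat_exp_def)
    then show "((\<lambda>t. (flat_exp j t - flat_exp j 0) / (t - 0)) \<longlongrightarrow> 0) (at_left 0)"
      by (rule Lim_transform_eventually[OF tendsto_const])
    have "\<forall>\<^sub>F t in at_right 0. flat_exp (j + 1) t = (flat_exp j t - flat_exp j 0) / (t - 0)"
      by (rule eventually_at_rightI[of 0 1]) (auto simp: flat_exp_def)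
    then show "((\<lambda>t. (flat_exp j t - flat_exp j 0) / (t - 0)) \<longlongrightarrow> 0) (at_right 0)"
      by (rule Lim_transform_eventually[OF flat_exp_tendsto_0])
  qed
  then show ?thesis using equal by (simp add: flat_exp_def)
qed

lemma C_k_flat_exp: "C_k k (\<lambda>x :: real^'n. flat_exp j (c * x $ i + d))"
proof (induction k arbitrary: j)
  case 0
  have "continuous_on UNIV (flat_exp j)"
    by (rule DERIV_continuous_on) (rule has_field_derivative_at_within[OF flat_exp_has_derivative])
  then show ?case by (auto intro!: continuous_on_compose2[of UNIV "flat_exp j"] continuous_intros)
next
  case (Suc k)
  define l where "l x = (c * (x :: real^'n) $ i + d)" for x
  have D: "((\<lambda>x. flat_exp j (l x)) has_derivative
      (\<lambda>h. (flat_exp (j + 2) (l x) - real j * flat_exp (j + 1) (l x)) * (c * h $ i))) (at x)" for x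
  proof -
    have "(l has_derivative (\<lambda>h. c * h $ i)) (at x)"
      unfolding l_def
      by (auto intro!: derivative_eq_intros bounded_linear_imp_has_derivative bounded_linear_vec_nth)
    from has_derivative_compose[OF this has_field_derivative_imp_has_derivative[OF flat_exp_has_derivative]]
    show ?thesis by (simp add: mult.commute)
  qed
  have "C_k k (\<lambda>x. (flat_exp (j + 2) (l x) + (- real j) * flat_exp (j + 1) (l x)) * (c * axis i' 1 $ i))" for i'
    unfolding l_def by (intro C_k_mult C_k_add C_k_const Suc.IH)
  then have "C_k k (\<lambda>x. grad (\<lambda>x. flat_exp j (l x)) x $ i')" for i'
    by (simp add: grad_eqI[OF D])
  moreover have "(\<lambda>x. flat_exp j (l x)) differentiable (at x)" for x
    using D by (rule differentiableI)
  ultimately show ?case by (simp add: l_def)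
qed

text \<open>Smooth functions supported in a box. With the scaling by \<open>Suc n\<close> each factor \<open>exp (-1/t)\<close> becomes
\<open>exp (-1/((n+1) t))\<close>, so that the functions converge to the indicator function of the open box.\<close>

definition box_bump :: "nat \<Rightarrow> real^'n \<Rightarrow> real^'n \<Rightarrow> real^'n \<Rightarrow> real" where
  "box_bump n a b x = (\<Prod>i\<in>UNIV. flat_exp 0 (real (Suc n) * (x $ i - a $ i)) * flat_exp 0 (real (Suc n) * (b $ i - x $ i)))"

lemma C_k_box_bump: "C_k k (box_bump n a b :: real^'n \<Rightarrow> real)"
proof -
  have "box_bump n a b = (\<lambda>x. \<Prod>i\<in>UNIV. flat_exp 0 (real (Suc n) * x $ i + - (real (Suc n) * a $ i))
      * flat_exp 0 ((- real (Suc n)) * x $ i + real (Suc n) * b $ i))"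
    unfolding box_bump_def
    by (intro ext prod.cong refl arg_cong2[where f="(*)"] arg_cong[where f="flat_exp 0"])
      (simp_all add: right_diff_distrib del: of_nat_Suc)
  then show ?thesis by (simp only:) (intro C_k_prod C_k_mult C_k_flat_exp)
qed

lemma flat_exp_0_bounds: "0 \<le> flat_exp 0 t" "flat_exp 0 t \<le> 1"
  by (auto simp: flat_exp_def)

lemma box_bump_bounds: "0 \<le> box_bump n a b x" "box_bump n a b x \<le> 1"
  unfolding box_bump_def using flat_exp_0_bounds
  by (auto intro!: prod_nonneg prod_le_1 mult_le_one)

lemma box_bump_eq_0: "x \<notin> box a b \<Longrightarrow> box_bump n a b x = 0"
proof -
  assume "x \<notin> box a b"
  then obtain i where "x $ i \<le> a $ i \<or> b $ i \<le> x $ i" by (force simp: mem_box_cart not_less)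
  then have "flat_exp 0 (real (Suc n) * (x $ i - a $ i)) * flat_exp 0 (real (Suc n) * (b $ i - x $ i)) = 0"
    by (auto simp: flat_exp_def mult_le_0_iff)
  then show ?thesis unfolding box_bump_def by (intro prod_zero) auto
qed

lemma box_bump_tendsto: "(\<lambda>n. box_bump n a b x) \<longlonglongrightarrow> indicator (box a b) x"
proof (cases "x \<in> box a b")
  case False
  then show ?thesis by (simp add: box_bump_eq_0)
next
  case True
  have "(\<lambda>n. flat_exp 0 (real (Suc n) * t)) \<longlonglongrightarrow> 1" if t: "t > 0" for t
  proof -
    have "(\<lambda>n. exp (- (inverse (real (Suc n)) * (1 / t)))) \<longlonglongrightarrow> exp (- (0 * (1 / t)))"
      by (intro tendsto_intros LIMSEQ_inverse_real_of_nat)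
    moreover have "exp (- (inverse (real (Suc n)) * (1 / t))) = flat_exp 0 (real (Suc n) * t)" for n
    proof -
      have "0 < real (Suc n) * t" using t by simp
      then show ?thesis by (simp add: flat_exp_def not_le inverse_eq_divide del: of_nat_Suc)
    qed
    ultimately show ?thesis by simp
  qed
  then have "(\<lambda>n. box_bump n a b x) \<longlonglongrightarrow> (\<Prod>i\<in>(UNIV :: 'a set). 1 * 1)"
    unfolding box_bump_def using True by (intro tendsto_prod tendsto_mult) (auto simp: mem_box_cart)
  then show ?thesis using True by simp
qed

lemma test_functionsI:
  assumes "\<And>k. C_k k \<phi>" "\<And>x. \<phi> x \<noteq> 0 \<Longrightarrow> x \<in> cbox a b" "cbox a b \<subseteq> S"
  shows "\<phi> \<in> test_functions S"
proof -
  have sub: "closure {x. \<phi> x \<noteq> 0} \<subseteq> cbox a b"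
    by (rule closure_minimal) (use assms(2) in auto)
  then have "compact (closure {x. \<phi> x \<noteq> 0})"
    by (metis bounded_cbox bounded_subset closed_closure compact_eq_bounded_closed)
  then show ?thesis using assms sub by (auto simp: test_functions_def)
qed

lemma C_k_imp_continuous_grad:
  assumes "C_k (Suc 0) f" shows "continuous_on UNIV f" "continuous_on UNIV (\<lambda>x. grad f x $ i)"
    "f differentiable (at x)"
  using assms C_k_Suc_imp[OF assms] by auto

text \<open>Outside the closed support the function vanishes in a neighbourhood, so its gradient vanishes too.\<close>

lemma test_function_support:
  assumes "\<psi> \<in> test_functions S"
  obtains B where "\<And>y. B \<le> norm y \<Longrightarrow> \<psi> y = 0" "\<And>y. B \<le> norm y \<Longrightarrow> grad \<psi> y = 0"
proof -
  let ?K = "closure {x. \<psi> x \<noteq> 0}"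
  have "bounded ?K" using assms by (auto simp: test_functions_def compact_imp_bounded)
  then obtain B' where B': "\<forall>y\<in>?K. norm y \<le> B'" unfolding bounded_iff ..
  define B where "B = B' + 1"
  have B: "norm y < B" if "y \<in> ?K" for y using bspec[OF B' that] by (simp add: B_def)
  have z: "\<psi> y = 0" if "y \<notin> ?K" for y
    using that closure_subset[of "{x. \<psi> x \<noteq> 0}"] by auto
  have g: "grad \<psi> y = 0" if "y \<notin> ?K" for y
  proof -
    have "((\<lambda>_. 0) has_derivative (\<lambda>_. 0)) (at y)" by simp
    then have "(\<psi> has_derivative (\<lambda>_. 0)) (at y)"
    proof (rule has_derivative_transform_within_open)
      show "open (- ?K)" by (simp add: open_Compl)
      show "y \<in> - ?K" using that by simp
      show "0 = \<psi> x" if "x \<in> - ?K" for x using z[of x] that by simp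
    qed
    then show ?thesis by (simp add: vec_eq_iff grad_eqI)
  qed
  show ?thesis
  proof (rule that)
    show "\<psi> y = 0" if "B \<le> norm y" for y using z[of y] B[of y] that by fastforce
    show "grad \<psi> y = 0" if "B \<le> norm y" for y using g[of y] B[of y] that by fastforce
  qed
qed

section \<open>The fundamental lemma of the calculus of variations\<close>

text \<open>Almost every value of \<open>f\<close> is a limit of averages over cubes.\<close>

lemma integral_cbox_eq_0_imp_AE_0:
  fixes f :: "'a::euclidean_space \<Rightarrow> real"
  assumes i: "integrable lebesgue f" and z: "\<And>a b. (LINT x|lebesgue_on (cbox a b). f x) = 0"
  shows "AE x in lebesgue. f x = 0"
proof -
  have ib: "integrable (lebesgue_on (cbox a b)) f" for a b
  proof -
    have "integrable lebesgue (\<lambda>x. indicator (cbox a b) x *\<^sub>R f x)"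
      by (rule integrable_mult_indicator[OF _ i]) auto
    then show ?thesis by (subst integrable_restrict_space) auto
  qed
  have hk: "f integrable_on cbox a b" "integral (cbox a b) f = 0" for a b
    using z[of a b] lebesgue_integral_eq_integral[OF ib, of a b] integrable_on_lebesgue_on[OF ib] by auto
  obtain N where N: "negligible N" and
    c: "\<And>x e. x \<notin> N \<Longrightarrow> 0 < e \<Longrightarrow> \<exists>d>0. \<forall>h. 0 < h \<and> h < d \<longrightarrow>
      norm (integral (cbox x (x + h *\<^sub>R One)) f /\<^sub>R h ^ DIM('a) - f x) < e"
    using integrable_ccontinuous_explicit[of f] hk(1) by blast
  have "f x = 0" if x: "x \<notin> N" for x
  proof (rule ccontr)
    assume "f x \<noteq> 0"
    then obtain d where d: "d > 0" "\<forall>h. 0 < h \<and> h < d \<longrightarrow>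
      norm (integral (cbox x (x + h *\<^sub>R One)) f /\<^sub>R h ^ DIM('a) - f x) < \<bar>f x\<bar>"
      using c[OF x, of "\<bar>f x\<bar>"] by auto
    from d(2)[rule_format, of "d/2"] d(1) show False by (simp add: hk(2))
  qed
  then show ?thesis using N unfolding negligible_iff_null_sets by (intro AE_I'[of N]) auto
qed

text \<open>Letting the bumps tend to indicator functions gives integral \<open>0\<close> over every box in \<open>\<Omega>\<close>, and
\<open>\<Omega>\<close> is a countable union of boxes.\<close>

lemma fundamental_lemma_box_bump:
  fixes \<Omega> :: "(real^'n) set" and h :: "real^'n \<Rightarrow> real"
  assumes \<Omega>: "open \<Omega>" and h: "integrable (lebesgue_on \<Omega>) h"
    and z: "\<And>n a b. cbox a b \<subseteq> \<Omega> \<Longrightarrow> (LINT x|lebesgue_on \<Omega>. box_bump n a b x * h x) = 0"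
  shows "AE x in lebesgue_on \<Omega>. h x = 0"
proof -
  have \<Omega>L: "\<Omega> \<inter> space lebesgue \<in> sets lebesgue" using \<Omega> by (simp add: borel_open sets_completionI_sets)
  have bm: "box_bump n a b \<in> borel_measurable (lebesgue_on \<Omega>)" for n a b
  proof -
    have "box_bump n a b \<in> borel_measurable borel"
      using C_k_box_bump[of 0] by (intro borel_measurable_continuous_onI) simp
    then show ?thesis by (intro measurable_restrict_space1 measurable_completion) simp
  qed
  have b0: "(LINT x|lebesgue_on \<Omega>. indicator (box a b) x * h x) = 0" if ab: "cbox a b \<subseteq> \<Omega>" for a b
  proof -
    have "(\<lambda>n. LINT x|lebesgue_on \<Omega>. box_bump n a b x * h x) \<longlonglongrightarrow> (LINT x|lebesgue_on \<Omega>. indicator (box a b) x * h x)"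
    proof (rule integral_dominated_convergence[where w="\<lambda>x. \<bar>h x\<bar>"])
      have "box a b \<in> sets (lebesgue_on \<Omega>)"
        using ab box_subset_cbox[of a b] \<Omega>L by (auto simp: sets_restrict_space_iff)
      then show "(\<lambda>x. indicator (box a b) x * h x) \<in> borel_measurable (lebesgue_on \<Omega>)"
        using h by (intro borel_measurable_times borel_measurable_indicator) auto
      show "(\<lambda>x. box_bump n a b x * h x) \<in> borel_measurable (lebesgue_on \<Omega>)" for n
        using h bm by (intro borel_measurable_times) auto
      show "integrable (lebesgue_on \<Omega>) (\<lambda>x. \<bar>h x\<bar>)" using h by simp
      show "AE x in lebesgue_on \<Omega>. (\<lambda>n. box_bump n a b x * h x) \<longlonglongrightarrow> indicator (box a b) x * h x"
        by (rule AE_I2) (intro tendsto_mult box_bump_tendsto tendsto_const)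
      show "AE x in lebesgue_on \<Omega>. norm (box_bump n a b x * h x) \<le> \<bar>h x\<bar>" for n
        by (rule AE_I2) (simp add: abs_mult box_bump_bounds mult_left_le_one_le)
    qed
    then have "(\<lambda>n. 0) \<longlonglongrightarrow> (LINT x|lebesgue_on \<Omega>. indicator (box a b) x * h x)" by (simp add: z[OF ab])
    then show ?thesis using LIMSEQ_unique tendsto_const by blast
  qed
  have hl: "integrable lebesgue (\<lambda>x. indicator \<Omega> x * h x)"
    using h integrable_restrict_space[OF \<Omega>L, of h] by simp
  have loc: "AE x in lebesgue. x \<in> cbox c d \<longrightarrow> h x = 0" if cd: "cbox c d \<subseteq> \<Omega>" for c d
  proof -
    define H where "H x = indicator (cbox c d) x * h x" for x
    have Heq: "H x = indicator (cbox c d) x *\<^sub>R (indicator \<Omega> x * h x)" for x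
      using cd by (auto simp: H_def indicator_def)
    have Hi: "integrable lebesgue H"
      unfolding Heq by (rule integrable_mult_indicator[OF _ hl]) auto
    have "(LINT x|lebesgue_on (cbox a b). H x) = 0" for a b
    proof -
      obtain p q where pq: "cbox a b \<inter> cbox c d = cbox p q" using Int_interval by blast
      have pq\<Omega>: "cbox p q \<subseteq> \<Omega>" using pq cd by blast
      have "(LINT x|lebesgue_on (cbox a b). H x) = (LINT x|lebesgue. indicator (cbox a b) x *\<^sub>R H x)"
        by (rule integral_restrict_space) auto
      also have "\<dots> = (LINT x|lebesgue. indicator (cbox p q) x *\<^sub>R (indicator \<Omega> x * h x))"
        using cd by (intro Bochner_Integration.integral_cong) (auto simp: H_def indicator_def pq[symmetric])
      also have "\<dots> = (LINT x|lebesgue. indicator (box p q) x *\<^sub>R (indicator \<Omega> x * h x))"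
      proof (rule integral_cong_AE)
        have "(\<lambda>x. indicator \<Omega> x * h x) \<in> borel_measurable lebesgue" using hl by auto
        then show "(\<lambda>x. indicator (cbox p q) x *\<^sub>R (indicator \<Omega> x * h x)) \<in> borel_measurable lebesgue"
          "(\<lambda>x. indicator (box p q) x *\<^sub>R (indicator \<Omega> x * h x)) \<in> borel_measurable lebesgue"
          by (intro borel_measurable_scaleR borel_measurable_indicator; simp)+
        have "negligible (cbox p q - box p q)" by (rule negligible_frontier_interval)
        then show "AE x in lebesgue. indicator (cbox p q) x *\<^sub>R (indicator \<Omega> x * h x) = indicator (box p q) x *\<^sub>R (indicator \<Omega> x * h x)"
          using box_subset_cbox[of p q] unfolding negligible_iff_null_sets
          by (intro AE_I'[of "cbox p q - box p q"]) (auto simp: indicator_def)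
      qed
      also have "\<dots> = (LINT x|lebesgue. indicator \<Omega> x *\<^sub>R (indicator (box p q) x * h x))"
        by (simp add: mult.left_commute)
      also have "\<dots> = (LINT x|lebesgue_on \<Omega>. indicator (box p q) x * h x)"
        by (rule integral_restrict_space[OF \<Omega>L, symmetric])
      also have "\<dots> = 0" by (rule b0[OF pq\<Omega>])
      finally show ?thesis .
    qed
    from integral_cbox_eq_0_imp_AE_0[OF Hi this] show ?thesis
      by (rule AE_mp) (auto intro!: AE_I2 simp: H_def indicator_def split: if_splits)
  qed
  obtain \<D> where \<D>: "countable \<D>" "\<D> \<subseteq> Pow \<Omega>" "\<And>X. X \<in> \<D> \<Longrightarrow> \<exists>a b. X = cbox a b" "\<Union>\<D> = \<Omega>"
    using open_countable_Union_open_cbox[OF \<Omega>] by metis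
  have "AE x in lebesgue. \<forall>X\<in>\<D>. x \<in> X \<longrightarrow> h x = 0"
  proof (subst AE_ball_countable[OF \<D>(1)], rule ballI)
    fix X assume X: "X \<in> \<D>"
    then obtain a b where ab: "X = cbox a b" using \<D>(3) by blast
    show "AE x in lebesgue. x \<in> X \<longrightarrow> h x = 0"
      unfolding ab by (rule loc) (use \<D>(2) X ab in auto)
  qed
  then have "AE x in lebesgue. x \<in> \<Omega> \<longrightarrow> h x = 0"
    by eventually_elim (use \<D>(4) in auto)
  then show ?thesis by (simp add: AE_restrict_space_iff[OF \<Omega>L])
qed

section \<open>The gradient identity in the limit\<close>

text \<open>The sum over all integer translates, written as a sum over the nonzero terms: there are finitely many
of them at each point when \<open>f\<close> has bounded support.\<close>

definition periodization :: "(real^'m \<Rightarrow> real) \<Rightarrow> real^'m \<Rightarrow> real" where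
  "periodization f y = (\<Sum>k | f (y + int_vec k) \<noteq> 0. f (y + int_vec k))"

lemma periodization_eq_sum:
  assumes "finite K" "\<And>k. f (y + int_vec k) \<noteq> 0 \<Longrightarrow> k \<in> K"
  shows "periodization f y = (\<Sum>k\<in>K. f (y + int_vec k))"
  unfolding periodization_def using assms by (intro sum.mono_neutral_left) auto

lemma periodization_periodic:
  fixes f :: "real^'m \<Rightarrow> real" shows "cell_periodic (periodization f)"
  unfolding cell_periodic_def periodization_def
proof (intro allI)
  fix y :: "real^'m" and l :: "int^'m"
  have e: "y + int_vec l + int_vec k = y + int_vec (l + k)" for k
    by (simp add: int_vec_simps)
  show "(\<Sum>k | f (y + int_vec l + int_vec k) \<noteq> 0. f (y + int_vec l + int_vec k)) = (\<Sum>k | f (y + int_vec k) \<noteq> 0. f (y + int_vec k))"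
    unfolding e by (rule sum.reindex_bij_witness[of _ "\<lambda>k. k - l" "\<lambda>k. l + k"]) auto
qed

lemma shifts_finite:
  fixes S :: "(real^'m) set"
  assumes "bounded S"
  shows "finite {k. \<exists>y\<in>S. y + int_vec k \<in> ball 0 B}"
  by (rule finite_overlapping_shifts[OF bounded_ball assms])

lemma support_shift:
  fixes f :: "real^'m \<Rightarrow> real"
  assumes f: "\<And>y. B \<le> norm y \<Longrightarrow> f y = 0" and y: "y \<in> S" "f (y + int_vec k) \<noteq> 0"
  shows "k \<in> {k. \<exists>y\<in>S. y + int_vec k \<in> ball 0 B}"
proof -
  have "norm (y + int_vec k) < B" using f[of "y + int_vec k"] y(2) by linarith
  then show ?thesis using y(1) by (auto intro!: bexI[of _ y])
qed

text \<open>On each ball the periodization is one fixed finite sum of continuous functions, and periodicity reduces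
the bound to a compact cube.\<close>

lemma periodization_bcontfun:
  fixes f :: "real^'m \<Rightarrow> real"
  assumes c: "continuous_on UNIV f" and f: "\<And>y. B \<le> norm y \<Longrightarrow> f y = 0"
  obtains P :: "(real^'m) \<Rightarrow>\<^sub>C real" where "P \<in> C_sharp" "\<And>y. P y = periodization f y"
proof -
  have cont: "continuous_on UNIV (periodization f)"
  proof (rule continuous_at_imp_continuous_on, rule ballI)
    fix y :: "real^'m"
    define K where "K = {k. \<exists>z\<in>ball y 1. z + int_vec k \<in> ball 0 B}"
    have K: "finite K" unfolding K_def by (rule shifts_finite) simp
    have eq: "(\<Sum>k\<in>K. f (z + int_vec k)) = periodization f z" if "z \<in> ball y 1" for z
      by (rule periodization_eq_sum[OF K, symmetric]) (unfold K_def, rule support_shift[OF f that])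
    have "continuous_on UNIV (\<lambda>z. \<Sum>k\<in>K. f (z + int_vec k))"
      by (intro continuous_on_sum continuous_on_compose2[OF c] continuous_intros) auto
    then have "continuous_on (ball y 1) (\<lambda>z. \<Sum>k\<in>K. f (z + int_vec k))"
      by (rule continuous_on_subset) auto
    then have "continuous_on (ball y 1) (periodization f)"
      by (rule continuous_on_eq[OF _ eq])
    then show "isCont (periodization f) y" by (simp add: continuous_on_eq_continuous_at)
  qed
  have "bounded (periodization f ` cbox 0 1)"
    by (intro compact_imp_bounded compact_continuous_image continuous_on_subset[OF cont]) auto
  then obtain C where C: "\<forall>z\<in>periodization f ` cbox 0 1. norm z \<le> C" unfolding bounded_iff ..
  have b: "norm (periodization f y) \<le> C" for y
  proof -
    have "periodization f y = periodization f (cell_frac y)"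
      by (rule cell_periodic_cell_frac[OF periodization_periodic, symmetric])
    then show ?thesis using C cell_frac_in_cbox[of y] by auto
  qed
  have "periodization f \<in> bcontfun" by (rule bcontfun_normI[OF cont b])
  then have e: "apply_bcontfun (Bcontfun (periodization f)) = periodization f" by (rule Bcontfun_inverse)
  then have "Bcontfun (periodization f) \<in> C_sharp" using periodization_periodic by (simp add: C_sharp_def)
  then show ?thesis by (rule that) (simp add: e)
qed

lemma grad_sum:
  fixes f :: "'i \<Rightarrow> real^'n \<Rightarrow> real"
  assumes "\<And>k. k \<in> K \<Longrightarrow> f k differentiable (at x)"
  shows "grad (\<lambda>x. \<Sum>k\<in>K. f k x) x $ i = (\<Sum>k\<in>K. grad (f k) x $ i)"
proof -
  have d: "(f k has_derivative frechet_derivative (f k) (at x)) (at x)" if "k \<in> K" for k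
    using assms[OF that] by (simp add: frechet_derivative_works)
  have "((\<lambda>x. \<Sum>k\<in>K. f k x) has_derivative (\<lambda>h. \<Sum>k\<in>K. frechet_derivative (f k) (at x) h)) (at x)"
    by (rule has_derivative_sum[OF d])
  from grad_eqI[OF this] show ?thesis by (simp add: grad_eqI[OF d])
qed

text \<open>The test function is the bump times the periodization of \<open>\<psi>\<close> at the phase. As \<open>\<Omega>\<close> is bounded,
finitely many translates of \<open>\<psi>\<close> describe this periodization on \<open>\<Omega>\<close>, so that smoothness is that of
a finite sum; outside \<open>\<Omega>\<close> the bump vanishes.\<close>

lemma oscillating_integration_by_parts:
  fixes R :: "real^'n^'m" and \<psi> :: "real^'m \<Rightarrow> real"
  assumes \<Omega>: "bounded \<Omega>" and ug: "has_weak_grad \<Omega> u g" and \<psi>: "\<psi> \<in> test_functions UNIV"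
    and ab: "cbox a b \<subseteq> \<Omega>"
  shows "(LINT x|lebesgue_on \<Omega>. u x * (box_bump n a b x * ((1 / \<epsilon>) * periodization (\<lambda>y. (transpose R *v grad \<psi> y) $ i) (phase R \<epsilon> x))
        + grad (box_bump n a b) x $ i * periodization \<psi> (phase R \<epsilon> x)))
    = - (LINT x|lebesgue_on \<Omega>. g x $ i * (box_bump n a b x * periodization \<psi> (phase R \<epsilon> x)))"
proof -
  obtain B where B: "\<And>y. B \<le> norm y \<Longrightarrow> \<psi> y = 0" "\<And>y. B \<le> norm y \<Longrightarrow> grad \<psi> y = 0"
    by (rule test_function_support[OF \<psi>]) (rule that)
  have B2: "(transpose R *v grad \<psi> y) $ i = 0" if "B \<le> norm y" for y
    unfolding B(2)[OF that] by simp
  define K where "K = {k. \<exists>y\<in>phase R \<epsilon> ` \<Omega>. y + int_vec k \<in> ball 0 B}"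
  have bl: "bounded_linear (\<lambda>x. phase R \<epsilon> x)"
    by (intro bounded_linear_compose[OF bounded_linear_scaleR_right] matrix_vector_mul_bounded_linear)
  have K: "finite K" unfolding K_def by (rule shifts_finite[OF bounded_linear_image[OF \<Omega> bl]])
  define S where "S x = (\<Sum>k\<in>K. \<psi> (phase R \<epsilon> x + int_vec k))" for x
  have \<psi>C: "C_k k \<psi>" for k using \<psi> by (simp add: test_functions_def)
  have \<psi>d: "\<psi> differentiable (at y)" for y by (rule C_k_imp_continuous_grad(3)[OF \<psi>C])
  have SC: "C_k k S" for k unfolding S_def by (intro C_k_sum C_k_compose_affine \<psi>C)
  have Seq: "S x = periodization \<psi> (phase R \<epsilon> x)" if "x \<in> \<Omega>" for x
    unfolding S_def by (rule periodization_eq_sum[OF K, symmetric])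
      (unfold K_def, rule support_shift[OF B(1) imageI[OF that]])
  have Sgrad: "grad S x $ i = (1 / \<epsilon>) * periodization (\<lambda>y. (transpose R *v grad \<psi> y) $ i) (phase R \<epsilon> x)" if "x \<in> \<Omega>" for x
  proof -
    have "grad S x $ i = (\<Sum>k\<in>K. (1 / \<epsilon>) * (transpose R *v grad \<psi> (phase R \<epsilon> x + int_vec k)) $ i)"
      unfolding S_def by (subst grad_sum) (simp_all only: grad_compose_affine[OF \<psi>d])
    also have "\<dots> = (1 / \<epsilon>) * (\<Sum>k\<in>K. (transpose R *v grad \<psi> (phase R \<epsilon> x + int_vec k)) $ i)"
      by (simp only: sum_distrib_left)
    also have "(\<Sum>k\<in>K. (transpose R *v grad \<psi> (phase R \<epsilon> x + int_vec k)) $ i)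
        = periodization (\<lambda>y. (transpose R *v grad \<psi> y) $ i) (phase R \<epsilon> x)"
      by (rule periodization_eq_sum[OF K, symmetric])
        (unfold K_def, rule support_shift[OF B2 imageI[OF that]])
    finally show ?thesis .
  qed
  let ?\<theta> = "box_bump n a b"
  have t: "(\<lambda>x. ?\<theta> x * S x) \<in> test_functions \<Omega>"
  proof (rule test_functionsI[OF _ _ ab])
    show "C_k k (\<lambda>x. ?\<theta> x * S x)" for k by (intro C_k_mult C_k_box_bump SC)
    show "x \<in> cbox a b" if "?\<theta> x * S x \<noteq> 0" for x
      using that box_bump_eq_0[of x a b n] box_subset_cbox[of a b] by auto
  qed
  have "(LINT x|lebesgue_on \<Omega>. u x * grad (\<lambda>x. ?\<theta> x * S x) x $ i) = - (LINT x|lebesgue_on \<Omega>. g x $ i * (?\<theta> x * S x))"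
    using ug t unfolding has_weak_grad_def by blast
  moreover have "(LINT x|lebesgue_on \<Omega>. u x * grad (\<lambda>x. ?\<theta> x * S x) x $ i) =
    (LINT x|lebesgue_on \<Omega>. u x * (?\<theta> x * ((1 / \<epsilon>) * periodization (\<lambda>y. (transpose R *v grad \<psi> y) $ i) (phase R \<epsilon> x))
        + grad ?\<theta> x $ i * periodization \<psi> (phase R \<epsilon> x)))"
  proof (rule Bochner_Integration.integral_cong[OF refl])
    fix x assume "x \<in> space (lebesgue_on \<Omega>)"
    then have x: "x \<in> \<Omega>" by simp
    have "grad (\<lambda>x. ?\<theta> x * S x) x $ i = ?\<theta> x * grad S x $ i + grad ?\<theta> x $ i * S x"
      by (rule grad_mult[OF C_k_imp_continuous_grad(3)[OF C_k_box_bump] C_k_imp_continuous_grad(3)[OF SC]])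
    then show "u x * grad (\<lambda>x. ?\<theta> x * S x) x $ i = u x * (?\<theta> x * ((1 / \<epsilon>) * periodization (\<lambda>y. (transpose R *v grad \<psi> y) $ i) (phase R \<epsilon> x))
        + grad ?\<theta> x $ i * periodization \<psi> (phase R \<epsilon> x))"
      by (simp only: Sgrad[OF x] Seq[OF x])
  qed
  moreover have "(LINT x|lebesgue_on \<Omega>. g x $ i * (?\<theta> x * S x))
      = (LINT x|lebesgue_on \<Omega>. g x $ i * (?\<theta> x * periodization \<psi> (phase R \<epsilon> x)))"
    by (rule Bochner_Integration.integral_cong[OF refl]) (simp add: Seq)
  ultimately show ?thesis by simp
qed

lemma L2_C_sharp_product:
  fixes c :: "real^'n \<Rightarrow> real" and F :: "(real^'m) \<Rightarrow>\<^sub>C real"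
  assumes \<Omega>: "open \<Omega>" "bounded \<Omega>" and c: "continuous_on UNIV c" and F: "F \<in> C_sharp"
  shows "(\<lambda>x. c x *\<^sub>R F) \<in> L2_C_sharp \<Omega>"
proof -
  have "compact (c ` closure \<Omega>)"
    using \<Omega>(2) by (intro compact_continuous_image continuous_on_subset[OF c]) (auto simp: compact_closure)
  then obtain B where B: "\<forall>z\<in>c ` closure \<Omega>. norm z \<le> B" using compact_imp_bounded bounded_iff by metis
  have cm: "c \<in> borel_measurable (lebesgue_on \<Omega>)"
    by (intro measurable_restrict_space1 measurable_completion) (use c in \<open>simp add: borel_measurable_continuous_onI\<close>)
  have "(\<lambda>r::real. r *\<^sub>R F) \<in> borel_measurable borel"
    by (intro borel_measurable_continuous_onI continuous_intros)
  from measurable_compose[OF cm this] have m: "(\<lambda>x. c x *\<^sub>R F) \<in> borel_measurable (lebesgue_on \<Omega>)" .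
  have "integrable (lebesgue_on \<Omega>) (\<lambda>x. (\<bar>c x\<bar> * norm F)\<^sup>2)"
  proof (rule finite_measure.integrable_const_bound[OF finite_lebesgue_on[OF \<Omega>], of _ "(B * norm F)\<^sup>2"])
    show "AE x in lebesgue_on \<Omega>. norm ((\<bar>c x\<bar> * norm F)\<^sup>2) \<le> (B * norm F)\<^sup>2"
    proof (rule AE_I2)
      fix x assume "x \<in> space (lebesgue_on \<Omega>)"
      then have "\<bar>c x\<bar> \<le> B" using B closure_subset[of \<Omega>] by auto
      then show "norm ((\<bar>c x\<bar> * norm F)\<^sup>2) \<le> (B * norm F)\<^sup>2"
        by (simp add: power_mono mult_right_mono)
    qed
    show "(\<lambda>x. (\<bar>c x\<bar> * norm F)\<^sup>2) \<in> borel_measurable (lebesgue_on \<Omega>)" using cm by measurable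
  qed
  then show ?thesis using m F by (simp add: L2_C_sharp_def L2_def C_sharp_scaleR)
qed

lemma borel_lebesgue_on: "f \<in> borel_measurable borel \<Longrightarrow> f \<in> borel_measurable (lebesgue_on S)"
  by (intro measurable_restrict_space1 measurable_completion) simp

text \<open>Multiply the previous formula by \<open>\<eta> n\<close> and pass to the limit. The term with the gradient of the bump
carries a factor \<open>\<eta> n\<close> and disappears. The fundamental lemma then removes the bump.\<close>

lemma two_scale_gradient_identity:
  fixes R :: "real^'n^'m" and \<psi> :: "real^'m \<Rightarrow> real" and P Q :: "(real^'m) \<Rightarrow>\<^sub>C real"
  assumes \<Omega>: "open \<Omega>" "bounded \<Omega>" and \<eta>: "\<And>n. \<eta> n > 0" "\<eta> \<longlonglongrightarrow> 0"
    and ug: "\<And>n. has_weak_grad \<Omega> (u n) (gu n)" and uL: "\<And>n. u n \<in> L2 (lebesgue_on \<Omega>)"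
    and gL: "\<And>n. (\<lambda>x. \<eta> n * gu n x $ i) \<in> L2 (lebesgue_on \<Omega>)"
    and w: "w \<in> L2 (two_scale_measure \<Omega>)" and wi: "wi \<in> L2 (two_scale_measure \<Omega>)"
    and cw: "\<And>\<phi>. \<phi> \<in> L2_C_sharp \<Omega> \<Longrightarrow> (\<lambda>n. LINT x|lebesgue_on \<Omega>. u n x * apply_bcontfun (\<phi> x) (phase R (\<eta> n) x))
      \<longlonglongrightarrow> (LINT p|two_scale_measure \<Omega>. w p * apply_bcontfun (\<phi> (fst p)) (snd p))"
    and cwi: "\<And>\<phi>. \<phi> \<in> L2_C_sharp \<Omega> \<Longrightarrow> (\<lambda>n. LINT x|lebesgue_on \<Omega>. (\<eta> n * gu n x $ i) * apply_bcontfun (\<phi> x) (phase R (\<eta> n) x))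
      \<longlonglongrightarrow> (LINT p|two_scale_measure \<Omega>. wi p * apply_bcontfun (\<phi> (fst p)) (snd p))"
    and \<psi>: "\<psi> \<in> test_functions UNIV"
    and P: "P \<in> C_sharp" "\<And>y. P y = periodization \<psi> y"
    and Q: "Q \<in> C_sharp" "\<And>y. Q y = periodization (\<lambda>y. (transpose R *v grad \<psi> y) $ i) y"
  shows "AE x in lebesgue_on \<Omega>. (LINT y|cell_measure. wi (x, y) * P y + w (x, y) * Q y) = 0"
proof -
  interpret O: finite_measure "lebesgue_on \<Omega>" by (rule finite_lebesgue_on[OF \<Omega>])
  interpret Y: finite_measure "cell_measure :: (real^'m) measure" by (rule finite_cell_measure)
  interpret pair_sigma_finite "lebesgue_on \<Omega>" "cell_measure :: (real^'m) measure" ..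
  let ?M = "two_scale_measure \<Omega> :: ((real^'n) \<times> (real^'m)) measure"
  have cb: "continuous_on UNIV (box_bump n a b :: real^'n \<Rightarrow> real)" "continuous_on UNIV (\<lambda>x :: real^'n. grad (box_bump n a b) x $ i)" for n a b
    using C_k_imp_continuous_grad(1,2)[OF C_k_box_bump] by auto
  have L2\<phi>: "(\<lambda>x. apply_bcontfun (\<phi> x) (phase R \<epsilon> x)) \<in> L2 (lebesgue_on \<Omega>)" if "\<phi> \<in> L2_C_sharp \<Omega>" for \<phi> \<epsilon>
    by (rule C_sharp_eval_L2(1)[OF _ _ phase_measurable]) (use that in \<open>auto simp: L2_C_sharp_def\<close>)
  have fm: "(\<lambda>p. apply_bcontfun F (snd p)) \<in> borel_measurable ?M" for F :: "(real^'m) \<Rightarrow>\<^sub>C real"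
    by (rule measurable_compose[OF measurable_snd borel_cell[OF C_sharp_borel]])
  have zero: "(LINT p|?M. wi p * (box_bump k a b (fst p) * P (snd p))) + (LINT p|?M. w p * (box_bump k a b (fst p) * Q (snd p))) = 0"
    if ab: "cbox a b \<subseteq> \<Omega>" for k a b
  proof -
    let ?\<theta> = "box_bump k a b :: real^'n \<Rightarrow> real" and ?\<theta>' = "\<lambda>x. grad (box_bump k a b) x $ i"
    let ?IP = "\<lambda>n. LINT x|lebesgue_on \<Omega>. (\<eta> n * gu n x $ i) * (?\<theta> x * P (phase R (\<eta> n) x))"
    let ?IQ = "\<lambda>n. LINT x|lebesgue_on \<Omega>. u n x * (?\<theta> x * Q (phase R (\<eta> n) x))"
    let ?I' = "\<lambda>n. LINT x|lebesgue_on \<Omega>. u n x * (?\<theta>' x * P (phase R (\<eta> n) x))"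
    note t1 = L2_C_sharp_product[OF \<Omega> cb(1) P(1), of k a b] and t2 = L2_C_sharp_product[OF \<Omega> cb(1) Q(1), of k a b]
      and t3 = L2_C_sharp_product[OF \<Omega> cb(2) P(1), of k a b]
    have ibp: "?IP n = - (\<eta> n * ?I' n + ?IQ n)" for n
    proof -
      have iQ: "integrable (lebesgue_on \<Omega>) (\<lambda>x. u n x * (?\<theta> x * Q (phase R (\<eta> n) x)))"
        using L2_mult_integrable[OF uL L2\<phi>[OF t2]] by (simp add: apply_bcontfun_scaleR)
      have i': "integrable (lebesgue_on \<Omega>) (\<lambda>x. u n x * (?\<theta>' x * P (phase R (\<eta> n) x)))"
        using L2_mult_integrable[OF uL L2\<phi>[OF t3]] by (simp add: apply_bcontfun_scaleR)
      have "?IP n = \<eta> n * (LINT x|lebesgue_on \<Omega>. gu n x $ i * (?\<theta> x * P (phase R (\<eta> n) x)))"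
        by (simp add: mult.assoc)
      also have "\<dots> = - (\<eta> n * (LINT x|lebesgue_on \<Omega>. u n x * (?\<theta> x * ((1 / \<eta> n) * Q (phase R (\<eta> n) x)) + ?\<theta>' x * P (phase R (\<eta> n) x))))"
        using oscillating_integration_by_parts[OF \<Omega>(2) ug \<psi> ab, of n k "\<eta> n" R i] unfolding P(2) Q(2) by simp
      also have "\<dots> = - (LINT x|lebesgue_on \<Omega>. \<eta> n * (u n x * (?\<theta> x * ((1 / \<eta> n) * Q (phase R (\<eta> n) x)) + ?\<theta>' x * P (phase R (\<eta> n) x))))"
        by simp
      also have "(LINT x|lebesgue_on \<Omega>. \<eta> n * (u n x * (?\<theta> x * ((1 / \<eta> n) * Q (phase R (\<eta> n) x)) + ?\<theta>' x * P (phase R (\<eta> n) x))))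
          = (LINT x|lebesgue_on \<Omega>. \<eta> n * (u n x * (?\<theta>' x * P (phase R (\<eta> n) x))) + u n x * (?\<theta> x * Q (phase R (\<eta> n) x)))"
        using \<eta>(1)[of n] by (intro Bochner_Integration.integral_cong) (auto simp: field_simps)
      also have "\<dots> = \<eta> n * ?I' n + ?IQ n" using iQ i' by simp
      finally show ?thesis .
    qed
    have lP: "?IP \<longlonglongrightarrow> (LINT p|?M. wi p * (?\<theta> (fst p) * P (snd p)))"
      using cwi[OF t1] by (simp add: apply_bcontfun_scaleR)
    have lQ: "?IQ \<longlonglongrightarrow> (LINT p|?M. w p * (?\<theta> (fst p) * Q (snd p)))"
      using cw[OF t2] by (simp add: apply_bcontfun_scaleR)
    have "?I' \<longlonglongrightarrow> (LINT p|?M. w p * (?\<theta>' (fst p) * P (snd p)))"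
      using cw[OF t3] by (simp add: apply_bcontfun_scaleR)
    from tendsto_minus[OF tendsto_add[OF tendsto_mult[OF \<eta>(2) this] lQ]]
    have "?IP \<longlonglongrightarrow> - (0 * (LINT p|?M. w p * (?\<theta>' (fst p) * P (snd p))) + (LINT p|?M. w p * (?\<theta> (fst p) * Q (snd p))))"
      unfolding ibp .
    from LIMSEQ_unique[OF lP this] show ?thesis by simp
  qed
  have finM: "finite_measure ?M" by (rule finite_measure_pair_measure[OF finite_cell_measure O.finite_measure_axioms])
  have FL: "(\<lambda>p. wi p * P (snd p)) \<in> L2 ?M" "(\<lambda>p. w p * Q (snd p)) \<in> L2 ?M"
    by (rule L2_bounded_multiplier(1)[OF _ fm bcont_abs_le], fact)+
  have FL: "(\<lambda>p. wi p * P (snd p) + w p * Q (snd p)) \<in> L2 ?M" by (rule L2_add[OF FL])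
  have Fi: "integrable ?M (\<lambda>p. wi p * P (snd p) + w p * Q (snd p))"
    by (rule integral_abs_le_L2(1)[OF finM FL])
  define h where "h x = (LINT y|cell_measure. wi (x, y) * P y + w (x, y) * Q y)" for x
  have hi: "integrable (lebesgue_on \<Omega>) h"
    unfolding h_def using integrable_fst'[OF Fi] by simp
  have "AE x in lebesgue_on \<Omega>. h x = 0"
  proof (rule fundamental_lemma_box_bump[OF \<Omega>(1) hi])
    fix k and a b :: "real^'n" assume ab: "cbox a b \<subseteq> \<Omega>"
    have bm: "(\<lambda>p. box_bump k a b (fst p)) \<in> borel_measurable ?M"
      by (rule measurable_compose[OF measurable_fst borel_lebesgue_on[OF borel_measurable_continuous_onI[OF cb(1)]]])
    have bb: "\<bar>box_bump k a b x\<bar> \<le> 1" for x using box_bump_bounds[of k a b x] by simp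
    have m1: "integrable ?M (\<lambda>p. f p * P (snd p) * box_bump k a b (fst p))" if "f \<in> L2 ?M"
      for f and P :: "(real^'m) \<Rightarrow>\<^sub>C real"
      by (intro integral_abs_le_L2(1)[OF finM] L2_bounded_multiplier(1)[OF _ bm bb]
          L2_bounded_multiplier(1)[OF that fm bcont_abs_le])
    have Fb: "integrable ?M (\<lambda>p. (wi p * P (snd p) + w p * Q (snd p)) * box_bump k a b (fst p))"
      by (intro integral_abs_le_L2(1)[OF finM] L2_bounded_multiplier(1)[OF FL bm bb])
    have "(LINT x|lebesgue_on \<Omega>. box_bump k a b x * h x)
        = (LINT x|lebesgue_on \<Omega>. (LINT y|cell_measure. (wi (x, y) * P y + w (x, y) * Q y) * box_bump k a b x))"
      unfolding h_def by (simp add: mult.commute)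
    also have "\<dots> = (LINT p|?M. (wi p * P (snd p) + w p * Q (snd p)) * box_bump k a b (fst p))"
      using integral_fst'[OF Fb] by simp
    also have "\<dots> = (LINT p|?M. wi p * P (snd p) * box_bump k a b (fst p) + w p * Q (snd p) * box_bump k a b (fst p))"
      by (simp only: distrib_right)
    also have "\<dots> = (LINT p|?M. wi p * P (snd p) * box_bump k a b (fst p)) + (LINT p|?M. w p * Q (snd p) * box_bump k a b (fst p))"
      by (rule Bochner_Integration.integral_add[OF m1[OF wi] m1[OF w]])
    also have "\<dots> = (LINT p|?M. wi p * (box_bump k a b (fst p) * P (snd p))) + (LINT p|?M. w p * (box_bump k a b (fst p) * Q (snd p)))"
      by (simp add: mult.assoc mult.commute[of "box_bump k a b _"])
    also have "\<dots> = 0" by (rule zero[OF ab])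
    finally show "(LINT x|lebesgue_on \<Omega>. box_bump k a b x * h x) = 0" .
  qed
  then show ?thesis by (simp add: h_def)
qed

lemma integrable_mult_bcontfun:
  fixes F :: "(real^'m) \<Rightarrow>\<^sub>C real"
  assumes f: "integrable cell_measure f"
  shows "integrable cell_measure (\<lambda>y. f y * F y)"
proof (rule Bochner_Integration.integrable_bound[of _ "\<lambda>y. f y * norm F"])
  show "(\<lambda>y. f y * F y) \<in> borel_measurable cell_measure"
    using f borel_cell[OF C_sharp_borel, of F] by (intro borel_measurable_times) auto
  show "AE y in cell_measure. norm (f y * F y) \<le> norm (f y * norm F)"
    by (rule AE_I2) (simp add: abs_mult mult_left_mono bcont_abs_le)
qed (use f in simp)

lemma integral_mult_bcontfun_tendsto:
  fixes P :: "nat \<Rightarrow> (real^'m) \<Rightarrow>\<^sub>C real"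
  assumes f: "integrable cell_measure f" and P: "P \<longlonglongrightarrow> P0"
  shows "(\<lambda>n. LINT y|cell_measure. f y * P n y) \<longlonglongrightarrow> (LINT y|cell_measure. f y * P0 y)"
proof (rule LIM_zero_cancel)
  note i = integrable_mult_bcontfun[OF f]
  have "(\<lambda>n. norm (P n - P0) * (LINT y|cell_measure. \<bar>f y\<bar>)) \<longlonglongrightarrow> 0 * (LINT y|cell_measure. \<bar>f y\<bar>)"
    using P by (intro tendsto_mult tendsto_const) (simp add: LIM_zero_iff tendsto_norm_zero_iff)
  then have l: "(\<lambda>n. norm (P n - P0) * (LINT y|cell_measure. \<bar>f y\<bar>)) \<longlonglongrightarrow> 0" by simp
  have "\<bar>(LINT y|cell_measure. f y * P n y) - (LINT y|cell_measure. f y * P0 y)\<bar>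
      \<le> norm (P n - P0) * (LINT y|cell_measure. \<bar>f y\<bar>)" for n
  proof -
    have "(LINT y|cell_measure. f y * P n y) - (LINT y|cell_measure. f y * P0 y) = (LINT y|cell_measure. f y * (P n - P0) y)"
      using i by (simp add: apply_bcontfun_diff right_diff_distrib)
    also have "\<bar>\<dots>\<bar> \<le> (LINT y|cell_measure. \<bar>f y * (P n - P0) y\<bar>)" by (rule integral_abs_bound)
    also have "\<dots> \<le> (LINT y|cell_measure. norm (P n - P0) * \<bar>f y\<bar>)"
    proof (rule integral_mono)
      show "integrable cell_measure (\<lambda>y. \<bar>f y * (P n - P0) y\<bar>)" using i by (rule integrable_abs)
      show "integrable cell_measure (\<lambda>y. norm (P n - P0) * \<bar>f y\<bar>)" using f by simp
      show "\<bar>f y * (P n - P0) y\<bar> \<le> norm (P n - P0) * \<bar>f y\<bar>" for y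
        unfolding abs_mult mult.commute[of "norm (P n - P0)"] by (intro mult_left_mono bcont_abs_le) simp
    qed
    finally show ?thesis by simp
  qed
  then show "(\<lambda>n. (LINT y|cell_measure. f y * P n y) - (LINT y|cell_measure. f y * P0 y)) \<longlonglongrightarrow> 0"
    by - (rule Lim_null_comparison[OF always_eventually l], simp)
qed

text \<open>The exceptional null set can be chosen independently of the pair: separability provides a countable dense
subset of \<open>E\<close>, and for almost every \<open>x\<close> the integrals depend continuously on the pair.\<close>

lemma AE_all_C_sharp_pairs:
  fixes E :: "(((real^'m) \<Rightarrow>\<^sub>C real) \<times> ((real^'m) \<Rightarrow>\<^sub>C real)) set" and \<Omega> :: "(real^'n) set"
  assumes \<Omega>: "open \<Omega>" "bounded \<Omega>" and f: "f \<in> L2 (two_scale_measure \<Omega>)" and g: "g \<in> L2 (two_scale_measure \<Omega>)"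
    and E: "E \<subseteq> C_sharp \<times> C_sharp"
    and ae: "\<And>P Q. (P, Q) \<in> E \<Longrightarrow> AE x in lebesgue_on \<Omega>. (LINT y|cell_measure. f (x, y) * P y + g (x, y) * Q y) = 0"
  shows "AE x in lebesgue_on \<Omega>. \<forall>(P, Q)\<in>E. (LINT y|cell_measure. f (x, y) * apply_bcontfun P y) + (LINT y|cell_measure. g (x, y) * apply_bcontfun Q y) = 0"
proof -
  interpret O: finite_measure "lebesgue_on \<Omega>" by (rule finite_lebesgue_on[OF \<Omega>])
  interpret Y: finite_measure "cell_measure :: (real^'m) measure" by (rule finite_cell_measure)
  interpret pair_sigma_finite "lebesgue_on \<Omega>" "cell_measure :: (real^'m) measure" ..
  have finM: "finite_measure (two_scale_measure \<Omega> :: ((real^'n) \<times> (real^'m)) measure)"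
    by (rule finite_measure_pair_measure[OF finite_cell_measure O.finite_measure_axioms])
  obtain D where D: "countable D" "D \<subseteq> C_sharp" "C_sharp \<subseteq> closure (D :: ((real^'m) \<Rightarrow>\<^sub>C real) set)"
    by (rule C_sharp_separable)
  have DD: "countable (D \<times> D)" using D(1) by simp
  have "C_sharp \<times> C_sharp \<subseteq> closure (D \<times> D)" unfolding closure_Times by (rule Sigma_mono[OF D(3) D(3)])
  with E have ED: "E \<subseteq> closure (D \<times> D)" by (rule subset_trans)
  obtain D' where D': "countable D'" "D' \<subseteq> E" "E \<subseteq> closure D'"
    by (rule countable_dense_subset[OF DD ED])
  have "\<forall>z\<in>D'. AE x in lebesgue_on \<Omega>. (LINT y|cell_measure. f (x, y) * apply_bcontfun (fst z) y + g (x, y) * apply_bcontfun (snd z) y) = 0"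
  proof
    fix z assume "z \<in> D'"
    then have "(fst z, snd z) \<in> E" using D'(2) by auto
    then show "AE x in lebesgue_on \<Omega>. (LINT y|cell_measure. f (x, y) * apply_bcontfun (fst z) y + g (x, y) * apply_bcontfun (snd z) y) = 0" by (rule ae)
  qed
  then have a1: "AE x in lebesgue_on \<Omega>. \<forall>z\<in>D'. (LINT y|cell_measure. f (x, y) * apply_bcontfun (fst z) y + g (x, y) * apply_bcontfun (snd z) y) = 0"
    by (subst AE_ball_countable[OF D'(1)])
  have a2: "AE x in lebesgue_on \<Omega>. integrable cell_measure (\<lambda>y. f (x, y))"
    by (rule AE_integrable_fst'[OF integral_abs_le_L2(1)[OF finM f]])
  have a3: "AE x in lebesgue_on \<Omega>. integrable cell_measure (\<lambda>y. g (x, y))"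
    by (rule AE_integrable_fst'[OF integral_abs_le_L2(1)[OF finM g]])
  from a1 a2 a3 show ?thesis
  proof eventually_elim
    fix x
    assume z: "\<forall>z\<in>D'. (LINT y|cell_measure. f (x, y) * apply_bcontfun (fst z) y + g (x, y) * apply_bcontfun (snd z) y) = 0"
      and fi: "integrable cell_measure (\<lambda>y. f (x, y))" and gi: "integrable cell_measure (\<lambda>y. g (x, y))"
    show "\<forall>(P, Q)\<in>E. (LINT y|cell_measure. f (x, y) * apply_bcontfun P y) + (LINT y|cell_measure. g (x, y) * apply_bcontfun Q y) = 0"
    proof clarify
      fix P Q assume "(P, Q) \<in> E"
      then have "(P, Q) \<in> closure D'" using D'(3) by blast
      then obtain s where s: "\<And>n. s n \<in> D'" "s \<longlonglongrightarrow> (P, Q)" unfolding closure_sequential by blast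
      have l: "(\<lambda>n. fst (s n)) \<longlonglongrightarrow> P" "(\<lambda>n. snd (s n)) \<longlonglongrightarrow> Q"
        using tendsto_fst[OF s(2)] tendsto_snd[OF s(2)] by simp_all
      have "(\<lambda>n. (LINT y|cell_measure. f (x, y) * apply_bcontfun (fst (s n)) y) + (LINT y|cell_measure. g (x, y) * apply_bcontfun (snd (s n)) y))
          \<longlonglongrightarrow> (LINT y|cell_measure. f (x, y) * P y) + (LINT y|cell_measure. g (x, y) * Q y)"
        by (intro tendsto_add integral_mult_bcontfun_tendsto fi gi l)
      moreover have "(LINT y|cell_measure. f (x, y) * apply_bcontfun (fst (s n)) y) + (LINT y|cell_measure. g (x, y) * apply_bcontfun (snd (s n)) y) = 0" for n
        using z s(1)[of n] Bochner_Integration.integral_add[OF integrable_mult_bcontfun[OF fi] integrable_mult_bcontfun[OF gi], of "fst (s n)" "snd (s n)"] by simp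
      ultimately have "(\<lambda>n. 0) \<longlonglongrightarrow> (LINT y|cell_measure. f (x, y) * P y) + (LINT y|cell_measure. g (x, y) * Q y)" by simp
      then show "(LINT y|cell_measure. f (x, y) * P y) + (LINT y|cell_measure. g (x, y) * Q y) = 0"
        by (rule LIMSEQ_unique[OF _ tendsto_const])
    qed
  qed
qed

section \<open>Periodic extension and gradients along R\<close>

text \<open>The fractional part of \<open>y\<close> may lie on the lower boundary of the open unit cell; the indicator function
assigns the value \<open>0\<close> there.\<close>

definition periodic_extension :: "(real^'m \<Rightarrow> real) \<Rightarrow> real^'m \<Rightarrow> real" where
  "periodic_extension f y = indicator unit_cell (cell_frac y) * f (cell_frac y)"

lemma periodic_extension_periodic: "cell_periodic (periodic_extension f)"
  by (simp add: cell_periodic_def periodic_extension_def cell_frac_periodic)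

lemma periodic_extension_cell: "y \<in> unit_cell \<Longrightarrow> periodic_extension f y = f y"
proof -
  assume y: "y \<in> unit_cell"
  then have "cell_frac y = y" by (intro cell_frac_id) (auto simp: unit_cell_def less_imp_le)
  with y show ?thesis by (simp add: periodic_extension_def)
qed

lemma cell_frac_measurable [measurable]: "(cell_frac :: real^'m \<Rightarrow> real^'m) \<in> borel_measurable borel"
proof -
  have "(\<lambda>y :: real^'m. cell_frac y \<bullet> b) \<in> borel_measurable borel" if bB: "b \<in> Basis" for b
  proof -
    obtain i where b: "b = axis i 1" using bB by (auto simp: Basis_vec_def)
    have "(\<lambda>y :: real^'m. y $ i - of_int \<lfloor>y $ i\<rfloor>) \<in> borel_measurable borel" by measurable
    then show ?thesis by (simp add: b inner_axis cell_frac_nth frac_def)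
  qed
  then show ?thesis by (simp add: borel_measurable_euclidean_space[of cell_frac])
qed

lemma periodic_extension_measurable:
  assumes "f \<in> borel_measurable cell_measure"
  shows "periodic_extension f \<in> borel_measurable borel"
proof -
  have "(\<lambda>z. indicator unit_cell z *\<^sub>R f z) \<in> borel_measurable lborel"
    by (rule borel_measurable_restrict_space_iff[THEN iffD1, OF _ assms]) auto
  then have "(\<lambda>z. indicator unit_cell z * f z) \<in> borel_measurable borel" by simp
  from measurable_compose[OF cell_frac_measurable this] show ?thesis
    unfolding periodic_extension_def .
qed

lemma cell_integral_extension: "(LINT y|cell_measure. periodic_extension f y * g y) = (LINT y|cell_measure. f y * g y)"
  by (rule Bochner_Integration.integral_cong) (auto simp: periodic_extension_cell)

lemma periodic_extension_integrable: "integrable cell_measure f \<Longrightarrow> integrable cell_measure (periodic_extension f)"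
  by (subst Bochner_Integration.integrable_cong[OF refl, of _ _ f]) (auto simp: periodic_extension_cell)

lemma integrable_lborel_imp_lebesgue_on:
  fixes f :: "'a::euclidean_space \<Rightarrow> real"
  assumes S: "S \<in> sets borel" and f: "f \<in> borel_measurable borel" and i: "integrable lborel (\<lambda>y. f y * indicator S y)"
  shows "integrable (lebesgue_on S) f"
proof -
  have m: "(\<lambda>y. f y * indicator S y) \<in> borel_measurable lborel" using f S by measurable
  have "integrable lebesgue (\<lambda>y. f y * indicator S y)"
    using i integrable_completion[OF m] by simp
  then have "integrable lebesgue (\<lambda>y. indicator S y *\<^sub>R f y)" by (simp add: mult.commute)
  moreover have "S \<inter> space lebesgue \<in> sets lebesgue" using S by simp
  ultimately show ?thesis by (simp add: integrable_restrict_space)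
qed

lemma periodic_locally_integrable:
  fixes u :: "real^'m \<Rightarrow> real"
  assumes u: "cell_periodic u" "u \<in> borel_measurable borel" "integrable cell_measure u" and K: "compact K"
  shows "integrable (lebesgue_on K) u"
proof -
  have Kb: "K \<in> sets borel" using K by (rule borel_compact)
  have b: "\<bar>indicator K y :: real\<bar> \<le> 1" for y by (simp add: indicator_def)
  have fin: "finite {k. \<exists>y\<in>unit_cell. y + int_vec k \<in> K}"
    by (rule finite_overlapping_shifts[OF compact_imp_bounded[OF K] bounded_unit_cell])
  have "integrable lborel (\<lambda>y. u y * indicator K y)"
    by (rule integral_unfold(1)[OF u(1,2) _ u(3) b fin]) (use Kb in \<open>auto simp: indicator_def split: if_splits\<close>)
  then show ?thesis by (rule integrable_lborel_imp_lebesgue_on[OF Kb u(2)])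
qed

lemma integral_unfold_periodization:
  fixes u f :: "real^'m \<Rightarrow> real" and P :: "(real^'m) \<Rightarrow>\<^sub>C real"
  assumes u: "cell_periodic u" "u \<in> borel_measurable borel" "integrable cell_measure u"
    and f: "continuous_on UNIV f" "\<And>y. B \<le> norm y \<Longrightarrow> f y = 0" and P: "\<And>y. P y = periodization f y"
  shows "(LINT y|lebesgue. u y * f y) = (LINT y|cell_measure. u y * P y)"
proof -
  have fm: "f \<in> borel_measurable borel" by (rule borel_measurable_continuous_onI[OF f(1)])
  have "bounded (f ` cball 0 B)"
    by (intro compact_imp_bounded compact_continuous_image continuous_on_subset[OF f(1)]) auto
  then obtain C where C: "\<forall>z\<in>f ` cball 0 B. norm z \<le> C" unfolding bounded_iff ..
  have fB: "\<bar>f y\<bar> \<le> max C 0" for y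
  proof (cases "norm y \<le> B")
    case True
    then have "\<bar>f y\<bar> \<le> C" using C by auto
    then show ?thesis by simp
  next
    case False
    then show ?thesis using f(2)[of y] by simp
  qed
  define K where "K = {k. \<exists>y\<in>(unit_cell :: (real^'m) set). y + int_vec k \<in> ball 0 B}"
  have K: "finite K" unfolding K_def by (rule shifts_finite[OF bounded_unit_cell])
  have KK: "k \<in> K" if "y \<in> unit_cell" "f (y + int_vec k) \<noteq> 0" for y k
    unfolding K_def by (rule support_shift[of B f, OF f(2) that])
  have "(LINT y|lebesgue. u y * f y) = (LINT y|lborel. u y * f y)"
    by (rule integral_completion) (use u(2) fm in measurable)
  also have "\<dots> = (LINT y|cell_measure. u y * (\<Sum>k\<in>K. f (y + int_vec k)))"
    by (rule integral_unfold(2)[OF u(1,2) fm u(3) fB K KK])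
  also have "\<dots> = (LINT y|cell_measure. u y * P y)"
  proof (rule Bochner_Integration.integral_cong[OF refl])
    fix y :: "real^'m" assume "y \<in> space cell_measure"
    then have y: "y \<in> unit_cell" by simp
    have "periodization f y = (\<Sum>k\<in>K. f (y + int_vec k))"
      by (rule periodization_eq_sum[OF K KK[OF y]])
    then show "u y * (\<Sum>k\<in>K. f (y + int_vec k)) = u y * P y" by (simp add: P)
  qed
  finally show ?thesis .
qed

lemma test_function_periodizations:
  fixes R :: "real^'n^'m"
  assumes \<psi>: "\<psi> \<in> test_functions UNIV"
  obtains P Q :: "(real^'m) \<Rightarrow>\<^sub>C real" where "P \<in> C_sharp" "\<And>y. P y = periodization \<psi> y"
    "Q \<in> C_sharp" "\<And>y. Q y = periodization (\<lambda>y. (transpose R *v grad \<psi> y) $ i) y"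
proof -
  obtain B where B: "\<And>y. B \<le> norm y \<Longrightarrow> \<psi> y = 0" "\<And>y. B \<le> norm y \<Longrightarrow> grad \<psi> y = 0"
    by (rule test_function_support[OF \<psi>]) (rule that)
  have \<psi>C: "C_k k \<psi>" for k using \<psi> by (simp add: test_functions_def)
  have c: "continuous_on UNIV (\<lambda>y. (transpose R *v grad \<psi> y) $ i)"
    unfolding transpose_mult_nth
    by (intro continuous_intros C_k_imp_continuous_grad(2)[OF \<psi>C])
  have z: "(transpose R *v grad \<psi> y) $ i = 0" if "B \<le> norm y" for y
    unfolding B(2)[OF that] by simp
  obtain P :: "(real^'m) \<Rightarrow>\<^sub>C real" where P: "P \<in> C_sharp" "\<And>y. P y = periodization \<psi> y"
    by (rule periodization_bcontfun[of \<psi> B, OF C_k_imp_continuous_grad(1)[OF \<psi>C] B(1)]) (assumption, rule that)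
  obtain Q :: "(real^'m) \<Rightarrow>\<^sub>C real" where Q: "Q \<in> C_sharp" "\<And>y. Q y = periodization (\<lambda>y. (transpose R *v grad \<psi> y) $ i) y"
    by (rule periodization_bcontfun[of _ B, OF c z]) (assumption, rule that)
  show ?thesis by (rule that[OF P Q])
qed

text \<open>For periodic functions the distributional gradient may be tested on the cell against periodizations.\<close>

lemma has_grad_R_periodicI:
  fixes R :: "real^'n^'m" and g :: "'n \<Rightarrow> real^'m \<Rightarrow> real"
  assumes u: "cell_periodic u" "u \<in> borel_measurable borel" "integrable cell_measure u"
    and g: "\<And>i. cell_periodic (g i)" "\<And>i. g i \<in> borel_measurable borel" "\<And>i. integrable cell_measure (g i)"
    and id: "\<And>\<psi> i P Q. \<lbrakk>\<psi> \<in> test_functions UNIV; P \<in> C_sharp; \<And>y. P y = periodization \<psi> y; Q \<in> C_sharp;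
      \<And>y. Q y = periodization (\<lambda>y. (transpose R *v grad \<psi> y) $ i) y\<rbrakk>
      \<Longrightarrow> (LINT y|cell_measure. g i y * apply_bcontfun P y) + (LINT y|cell_measure. u y * apply_bcontfun Q y) = 0"
  shows "has_grad_R R u (\<lambda>y. \<chi> i. g i y)"
  unfolding has_grad_R_def
proof (intro conjI ballI allI)
  show "locally_integrable UNIV u"
    unfolding locally_integrable_def using periodic_locally_integrable[OF u] by blast
  have e: "(\<lambda>y. \<chi> i. g i y) = (\<lambda>y. \<Sum>i\<in>UNIV. g i y *\<^sub>R axis i 1)"
    by (rule ext) (simp add: vec_eq_iff axis_def if_distrib cong: if_cong)
  show "locally_integrable UNIV (\<lambda>y. \<chi> i. g i y)"
    unfolding locally_integrable_def
  proof (intro allI impI)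
    fix K :: "(real^'m) set" assume "compact K \<and> K \<subseteq> UNIV"
    then have K: "compact K" by simp
    show "integrable (lebesgue_on K) (\<lambda>y. \<chi> i. g i y)"
      unfolding e
      by (intro Bochner_Integration.integrable_sum integrable_scaleR_left periodic_locally_integrable[OF g(1-3) K])
  qed
  fix \<psi> :: "real^'m \<Rightarrow> real" and i assume \<psi>: "\<psi> \<in> test_functions UNIV"
  obtain P Q :: "(real^'m) \<Rightarrow>\<^sub>C real" where P: "P \<in> C_sharp" "\<And>y. P y = periodization \<psi> y"
    and Q: "Q \<in> C_sharp" "\<And>y. Q y = periodization (\<lambda>y. (transpose R *v grad \<psi> y) $ i) y"
    by (rule test_function_periodizations[OF \<psi>, of R i]) (rule that)
  obtain B where B: "\<And>y. B \<le> norm y \<Longrightarrow> \<psi> y = 0" "\<And>y. B \<le> norm y \<Longrightarrow> grad \<psi> y = 0"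
    by (rule test_function_support[OF \<psi>]) (rule that)
  have \<psi>C: "C_k k \<psi>" for k using \<psi> by (simp add: test_functions_def)
  have c: "continuous_on UNIV (\<lambda>y. (transpose R *v grad \<psi> y) $ i)"
    unfolding transpose_mult_nth
    by (intro continuous_intros C_k_imp_continuous_grad(2)[OF \<psi>C])
  have z: "(transpose R *v grad \<psi> y) $ i = 0" if "B \<le> norm y" for y
    unfolding B(2)[OF that] by simp
  have "(LINT y|lebesgue. u y * (transpose R *v grad \<psi> y) $ i) = (LINT y|cell_measure. u y * Q y)"
    by (rule integral_unfold_periodization[OF u c z Q(2)])
  moreover have "(LINT y|lebesgue. g i y * \<psi> y) = (LINT y|cell_measure. g i y * P y)"
    by (rule integral_unfold_periodization[OF g(1-3) C_k_imp_continuous_grad(1)[OF \<psi>C] B(1) P(2)])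
  ultimately show "(LINT y|lebesgue. u y * (transpose R *v grad \<psi> y) $ i) = - (LINT y|lebesgue. (\<chi> i. g i y) $ i * \<psi> y)"
    using id[OF \<psi> P Q] by simp
qed

lemma norm_sq_vec: "(norm x)\<^sup>2 = (\<Sum>i\<in>UNIV. (x $ i)\<^sup>2)" for x :: "real^'n"
  by (simp add: norm_vec_def L2_set_def sum_nonneg)

lemma L2_component:
  fixes f :: "'a \<Rightarrow> real^'n"
  assumes "f \<in> L2 M"
  shows "(\<lambda>x. f x $ i) \<in> L2 M" "(LINT x|M. (f x $ i)\<^sup>2) \<le> (LINT x|M. (norm (f x))\<^sup>2)"
proof -
  have "(\<lambda>v :: real^'n. v $ i) \<in> borel_measurable borel"
    by (intro borel_measurable_continuous_onI continuous_intros)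
  from measurable_compose[OF L2_measurable[OF assms] this]
  have m: "(\<lambda>x. f x $ i) \<in> borel_measurable M" .
  have iN: "integrable M (\<lambda>x. (norm (f x))\<^sup>2)" using assms by (simp add: L2_def)
  have b: "(f x $ i)\<^sup>2 \<le> (norm (f x))\<^sup>2" for x
    unfolding norm_sq_vec by (rule member_le_sum) auto
  have ii: "integrable M (\<lambda>x. (f x $ i)\<^sup>2)"
    by (rule Bochner_Integration.integrable_bound[OF iN]) (use m b in auto)
  show "(\<lambda>x. f x $ i) \<in> L2 M" using m ii by (simp add: L2_def)
  show "(LINT x|M. (f x $ i)\<^sup>2) \<le> (LINT x|M. (norm (f x))\<^sup>2)" by (rule integral_mono[OF ii iN b])
qed

lemma L2_vecI:
  fixes f :: "'a \<Rightarrow> real^'n"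
  assumes "\<And>i. (\<lambda>x. f x $ i) \<in> L2 M"
  shows "f \<in> L2 M"
proof -
  have "(\<lambda>x. f x \<bullet> b) \<in> borel_measurable M" if "b \<in> Basis" for b
    using that assms by (auto simp: Basis_vec_def inner_axis L2_def)
  then have "f \<in> borel_measurable M" by (simp add: borel_measurable_euclidean_space[of f])
  moreover have "integrable M (\<lambda>x. (norm (f x))\<^sup>2)"
    unfolding norm_sq_vec using assms by (intro Bochner_Integration.integrable_sum L2_sq_integrable)
  ultimately show ?thesis by (simp add: L2_def)
qed

lemma L2_cong:
  fixes f g :: "'a \<Rightarrow> real"
  assumes "f \<in> L2 M" "\<And>x. x \<in> space M \<Longrightarrow> g x = f x"
  shows "g \<in> L2 M"
proof -
  have "g \<in> borel_measurable M"
    using assms measurable_cong[of M g f borel] by (simp add: L2_def)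
  moreover have "integrable M (\<lambda>x. (norm (g x))\<^sup>2)"
    using assms Bochner_Integration.integrable_cong[of M M "\<lambda>x. (norm (g x))\<^sup>2" "\<lambda>x. (norm (f x))\<^sup>2"] by (simp add: L2_def)
  ultimately show ?thesis by (simp add: L2_def)
qed

lemma periodic_extension_L2:
  assumes f: "f \<in> L2 cell_measure"
  shows "periodic_extension f \<in> L2 (lebesgue_on unit_cell)"
proof -
  have m: "periodic_extension f \<in> borel_measurable borel"
    using f by (intro periodic_extension_measurable) (simp add: L2_def)
  have "integrable lborel (\<lambda>y. indicator unit_cell y * (f y)\<^sup>2)"
    using L2_sq_integrable[OF f] by (simp add: cell_integrable_iff)
  moreover have "(\<lambda>y. (periodic_extension f y)\<^sup>2 * indicator unit_cell y) = (\<lambda>y. indicator unit_cell y * (f y)\<^sup>2)"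
    by (auto simp: indicator_def periodic_extension_cell)
  ultimately have "integrable lborel (\<lambda>y. (periodic_extension f y)\<^sup>2 * indicator unit_cell y)" by simp
  then have "integrable (lebesgue_on unit_cell) (\<lambda>y. (periodic_extension f y)\<^sup>2)"
    by (intro integrable_lborel_imp_lebesgue_on unit_cell_borel) (use m in measurable)
  then show ?thesis using borel_lebesgue_on[OF m] by (simp add: L2_def)
qed

theorem proposition7:
  fixes \<Omega> :: "(real^3) set"
    and R :: "real^3^'m"
    and \<eta> :: "nat \<Rightarrow> real"
    and u :: "nat \<Rightarrow> real^3 \<Rightarrow> real"
    and gu :: "nat \<Rightarrow> real^3 \<Rightarrow> real^3"
  assumes "open \<Omega>" and "bounded \<Omega>" and "lipschitz_boundary \<Omega>"
    and "CARD('m) > 3"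
    and "\<And>k :: int^'m. k \<noteq> 0 \<Longrightarrow> transpose R *v int_vec k \<noteq> 0"
    and "\<And>n. \<eta> n > 0" and "\<eta> \<longlonglongrightarrow> 0"
    and "\<And>n. u n \<in> L2 (lebesgue_on \<Omega>)"
    and "\<And>n. has_weak_grad \<Omega> (u n) (gu n)"
    and "\<And>n. (\<lambda>x. \<eta> n *\<^sub>R gu n x) \<in> L2 (lebesgue_on \<Omega>)"
    and "\<exists>C. \<forall>n. L2_norm (lebesgue_on \<Omega>) (u n) \<le> C"
    and "\<exists>C. \<forall>n. L2_norm (lebesgue_on \<Omega>) (\<lambda>x. \<eta> n *\<^sub>R gu n x) \<le> C"
  shows "\<exists>r u0 G. strict_mono r \<and>
    u0 \<in> L2_H_sharp R \<Omega> \<and>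
    u0 \<in> L2_L2_sharp \<Omega> \<and> G \<in> L2_L2_sharp \<Omega> \<and>
    (AE x in lebesgue_on \<Omega>. has_grad_R R (u0 x) (G x)) \<and>
    two_scale_converges R \<Omega> (\<eta> \<circ> r) (u \<circ> r) u0 \<and>
    two_scale_converges_vec R \<Omega> (\<eta> \<circ> r) (\<lambda>k x. \<eta> (r k) *\<^sub>R gu (r k) x) G"
proof -
  note \<Omega> = assms(1,2) and irr = assms(5) and \<eta> = assms(6,7) and uL = assms(8) and ug = assms(9) and gL = assms(10)
  interpret O: finite_measure "lebesgue_on \<Omega>" by (rule finite_lebesgue_on[OF \<Omega>])
  interpret Y: finite_measure "cell_measure :: (real^'m) measure" by (rule finite_cell_measure)
  interpret pair_sigma_finite "lebesgue_on \<Omega>" "cell_measure :: (real^'m) measure" ..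
  let ?M = "two_scale_measure \<Omega> :: ((real^3) \<times> (real^'m)) measure"
  have finM: "finite_measure ?M" by (rule finite_measure_pair_measure[OF finite_cell_measure O.finite_measure_axioms])
  obtain C1 where C1: "\<And>n. L2_norm (lebesgue_on \<Omega>) (u n) \<le> C1" using assms(11) by blast
  obtain C2 where C2: "\<And>n. L2_norm (lebesgue_on \<Omega>) (\<lambda>x. \<eta> n *\<^sub>R gu n x) \<le> C2" using assms(12) by blast
  have sq: "(LINT x|lebesgue_on \<Omega>. (norm (f x))\<^sup>2) \<le> C\<^sup>2" if "L2_norm (lebesgue_on \<Omega>) f \<le> C"
    for f :: "real^3 \<Rightarrow> 'b::real_normed_vector" and C
    using that unfolding L2_norm_def by (rule sqrt_le_D)
  \<comment> \<open>the functions and the components of the rescaled gradients as one family\<close>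
  define v where "v c n x = (case c of None \<Rightarrow> u n x | Some i \<Rightarrow> \<eta> n * gu n x $ i)" for c :: "3 option" and n x
  have v_eq: "v None n = u n" "v (Some i) n = (\<lambda>x. \<eta> n * gu n x $ i)" for n i
    by (simp_all add: v_def[abs_def])
  have vL: "v c n \<in> L2 (lebesgue_on \<Omega>)" for c n
    using uL L2_component(1)[OF gL, of n] by (cases c) (simp_all add: v_eq)
  have vB: "(LINT x|lebesgue_on \<Omega>. (v c n x)\<^sup>2) \<le> C1\<^sup>2 + C2\<^sup>2" for c n
  proof (cases c)
    case None
    then show ?thesis using sq[OF C1[of n]] by (simp add: v_eq add_increasing2)
  next
    case (Some i)
    then show ?thesis
      using order_trans[OF L2_component(2)[OF gL, of n i] sq[OF C2[of n]]] by (simp add: v_eq add_increasing)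
  qed
  obtain r and w :: "3 option \<Rightarrow> (real^3) \<times> (real^'m) \<Rightarrow> real" where r: "strict_mono (r :: nat \<Rightarrow> nat)"
    and w: "\<And>c. w c \<in> L2 ?M"
    and conv: "\<And>c \<phi>. \<phi> \<in> L2_C_sharp \<Omega> \<Longrightarrow>
      (\<lambda>n. LINT x|lebesgue_on \<Omega>. v c (r n) x * apply_bcontfun (\<phi> x) (phase R (\<eta> (r n)) x))
      \<longlonglongrightarrow> (LINT p|?M. w c p * apply_bcontfun (\<phi> (fst p)) (snd p))"
    by (rule two_scale_compactness[of R \<Omega> \<eta> v "\<lambda>_. C1\<^sup>2 + C2\<^sup>2", OF irr \<Omega> \<eta> vL vB]) (assumption, rule that)
  have \<eta>r: "\<And>n. \<eta> (r n) > 0" "(\<lambda>n. \<eta> (r n)) \<longlonglongrightarrow> 0"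
    using \<eta> LIMSEQ_subseq_LIMSEQ[OF \<eta>(2) r] by (auto simp: o_def)
  define U where "U c x = periodic_extension (\<lambda>y. w c (x, y))" for c x
  define G where "G x y = (\<chi> i. U (Some i) x y)" for x y
  have Uw: "U c x y = w c (x, y)" if "y \<in> unit_cell" for c x y
    unfolding U_def by (rule periodic_extension_cell[OF that])
  have UM: "(\<lambda>(x, y). U c x y) \<in> L2 ?M" for c
    by (rule L2_cong[OF w[of c]]) (auto simp: space_pair_measure Uw)
  have UL: "(\<lambda>(x, y). U c x y) \<in> L2 (lebesgue_on (\<Omega> \<times> unit_cell))" for c
    using UM[of c] two_scale_measure_lebesgue(1)[OF \<Omega> L2_measurable[OF UM[of c]]]
      two_scale_measure_lebesgue(2)[OF \<Omega> borel_measurable_integrable[OF L2_sq_integrable[OF UM[of c]]]]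
    by (simp add: L2_def)
  have GL: "(\<lambda>(x, y). G x y) \<in> L2 (lebesgue_on (\<Omega> \<times> unit_cell))"
    by (rule L2_vecI) (use UL in \<open>simp add: G_def case_prod_beta'\<close>)
  have sec: "AE x in lebesgue_on \<Omega>. (\<lambda>y. w c (x, y)) \<in> L2 cell_measure" for c
  proof -
    have "AE x in lebesgue_on \<Omega>. integrable cell_measure (\<lambda>y. (w c (x, y))\<^sup>2)"
      by (rule AE_integrable_fst'[OF L2_sq_integrable[OF w]])
    then show ?thesis
    proof (rule AE_mp, intro AE_I2 impI)
      fix x assume "x \<in> space (lebesgue_on \<Omega>)" "integrable cell_measure (\<lambda>y. (w c (x, y))\<^sup>2)"
      then show "(\<lambda>y. w c (x, y)) \<in> L2 cell_measure"
        using measurable_Pair2[OF L2_measurable[OF w[of c]]] by (simp add: L2_def)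
    qed
  qed
  have secs: "AE x in lebesgue_on \<Omega>. \<forall>c. (\<lambda>y. w c (x, y)) \<in> L2 cell_measure"
    using sec by (simp add: AE_all_countable)
  have US: "U c x \<in> L2_sharp" if "(\<lambda>y. w c (x, y)) \<in> L2 cell_measure" for c x
    using periodic_extension_L2[OF that] by (simp add: L2_sharp_def U_def periodic_extension_periodic)
  have GS: "G x \<in> L2_sharp" if "\<forall>c. (\<lambda>y. w c (x, y)) \<in> L2 cell_measure" for x
  proof -
    have "G x \<in> L2 (lebesgue_on unit_cell)"
      by (rule L2_vecI) (use US that in \<open>simp add: G_def L2_sharp_def\<close>)
    moreover have "cell_periodic (G x)"
      by (simp add: cell_periodic_def G_def U_def periodic_extension_def cell_frac_periodic)
    ultimately show ?thesis by (simp add: L2_sharp_def)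
  qed
  \<comment> \<open>the pairs against which the two limits have to be compared, one set for each component\<close>
  define E where "E i = {(P, Q). P \<in> C_sharp \<and> Q \<in> C_sharp \<and> (\<exists>\<psi>\<in>test_functions UNIV. (\<forall>y. apply_bcontfun P y = periodization \<psi> y) \<and>
    (\<forall>y. apply_bcontfun Q y = periodization (\<lambda>y. (transpose R *v grad \<psi> y) $ i) y))}" for i
  have id: "AE x in lebesgue_on \<Omega>. \<forall>(P, Q)\<in>E i. (LINT y|cell_measure. w (Some i) (x, y) * apply_bcontfun P y) + (LINT y|cell_measure. w None (x, y) * apply_bcontfun Q y) = 0" for i
  proof (rule AE_all_C_sharp_pairs[OF \<Omega> w w])
    show "E i \<subseteq> C_sharp \<times> C_sharp" by (auto simp: E_def)
    fix P Q assume "(P, Q) \<in> E i"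
    then obtain \<psi> where PQ: "P \<in> C_sharp" "Q \<in> C_sharp" and \<psi>: "\<psi> \<in> test_functions UNIV"
      and P: "\<And>y. apply_bcontfun P y = periodization \<psi> y"
      and Q: "\<And>y. apply_bcontfun Q y = periodization (\<lambda>y. (transpose R *v grad \<psi> y) $ i) y"
      unfolding E_def by blast
    have gi: "(\<lambda>x. \<eta> (r n) * gu (r n) x $ i) \<in> L2 (lebesgue_on \<Omega>)" for n
      using vL[of "Some i" "r n"] by (simp add: v_eq)
    show "AE x in lebesgue_on \<Omega>. (LINT y|cell_measure. w (Some i) (x, y) * apply_bcontfun P y + w None (x, y) * apply_bcontfun Q y) = 0"
    proof (rule two_scale_gradient_identity[of \<Omega> "\<lambda>n. \<eta> (r n)" "\<lambda>n. u (r n)" "\<lambda>n. gu (r n)" i "w None" "w (Some i)" R,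
          OF \<Omega> \<eta>r ug uL gi w w _ _ \<psi> PQ(1) P PQ(2) Q])
      fix \<phi> :: "real^3 \<Rightarrow> ((real^'m) \<Rightarrow>\<^sub>C real)" assume \<phi>: "\<phi> \<in> L2_C_sharp \<Omega>"
      show "(\<lambda>n. LINT x|lebesgue_on \<Omega>. u (r n) x * apply_bcontfun (\<phi> x) (phase R (\<eta> (r n)) x))
        \<longlonglongrightarrow> (LINT p|?M. w None p * apply_bcontfun (\<phi> (fst p)) (snd p))"
        using conv[OF \<phi>, of None] by (simp add: v_eq)
      show "(\<lambda>n. LINT x|lebesgue_on \<Omega>. (\<eta> (r n) * gu (r n) x $ i) * apply_bcontfun (\<phi> x) (phase R (\<eta> (r n)) x))
        \<longlonglongrightarrow> (LINT p|?M. w (Some i) p * apply_bcontfun (\<phi> (fst p)) (snd p))"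
        using conv[OF \<phi>, of "Some i"] by (simp add: v_eq)
    qed
  qed
  then have ids: "AE x in lebesgue_on \<Omega>. \<forall>i. \<forall>(P, Q)\<in>E i.
      (LINT y|cell_measure. w (Some i) (x, y) * apply_bcontfun P y) + (LINT y|cell_measure. w None (x, y) * apply_bcontfun Q y) = 0"
    by (simp add: AE_all_countable)
  have grad: "AE x in lebesgue_on \<Omega>. has_grad_R R (U None x) (G x)"
    using ids secs
  proof eventually_elim
    fix x
    assume id: "\<forall>i. \<forall>(P, Q)\<in>E i. (LINT y|cell_measure. w (Some i) (x, y) * apply_bcontfun P y) + (LINT y|cell_measure. w None (x, y) * apply_bcontfun Q y) = 0"
      and wx: "\<forall>c. (\<lambda>y. w c (x, y)) \<in> L2 cell_measure"
    have per: "cell_periodic (U c x)" for c unfolding U_def by (rule periodic_extension_periodic)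
    have meas: "U c x \<in> borel_measurable borel" for c
      unfolding U_def using wx by (intro periodic_extension_measurable) (simp add: L2_def)
    have int: "integrable cell_measure (U c x)" for c
      unfolding U_def using wx by (intro periodic_extension_integrable integral_abs_le_L2(1)[OF finite_cell_measure]) simp
    show "has_grad_R R (U None x) (G x)"
      unfolding G_def
    proof (rule has_grad_R_periodicI[OF per meas int per meas int])
      fix \<psi> :: "real^'m \<Rightarrow> real" and i and P Q :: "(real^'m) \<Rightarrow>\<^sub>C real"
      assume "\<psi> \<in> test_functions UNIV" "P \<in> C_sharp" "\<And>y. P y = periodization \<psi> y" "Q \<in> C_sharp"
        "\<And>y. Q y = periodization (\<lambda>y. (transpose R *v grad \<psi> y) $ i) y"
      then have "(P, Q) \<in> E i" by (auto simp: E_def)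
      then show "(LINT y|cell_measure. U (Some i) x y * apply_bcontfun P y) + (LINT y|cell_measure. U None x y * apply_bcontfun Q y) = 0"
        using id unfolding U_def cell_integral_extension by blast
    qed
  qed
  have u0: "U None \<in> L2_L2_sharp \<Omega>"
    unfolding L2_L2_sharp_def using UL secs by (auto intro: US elim!: AE_mp)
  have G0: "G \<in> L2_L2_sharp \<Omega>"
    unfolding L2_L2_sharp_def using GL secs by (auto intro: GS elim!: AE_mp)
  have H: "U None \<in> L2_H_sharp R \<Omega>"
  proof -
    have "AE x in lebesgue_on \<Omega>. U None x \<in> H_sharp R \<and> has_grad_R R (U None x) (G x)"
      using grad secs by eventually_elim (auto simp: H_sharp_def intro: US GS)
    then show ?thesis using u0 G0 unfolding L2_H_sharp_def by blast
  qed
  have two: "two_scale_converges R \<Omega> (\<eta> \<circ> r) (\<lambda>n. v c (r n)) (U c)" for c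
    unfolding two_scale_converges_def
  proof (intro conjI allI ballI)
    show "v c (r n) \<in> L2 (lebesgue_on \<Omega>)" for n by (rule vL)
    show "(\<lambda>(x, y). U c x y) \<in> L2 (lebesgue_on (\<Omega> \<times> unit_cell))" by (rule UL)
    fix \<phi> :: "real^3 \<Rightarrow> ((real^'m) \<Rightarrow>\<^sub>C real)" assume \<phi>: "\<phi> \<in> L2_C_sharp \<Omega>"
    have \<phi>2: "(\<lambda>p. apply_bcontfun (\<phi> (fst p)) (snd p)) \<in> L2 ?M"
      using \<phi> by (intro two_scale_lift_L2(1)[OF \<Omega>]) (auto simp: L2_C_sharp_def)
    have m: "(\<lambda>(x, y). U c x y * apply_bcontfun (\<phi> x) y) \<in> borel_measurable ?M"
      using borel_measurable_times[OF L2_measurable[OF UM[of c]] L2_measurable[OF \<phi>2]]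
      by (simp add: case_prod_beta')
    have "(LINT (x, y)|lebesgue_on (\<Omega> \<times> unit_cell). U c x y * apply_bcontfun (\<phi> x) y)
        = (LINT (x, y)|?M. U c x y * apply_bcontfun (\<phi> x) y)"
      by (rule two_scale_measure_lebesgue(3)[OF \<Omega> m])
    also have "\<dots> = (LINT p|?M. w c p * apply_bcontfun (\<phi> (fst p)) (snd p))"
      by (rule Bochner_Integration.integral_cong) (auto simp: space_pair_measure Uw)
    finally show "(\<lambda>n. LINT x|lebesgue_on \<Omega>. v c (r n) x * apply_bcontfun (\<phi> x) ((1 / (\<eta> \<circ> r) n) *\<^sub>R (R *v x)))
        \<longlonglongrightarrow> (LINT (x, y)|lebesgue_on (\<Omega> \<times> unit_cell). U c x y * apply_bcontfun (\<phi> x) y)"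
      using conv[OF \<phi>, of c] by simp
  qed
  have t1: "two_scale_converges R \<Omega> (\<eta> \<circ> r) (u \<circ> r) (U None)"
    using two[of None] by (simp add: v_eq comp_def)
  have t2: "two_scale_converges_vec R \<Omega> (\<eta> \<circ> r) (\<lambda>k x. \<eta> (r k) *\<^sub>R gu (r k) x) G"
    unfolding two_scale_converges_vec_def
  proof
    fix i show "two_scale_converges R \<Omega> (\<eta> \<circ> r) (\<lambda>n x. (\<eta> (r n) *\<^sub>R gu (r n) x) $ i) (\<lambda>x y. G x y $ i)"
      using two[of "Some i"] by (simp add: v_eq G_def)
  qed
  show ?thesis
    by (intro exI[of _ r] exI[of _ "U None"] exI[of _ G] conjI r H u0 G0 grad t1 t2)
qed

end
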